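(* Let $\varphi\in L^{2}(\mathbb{H}^{n})$ satisfy condition C and $\frac{1}{G^{\varphi}_{0,0}}\in L^{1}(0,1]$. If any one of the following equivalent conditions holds: (a) $\{L_{(2k,l,m)}\varphi:(k,l,m)\in\mathbb{Z}^{2n+1}\}$ is Hilbertian; (b) $\|G^{\varphi}_{0,0}\|_{\infty}<\infty$; (c) $\{L_{(2k,l,m)}\varphi:(k,l,m)\in\mathbb{Z}^{2n+1}\}$ is a Bessel sequence; then there exists $\tilde{\varphi}\in V(\varphi)$ such that $\{L_{(2k,l,m)}\tilde{\varphi}:(k,l,m)\in\mathbb{Z}^{2n+1}\}$ is Besselian. Moreover, if $\{L_{(2k,l,m)}\varphi:(k,l,m)\in\mathbb{Z}^{2n+1}\}$ is Besselian and if for each $\psi\in V(\varphi)$ there exists a sequence $\{c_{k,l,m}\}$ of complex numbers such that $\psi=\sum_{(k,l,m)\in\mathbb{Z}^{2n+1}}c_{k,l,m}L_{(2k,l,m)}\varphi$, then $\left\|\frac{1}{G^{\varphi}_{0,0}}\right\|_{\infty}<\infty$.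
   Context: The Heisenberg group $\mathbb{H}^{n}$ is $\mathbb{R}^{n}\times\mathbb{R}^{n}\times\mathbb{R}$ with group law $(x,y,t)(x',y',t')=(x+x',y+y',t+t'+\frac12(x'\cdot y-y'\cdot x))$ and Haar measure $dx\,dy\,dt$. Left translation: $L_{h}\varphi(X)=\varphi(h^{-1}X)$. In $(k,l,m)\in\mathbb{Z}^{2n+1}$, $k,l\in\mathbb{Z}^n$ and $m\in\mathbb{Z}$. For $\varphi\in L^{2}(\mathbb{H}^{n})$, $V(\varphi)$ is the closed linear span in $L^2(\mathbb{H}^n)$ of $\{L_{(2k,l,m)}\varphi:k,l\in\mathbb{Z}^{n},m\in\mathbb{Z}\}$. For $\lambda\in\mathbb{R}^{\star}=\mathbb{R}\setminus\{0\}$, $\pi_{\lambda}(x,y,t)$ acts on $\phi\in L^{2}(\mathbb{R}^{n})$ by $\pi_{\lambda}(x,y,t)\phi(\xi)=e^{2\pi i\lambda t}e^{2\pi i\lambda(x\cdot\xi+\frac12x\cdot y)}\phi(\xi+y)$. The group Fourier transform is $\widehat{f}(\lambda)=\int_{\mathbb{H}^{n}}f(x,y,t)\pi_{\lambda}(x,y,t)\,dx\,dy\,dt$ for $f\in L^{1}(\mathbb{H}^{n})$, extended to an isometric isomorphism of $L^{2}(\mathbb{H}^{n})$ onto $L^{2}(\mathbb{R}^{\star},\mathcal{B}_{2};|\lambda|^{n}d\lambda)$, where $\mathcal{B}_{2}$ is the space of Hilbert–Schmidt operators on $L^{2}(\mathbb{R}^{n})$. For $(k,l)\in\mathbb{Z}^{2n}$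 and $\lambda\in(0,1]$, $G^{\varphi}_{k,l}(\lambda)=\sum_{r\in\mathbb{Z}}\langle\widehat{\varphi}(\lambda+r),\widehat{L_{(2k,l,0)}\varphi}(\lambda+r)\rangle_{\mathcal{B}_{2}}|\lambda+r|^{n}$; $1/G^{\varphi}_{0,0}$ is $+\infty$ where $G^{\varphi}_{0,0}=0$, and $\|\cdot\|_\infty$ is the $L^\infty(0,1]$ norm. Condition C: $G^{\varphi}_{k,l}(\lambda)=0$ for a.e. $\lambda\in(0,1]$, for all $(k,l)\in\mathbb{Z}^{2n}\setminus\{(0,0)\}$. A family $\{f_{j}:j\in\mathbb{Z}^{d}\}$ in a Hilbert space $\mathcal{H}$ is Hilbertian if $\{c_{j}\}\in\ell^{2}(\mathbb{Z}^{d})$ implies that $\sum_{j\in\mathbb{Z}^{d}}c_{j}f_{j}$ converges; it is Besselian if convergence of $\sum_{j\in\mathbb{Z}^{d}}c_{j}f_{j}$ implies $\{c_{j}\}\in\ell^{2}(\mathbb{Z}^{d})$; it is a Bessel sequence if there is $B>0$ with $\sum_{j}|\langle f,f_{j}\rangle|^{2}\le B\|f\|^{2}$ for all $f\in\mathcal{H}$. Convergence of a series over $\mathbb{Z}^{d}$ means norm convergence in $\mathcal{H}$ of the partial sums over $\{j:\max_i|j_i|\le N\}$ as $N\to\infty$. *)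

theory Defs
  imports "HOL-Analysis.Analysis" "HOL-Probability.Essential_Supremum"
begin

section \<open>Square-integrable functions\<close>

text \<open>
  Elements of \<open>L\<^sup>2(M)\<close> are represented by measurable functions; equality in \<open>L\<^sup>2(M)\<close> is equality
  almost everywhere. The norm is only meaningful on \<open>l2_space M\<close> (elsewhere the Bochner
  integral may default to 0).
\<close>

definition l2_space :: "'a measure \<Rightarrow> ('a \<Rightarrow> complex) set" where
  "l2_space M = {f \<in> borel_measurable M. integrable M (\<lambda>x. (cmod (f x))\<^sup>2)}"

definition l2_inner :: "'a measure \<Rightarrow> ('a \<Rightarrow> complex) \<Rightarrow> ('a \<Rightarrow> complex) \<Rightarrow> complex" where
  "l2_inner M f g = (LINT x|M. f x * cnj (g x))"

definition l2_norm :: "'a measure \<Rightarrow> ('a \<Rightarrow> complex) \<Rightarrow> real" where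
  "l2_norm M f = sqrt (LINT x|M. (cmod (f x))\<^sup>2)"


section \<open>The Heisenberg group\<close>

type_synonym 'n heis = "(real^'n) \<times> (real^'n) \<times> real"

text \<open>The Haar measure \<open>dx dy dt\<close> is \<open>lborel\<close> on this product space.\<close>

fun heis_mult :: "'n::finite heis \<Rightarrow> 'n heis \<Rightarrow> 'n heis" where
  "heis_mult (x, y, t) (x', y', t') = (x + x', y + y', t + t' + (x' \<bullet> y - y' \<bullet> x) / 2)"

fun heis_inv :: "'n::finite heis \<Rightarrow> 'n heis" where
  "heis_inv (x, y, t) = (- x, - y, - t)"

lemma heis_mult_inv:
  "heis_mult h (heis_inv h) = (0, 0, 0)" "heis_mult (heis_inv h) h = (0, 0, 0)"
  by (cases h; simp add: inner_commute)+

definition left_translate :: "'n::finite heis \<Rightarrow> ('n heis \<Rightarrow> complex) \<Rightarrow> 'n heis \<Rightarrow> complex" where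
  "left_translate h \<phi> = (\<lambda>X. \<phi> (heis_mult (heis_inv h) X))"

text \<open>The type \<open>'n idx\<close> is \<open>\<int>\<^sup>n \<times> \<int>\<^sup>n \<times> \<int> = \<int>\<^bsup>2n+1\<^esup>\<close>.\<close>

type_synonym 'n idx = "(int^'n) \<times> (int^'n) \<times> int"

definition of_int_vec :: "int^'n \<Rightarrow> real^'n" where
  "of_int_vec k = (\<chi> i. real_of_int (k $ i))"

text \<open>The system \<open>L\<^bsub>(2k,l,m)\<^esub> \<phi>\<close>; note the factor 2 in the first component only.\<close>

fun translates :: "('n::finite heis \<Rightarrow> complex) \<Rightarrow> 'n idx \<Rightarrow> 'n heis \<Rightarrow> complex" where
  "translates \<phi> (k, l, m) =
     left_translate (2 *\<^sub>R of_int_vec k, of_int_vec l, real_of_int m) \<phi>"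

definition V_space :: "('n::finite heis \<Rightarrow> complex) \<Rightarrow> ('n heis \<Rightarrow> complex) set" where
  "V_space \<phi> = {f \<in> l2_space lborel. \<forall>\<epsilon>>0. \<exists>J c. finite J \<and>
     l2_norm lborel (\<lambda>X. f X - (\<Sum>j\<in>J. c j * translates \<phi> j X)) < \<epsilon>}"


section \<open>Families indexed by the integer lattice\<close>

definition cube :: "nat \<Rightarrow> ('n::finite) idx set" where
  "cube N = {(k, l, m). (\<forall>i. \<bar>k $ i\<bar> \<le> int N) \<and> (\<forall>i. \<bar>l $ i\<bar> \<le> int N) \<and> \<bar>m\<bar> \<le> int N}"

definition l2_sums ::
  "'a measure \<Rightarrow> ('n::finite idx \<Rightarrow> 'a \<Rightarrow> complex) \<Rightarrow> ('n idx \<Rightarrow> complex) \<Rightarrow> ('a \<Rightarrow> complex) \<Rightarrow> bool" where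
  "l2_sums M f c s \<longleftrightarrow> s \<in> l2_space M \<and>
     (\<lambda>N. l2_norm M (\<lambda>x. (\<Sum>j\<in>cube N. c j * f j x) - s x)) \<longlonglongrightarrow> 0"

definition ell2 :: "('i \<Rightarrow> complex) set" where
  "ell2 = {c. (\<lambda>j. (cmod (c j))\<^sup>2) summable_on UNIV}"

definition hilbertian :: "'a measure \<Rightarrow> ('n::finite idx \<Rightarrow> 'a \<Rightarrow> complex) \<Rightarrow> bool" where
  "hilbertian M f \<longleftrightarrow> (\<forall>c. c \<in> ell2 \<longrightarrow> (\<exists>s. l2_sums M f c s))"

definition besselian :: "'a measure \<Rightarrow> ('n::finite idx \<Rightarrow> 'a \<Rightarrow> complex) \<Rightarrow> bool" where
  "besselian M f \<longleftrightarrow> (\<forall>c. (\<exists>s. l2_sums M f c s) \<longrightarrow> c \<in> ell2)"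

definition bessel_sequence :: "'a measure \<Rightarrow> ('n::finite idx \<Rightarrow> 'a \<Rightarrow> complex) \<Rightarrow> bool" where
  "bessel_sequence M f \<longleftrightarrow> (\<exists>B>0. \<forall>g\<in>l2_space M.
     (\<lambda>j. (cmod (l2_inner M g (f j)))\<^sup>2) summable_on UNIV \<and>
     (\<Sum>\<^sub>\<infinity>j. (cmod (l2_inner M g (f j)))\<^sup>2) \<le> B * (l2_norm M g)\<^sup>2)"


section \<open>Hilbert--Schmidt operators on \<open>L\<^sup>2(\<real>\<^sup>n)\<close>\<close>

text \<open>Operators act on representatives; linearity and boundedness together make them respect
  equality almost everywhere. Only their values on \<open>l2_space lborel\<close> matter.\<close>

type_synonym 'n op = "(real^'n \<Rightarrow> complex) \<Rightarrow> (real^'n \<Rightarrow> complex)"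

definition bounded_op :: "'n::finite op \<Rightarrow> bool" where
  "bounded_op T \<longleftrightarrow>
     (\<forall>u\<in>l2_space lborel. T u \<in> l2_space lborel) \<and>
     (\<forall>u\<in>l2_space lborel. \<forall>v\<in>l2_space lborel. \<forall>a b.
        AE \<xi> in lborel. T (\<lambda>\<eta>. a * u \<eta> + b * v \<eta>) \<xi> = a * T u \<xi> + b * T v \<xi>) \<and>
     (\<exists>B. \<forall>u\<in>l2_space lborel. l2_norm lborel (T u) \<le> B * l2_norm lborel u)"

definition orthonormal_basis :: "(nat \<Rightarrow> real^'n::finite \<Rightarrow> complex) \<Rightarrow> bool" where
  "orthonormal_basis e \<longleftrightarrow>
     (\<forall>j. e j \<in> l2_space lborel) \<and>
     (\<forall>i j. l2_inner lborel (e i) (e j) = (if i = j then 1 else 0)) \<and>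
     (\<forall>u\<in>l2_space lborel. (\<forall>j. l2_inner lborel u (e j) = 0) \<longrightarrow> (AE \<xi> in lborel. u \<xi> = 0))"

text \<open>The Hilbert--Schmidt norm and inner product do not depend on the basis; one is fixed
  once and for all.\<close>

definition the_basis :: "nat \<Rightarrow> real^'n::finite \<Rightarrow> complex" where
  "the_basis = (SOME e. orthonormal_basis e)"

definition hs_norm_sq :: "'n::finite op \<Rightarrow> ennreal" where
  "hs_norm_sq T = (\<Sum>j. \<integral>\<^sup>+\<xi>. ennreal ((cmod (T (the_basis j) \<xi>))\<^sup>2) \<partial>lborel)"

definition hilbert_schmidt :: "'n::finite op \<Rightarrow> bool" where
  "hilbert_schmidt T \<longleftrightarrow> bounded_op T \<and> hs_norm_sq T < \<infinity>"

definition hs_inner :: "'n::finite op \<Rightarrow> 'n op \<Rightarrow> complex" where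
  "hs_inner S T = (\<Sum>j. l2_inner lborel (S (the_basis j)) (T (the_basis j)))"


section \<open>The group Fourier transform\<close>

text \<open>The spectral parameter \<open>\<lambda>\<close> is written \<open>s\<close>, and \<open>\<pi>\<^bsub>\<lambda>\<^esub>(X)\<close> is \<open>schroedinger s X\<close>.\<close>

fun schroedinger :: "real \<Rightarrow> 'n::finite heis \<Rightarrow> 'n op" where
  "schroedinger s (x, y, t) u =
     (\<lambda>\<xi>. exp (2 * complex_of_real pi * \<i> * complex_of_real (s * t)) *
          exp (2 * complex_of_real pi * \<i> * complex_of_real (s * (x \<bullet> \<xi> + (x \<bullet> y) / 2))) * u (\<xi> + y))"

text \<open>For integrable \<open>f\<close>, the operator-valued integral of \<open>f(X) \<pi>\<^bsub>\<lambda>\<^esub>(X)\<close> over the group is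
  understood, as usual, in the weak sense; it determines the operator uniquely (up to equality
  almost everywhere of its values).\<close>

definition fourier_L1 :: "('n::finite heis \<Rightarrow> complex) \<Rightarrow> real \<Rightarrow> 'n op" where
  "fourier_L1 f s = (SOME T. bounded_op T \<and>
     (\<forall>u\<in>l2_space lborel. \<forall>v\<in>l2_space lborel.
        l2_inner lborel (T u) v = (LINT X|lborel. f X * l2_inner lborel (schroedinger s X u) v)))"

text \<open>The measure \<open>|\<lambda>|\<^sup>n d\<lambda>\<close> on the nonzero reals.\<close>

definition plancherel_measure :: "nat \<Rightarrow> real measure" where
  "plancherel_measure n = density (restrict_space lborel (- {0})) (\<lambda>s. ennreal (\<bar>s\<bar> ^ n))"

text \<open>\<open>L\<^sup>2\<close>-fields of Hilbert--Schmidt operators on the nonzero reals. Measurability is weak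
  measurability, which is the same as strong measurability because the space of
  Hilbert--Schmidt operators is separable.\<close>

definition hs_fields :: "(real \<Rightarrow> 'n::finite op) set" where
  "hs_fields = {F.
     (\<forall>s. s \<noteq> 0 \<longrightarrow> hilbert_schmidt (F s)) \<and>
     (\<forall>u\<in>l2_space lborel. \<forall>v\<in>l2_space lborel.
        (\<lambda>s. l2_inner lborel (F s u) v) \<in> borel_measurable (plancherel_measure CARD('n))) \<and>
     (\<integral>\<^sup>+s. hs_norm_sq (F s) \<partial>plancherel_measure CARD('n)) < \<infinity>}"

text \<open>Extension to \<open>L\<^sup>2\<close> by continuity: \<open>F\<close> is the transform of \<open>f\<close> when it is the limit, in the
  space of \<open>L\<^sup>2\<close>-fields, of the transforms of functions in \<open>L\<^sup>1 \<inter> L\<^sup>2\<close> approximating \<open>f\<close>. This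
  determines \<open>F\<close> up to equality almost everywhere.\<close>

definition is_fourier_L2 :: "('n::finite heis \<Rightarrow> complex) \<Rightarrow> (real \<Rightarrow> 'n op) \<Rightarrow> bool" where
  "is_fourier_L2 f F \<longleftrightarrow> F \<in> hs_fields \<and>
     (\<exists>g. (\<forall>k::nat. g k \<in> l2_space lborel \<and> integrable lborel (g k)) \<and>
          (\<lambda>k. l2_norm lborel (\<lambda>X. g k X - f X)) \<longlonglongrightarrow> 0 \<and>
          (\<lambda>k. \<integral>\<^sup>+s. hs_norm_sq (\<lambda>u \<xi>. fourier_L1 (g k) s u \<xi> - F s u \<xi>)
                 \<partial>plancherel_measure CARD('n)) \<longlonglongrightarrow> 0)"

definition fourier :: "('n::finite heis \<Rightarrow> complex) \<Rightarrow> real \<Rightarrow> 'n op" where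
  "fourier f = (SOME F. is_fourier_L2 f F)"


section \<open>The functions \<open>G\<^bsub>k,l\<^esub>\<close>\<close>

text \<open>The series converges absolutely for almost every \<open>s\<close> in \<open>(0,1]\<close>. At \<open>s = 1\<close> the
  term \<open>r = -1\<close>, where the transform is not defined, has weight \<open>0\<close>.\<close>

definition G :: "('n::finite heis \<Rightarrow> complex) \<Rightarrow> int^'n \<Rightarrow> int^'n \<Rightarrow> real \<Rightarrow> complex" where
  "G \<phi> k l s = (\<Sum>\<^sub>\<infinity>r::int.
     hs_inner (fourier \<phi> (s + real_of_int r)) (fourier (translates \<phi> (k, l, 0)) (s + real_of_int r)) *
     complex_of_real (\<bar>s + real_of_int r\<bar> ^ CARD('n)))"

abbreviation unit_interval :: "real measure" where
  "unit_interval \<equiv> restrict_space lborel {0<..1}"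

definition condition_C :: "('n::finite heis \<Rightarrow> complex) \<Rightarrow> bool" where
  "condition_C \<phi> \<longleftrightarrow> (\<forall>k l. (k, l) \<noteq> (0, 0) \<longrightarrow> (AE s in unit_interval. G \<phi> k l s = 0))"

text \<open>\<open>G\<^bsub>0,0\<^esub>\<close> is nonnegative; passing to its modulus makes it a function into \<open>[0,\<infinity>]\<close>, where
  \<open>inverse 0 = \<infinity>\<close>.\<close>

definition G00 :: "('n::finite heis \<Rightarrow> complex) \<Rightarrow> real \<Rightarrow> ennreal" where
  "G00 \<phi> s = ennreal (cmod (G \<phi> 0 0 s))"

definition integrable_unit :: "(real \<Rightarrow> ennreal) \<Rightarrow> bool" where
  "integrable_unit h \<longleftrightarrow>
     h \<in> borel_measurable unit_interval \<and> (\<integral>\<^sup>+s. h s \<partial>unit_interval) < \<infinity>"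

definition Linf_norm :: "(real \<Rightarrow> ennreal) \<Rightarrow> ennreal" where
  "Linf_norm h = esssup unit_interval h"

end

theory Submission
  imports Defs
begin

text \<open>
  Write \<open>w = G\<^bsub>0,0\<^esub>\<close>. The group Fourier transform enters through a single identity: for square-integrable
  \<open>f\<close> and \<open>g\<close>, the periodization over \<open>r \<in> \<int>\<close> of the Hilbert--Schmidt inner products of the transforms at \<open>s + r\<close>,
  with weight \<open>|s + r|\<^sup>n\<close>, is integrable on \<open>(0,1]\<close>, and its Fourier coefficients are the inner products of
  \<open>f\<close> with the central integer translates of \<open>g\<close> (\<open>fourier_periodization\<close>). The points
  \<open>(2k,l,m)\<close> form a subgroup and \<open>(2k,l,m) = (0,0,m)(2k,l,0)\<close>, so condition C says that translates
  with different \<open>(k,l)\<close> are orthogonal, while for fixed \<open>(k,l)\<close> the translates have the Gram matrix of the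
  exponentials in \<open>L\<^sup>2((0,1], w ds)\<close> (\<open>translates_gram\<close>). What remains is a statement about exponentials
  in a weighted space on the circle.

  If the family is Hilbertian, take any \<open>u\<close> in \<open>L\<^sup>2(0,1]\<close>. The partial sums of its Fourier series are bounded in
  the weighted space and converge to \<open>u\<close> almost everywhere along a subsequence, hence \<open>\<integral>|u|\<^sup>2 w < \<infinity>\<close>
  by Fatou. A function that has a finite integral against every integrable density is essentially bounded
  (\<open>AE_bounded_by_duality\<close>), so \<open>w\<close> is bounded. A bounded weight bounds the synthesis operator, which gives both the
  Hilbertian and, by adjunction, the Bessel property; and a Bessel bound gives back a bound for synthesis.

  If \<open>w\<close> is bounded, the multiplier \<open>w\<^bsup>-1/2\<^esup>\<close> lies in \<open>L\<^sup>2(0,1]\<close> because \<open>1/w\<close> is integrable. Its Fourier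
  series, applied to the central translates of \<open>\<phi>\<close>, defines an element of \<open>V(\<phi>)\<close> whose weight is
  identically 1: its translates are orthonormal, and an orthonormal family is Besselian
  (\<open>exists_orthonormal_translates\<close>).

  For the last assertion let \<open>q \<ge> 0\<close> be integrable and \<open>h = (q/w)\<^bsup>1/2\<^esup>\<close>, an element of the weighted space. It is a
  limit of trigonometric polynomials, so it corresponds to some \<open>\<psi> \<in> V(\<phi>)\<close>. The coefficients of an
  expansion of \<open>\<psi>\<close> are square summable, and those with \<open>k = l = 0\<close> give sums that tend to \<open>h\<close> in the weighted
  space and stay bounded in \<open>L\<^sup>2(0,1]\<close>. By Fatou \<open>\<integral>q/w < \<infinity>\<close>, and duality bounds \<open>1/w\<close>
  (\<open>besselian_bounded_inverse_weight\<close>).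

  The periodization identity is proved in coordinates. Let \<open>\<Phi>(y,(a,\<lambda>))\<close> be the Euclidean Fourier transform of
  \<open>f(x,y,t)\<close> in \<open>(x,t)\<close>. The transform of \<open>f\<close> at \<open>\<lambda>\<close> is the integral operator with kernel
  \<open>\<Phi>(\<eta> - \<xi>, (\<lambda>(\<xi> + \<eta>)/2, \<lambda>))\<close>. By Parseval for an orthonormal basis, Hilbert--Schmidt inner products are
  inner products of kernels; the change of variables \<open>(\<xi>,\<eta>) \<mapsto> (\<eta> - \<xi>, \<lambda>(\<xi> + \<eta>)/2)\<close> has Jacobian
  \<open>|\<lambda>|\<^sup>n\<close>, which is the Plancherel weight. Hence the weighted inner product at \<open>\<lambda>\<close> is an integral of
  \<open>\<Phi>\<close> against the conjugate of \<open>\<Psi>\<close> over \<open>(y,a)\<close>, and integrating it against \<open>e\<^bsup>-2\<pi>im\<lambda>\<^esup>\<close> is the Euclidean Plancherel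
  theorem for \<open>f\<close> and a central translate of \<open>g\<close>.

  The analysis underneath rests on Fourier series on the unit box, through the density of the trigonometric
  polynomials in \<open>L\<^sup>2\<close> of any finite measure on the box (\<open>trigonometric_spanning\<close>), an orthonormal basis of
  \<open>L\<^sup>2(\<real>\<^sup>n)\<close>, and the Euclidean Plancherel theorem, which follows from two applications of Parseval on the box
  to \<open>P(\<xi>,x) = \<Sum>\<^bsub>k\<^esub> f(x + k) e\<^bsup>2\<pi>i\<xi>\<cdot>(x + k)\<^esup>\<close> (\<open>plancherel_L1_L2\<close>).
\<close>

section \<open>Square-integrable functions\<close>

lemma measurable_cnj [measurable]: "cnj \<in> borel_measurable borel"
  by (intro borel_measurable_continuous_onI continuous_intros)

lemma l2_measurable: "f \<in> l2_space M \<Longrightarrow> f \<in> borel_measurable M"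
  by (simp add: l2_space_def)

lemma l2_integrable_sq: "f \<in> l2_space M \<Longrightarrow> integrable M (\<lambda>x. (cmod (f x))\<^sup>2)"
  by (simp add: l2_space_def)

abbreviation nn_sq :: "'a measure \<Rightarrow> ('a \<Rightarrow> complex) \<Rightarrow> ennreal" where
  "nn_sq M f \<equiv> (\<integral>\<^sup>+x. ennreal ((cmod (f x))\<^sup>2) \<partial>M)"

lemma l2_nn_integral:
  "f \<in> l2_space M \<Longrightarrow> nn_sq M f = ennreal ((l2_norm M f)\<^sup>2)"
  unfolding l2_norm_def by (simp add: nn_integral_eq_integral l2_integrable_sq)

lemma l2_spaceI_nn:
  assumes [measurable]: "f \<in> borel_measurable M"
    and "nn_sq M f < \<infinity>"
  shows "f \<in> l2_space M"
  using assms by (auto simp: l2_space_def intro!: integrableI_bounded)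

lemma l2_norm_nonneg [simp]: "0 \<le> l2_norm M f"
  by (simp add: l2_norm_def)

lemma l2_norm_sq: "(l2_norm M f)\<^sup>2 = (LINT x|M. (cmod (f x))\<^sup>2)"
  by (simp add: l2_norm_def)

lemma l2_inner_self: "l2_inner M f f = complex_of_real ((l2_norm M f)\<^sup>2)"
  unfolding l2_inner_def l2_norm_sq complex_norm_square[symmetric]
  by (simp flip: of_real_power)

lemma l2_space_zero [simp]: "(\<lambda>x. 0) \<in> l2_space M"
  by (simp add: l2_space_def)

lemma l2_space_bounded_mult:
  assumes f: "f \<in> l2_space M" and g: "g \<in> borel_measurable M" and B: "\<And>x. cmod (g x) \<le> B"
  shows "(\<lambda>x. g x * f x) \<in> l2_space M"
proof -
  note [measurable] = l2_measurable[OF f] g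
  have "integrable M (\<lambda>x. (cmod (g x * f x))\<^sup>2)"
  proof (rule Bochner_Integration.integrable_bound)
    show "integrable M (\<lambda>x. B\<^sup>2 * (cmod (f x))\<^sup>2)"
      using l2_integrable_sq[OF f] by simp
    show "AE x in M. norm ((cmod (g x * f x))\<^sup>2) \<le> norm (B\<^sup>2 * (cmod (f x))\<^sup>2)"
      using B by (auto simp: norm_mult power_mult_distrib intro!: mult_right_mono power_mono)
  qed simp
  thus ?thesis by (simp add: l2_space_def)
qed

lemma l2_space_cmult: "f \<in> l2_space M \<Longrightarrow> (\<lambda>x. c * f x) \<in> l2_space M"
  by (rule l2_space_bounded_mult[where B = "cmod c"]) auto

lemma l2_space_add:
  assumes f: "f \<in> l2_space M" and g: "g \<in> l2_space M"
  shows "(\<lambda>x. f x + g x) \<in> l2_space M"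
proof -
  note [measurable] = l2_measurable[OF f] l2_measurable[OF g]
  have "integrable M (\<lambda>x. (cmod (f x + g x))\<^sup>2)"
  proof (rule Bochner_Integration.integrable_bound)
    show "integrable M (\<lambda>x. 2 * (cmod (f x))\<^sup>2 + 2 * (cmod (g x))\<^sup>2)"
      using l2_integrable_sq[OF f] l2_integrable_sq[OF g] by simp
    have "(cmod (a + b))\<^sup>2 \<le> 2 * (cmod a)\<^sup>2 + 2 * (cmod b)\<^sup>2" for a b
    proof -
      have "(cmod (a + b))\<^sup>2 \<le> (cmod a + cmod b)\<^sup>2"
        by (intro power_mono norm_triangle_ineq) simp
      also have "\<dots> \<le> 2 * (cmod a)\<^sup>2 + 2 * (cmod b)\<^sup>2"
        using sum_squares_ge_zero[of "cmod a - cmod b" 0] by (simp add: power2_eq_square algebra_simps)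
      finally show ?thesis .
    qed
    thus "AE x in M. norm ((cmod (f x + g x))\<^sup>2) \<le> norm (2 * (cmod (f x))\<^sup>2 + 2 * (cmod (g x))\<^sup>2)"
      by auto
  qed simp
  thus ?thesis by (simp add: l2_space_def)
qed

lemma l2_space_uminus: "f \<in> l2_space M \<Longrightarrow> (\<lambda>x. - f x) \<in> l2_space M"
  using l2_space_cmult[of f M "-1"] by simp

lemma l2_space_diff:
  "f \<in> l2_space M \<Longrightarrow> g \<in> l2_space M \<Longrightarrow> (\<lambda>x. f x - g x) \<in> l2_space M"
  using l2_space_add[of f M "\<lambda>x. - g x"] l2_space_uminus[of g M] by simp

lemma l2_space_cnj: "f \<in> l2_space M \<Longrightarrow> (\<lambda>x. cnj (f x)) \<in> l2_space M"
  by (auto simp: l2_space_def)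

lemma l2_space_sum:
  "(\<And>i. i \<in> I \<Longrightarrow> f i \<in> l2_space M) \<Longrightarrow> (\<lambda>x. \<Sum>i\<in>I. f i x) \<in> l2_space M"
  by (induction I rule: infinite_finite_induct) (auto intro: l2_space_add)

lemma l2_space_lincomb:
  "(\<And>i. i \<in> I \<Longrightarrow> f i \<in> l2_space M) \<Longrightarrow> (\<lambda>x. \<Sum>i\<in>I. c i * f i x) \<in> l2_space M"
  by (intro l2_space_sum l2_space_cmult)

lemma l2_space_cong_AE:
  assumes "f \<in> l2_space M" "g \<in> borel_measurable M" "AE x in M. f x = g x"
  shows "g \<in> l2_space M"
proof -
  note [measurable] = l2_measurable[OF assms(1)] assms(2)
  have "integrable M (\<lambda>x. (cmod (g x))\<^sup>2) \<longleftrightarrow> integrable M (\<lambda>x. (cmod (f x))\<^sup>2)"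
    using assms(3) by (intro integrable_cong_AE) auto
  thus ?thesis using assms by (simp add: l2_space_def)
qed

lemma l2_inner_cong_AE:
  assumes "AE x in M. f x = f' x" "AE x in M. g x = g' x"
    "f \<in> borel_measurable M" "f' \<in> borel_measurable M"
    "g \<in> borel_measurable M" "g' \<in> borel_measurable M"
  shows "l2_inner M f g = l2_inner M f' g'"
  unfolding l2_inner_def using assms by (intro integral_cong_AE) auto

lemma l2_norm_cong_AE:
  assumes "AE x in M. f x = f' x" "f \<in> borel_measurable M" "f' \<in> borel_measurable M"
  shows "l2_norm M f = l2_norm M f'"
  unfolding l2_norm_def using assms by (intro arg_cong[where f = sqrt] integral_cong_AE) auto

lemma l2_integrable_mult:
  assumes f: "f \<in> l2_space M" and g: "g \<in> l2_space M"
  shows "integrable M (\<lambda>x. f x * g x)"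
proof (rule Bochner_Integration.integrable_bound)
  note [measurable] = l2_measurable[OF f] l2_measurable[OF g]
  show "integrable M (\<lambda>x. (cmod (f x))\<^sup>2 + (cmod (g x))\<^sup>2)"
    using l2_integrable_sq[OF f] l2_integrable_sq[OF g] by simp
  show "(\<lambda>x. f x * g x) \<in> borel_measurable M" by simp
  have "a * b \<le> a\<^sup>2 + b\<^sup>2" if "a \<ge> 0" "b \<ge> 0" for a b :: real
    using sum_squares_ge_zero[of "a - b" 0] that mult_nonneg_nonneg[OF that]
    unfolding power2_eq_square left_diff_distrib right_diff_distrib mult.commute[of b a] by linarith
  thus "AE x in M. norm (f x * g x) \<le> norm ((cmod (f x))\<^sup>2 + (cmod (g x))\<^sup>2)"
    by (auto simp: norm_mult)
qed

lemma l2_integrable_inner: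
  "f \<in> l2_space M \<Longrightarrow> g \<in> l2_space M \<Longrightarrow> integrable M (\<lambda>x. f x * cnj (g x))"
  by (rule l2_integrable_mult) (auto intro: l2_space_cnj)

lemma l2_inner_add_left:
  "f \<in> l2_space M \<Longrightarrow> g \<in> l2_space M \<Longrightarrow> h \<in> l2_space M \<Longrightarrow>
   l2_inner M (\<lambda>x. f x + g x) h = l2_inner M f h + l2_inner M g h"
  by (simp add: l2_inner_def ring_distribs l2_integrable_inner)

lemma l2_inner_diff_left:
  "f \<in> l2_space M \<Longrightarrow> g \<in> l2_space M \<Longrightarrow> h \<in> l2_space M \<Longrightarrow>
   l2_inner M (\<lambda>x. f x - g x) h = l2_inner M f h - l2_inner M g h"
  by (simp add: l2_inner_def ring_distribs l2_integrable_inner)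

lemma l2_inner_cmult_left [simp]: "l2_inner M (\<lambda>x. c * f x) g = c * l2_inner M f g"
  by (simp add: l2_inner_def mult.assoc)

lemma l2_inner_cmult_right [simp]: "l2_inner M f (\<lambda>x. c * g x) = cnj c * l2_inner M f g"
proof -
  have "(\<lambda>x. f x * cnj (c * g x)) = (\<lambda>x. cnj c * (f x * cnj (g x)))" by (auto simp: fun_eq_iff)
  thus ?thesis by (simp add: l2_inner_def)
qed

lemma l2_inner_commute: "l2_inner M f g = cnj (l2_inner M g f)"
proof -
  have "cnj (l2_inner M g f) = (LINT x|M. cnj (g x * cnj (f x)))"
    unfolding l2_inner_def by (rule Bochner_Integration.integral_cnj[symmetric])
  thus ?thesis by (simp add: l2_inner_def mult.commute)
qed

lemma l2_inner_zero [simp]: "l2_inner M (\<lambda>x. 0) g = 0" "l2_inner M f (\<lambda>x. 0) = 0"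
  by (simp_all add: l2_inner_def)

lemma l2_inner_sum_left:
  assumes "\<And>i. i \<in> I \<Longrightarrow> f i \<in> l2_space M" "g \<in> l2_space M"
  shows "l2_inner M (\<lambda>x. \<Sum>i\<in>I. f i x) g = (\<Sum>i\<in>I. l2_inner M (f i) g)"
  using assms by (simp add: l2_inner_def sum_distrib_right l2_integrable_inner)

lemma l2_inner_lincomb_left:
  assumes "\<And>i. i \<in> I \<Longrightarrow> f i \<in> l2_space M" "g \<in> l2_space M"
  shows "l2_inner M (\<lambda>x. \<Sum>i\<in>I. c i * f i x) g = (\<Sum>i\<in>I. c i * l2_inner M (f i) g)"
  using assms by (subst l2_inner_sum_left) (auto intro: l2_space_cmult)

lemma l2_inner_lincomb_right:
  assumes "\<And>i. i \<in> I \<Longrightarrow> f i \<in> l2_space M" "g \<in> l2_space M"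
  shows "l2_inner M g (\<lambda>x. \<Sum>i\<in>I. c i * f i x) = (\<Sum>i\<in>I. cnj (c i) * l2_inner M g (f i))"
  by (subst l2_inner_commute, subst l2_inner_lincomb_left[OF assms], assumption)
     (simp add: l2_inner_commute[of M _ g])

lemma l2_inner_add_right:
  "f \<in> l2_space M \<Longrightarrow> g \<in> l2_space M \<Longrightarrow> h \<in> l2_space M \<Longrightarrow>
   l2_inner M h (\<lambda>x. f x + g x) = l2_inner M h f + l2_inner M h g"
  by (simp add: l2_inner_commute[of M h] l2_inner_add_left)

lemma l2_inner_diff_right:
  "f \<in> l2_space M \<Longrightarrow> g \<in> l2_space M \<Longrightarrow> h \<in> l2_space M \<Longrightarrow>
   l2_inner M h (\<lambda>x. f x - g x) = l2_inner M h f - l2_inner M h g"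
  by (simp add: l2_inner_commute[of M h] l2_inner_diff_left)

lemma l2_norm_cmult: "l2_norm M (\<lambda>x. c * f x) = cmod c * l2_norm M f"
  by (simp add: l2_norm_def norm_mult power_mult_distrib real_sqrt_mult)

lemma l2_norm_uminus: "l2_norm M (\<lambda>x. - f x) = l2_norm M f"
  by (simp add: l2_norm_def)

lemma l2_norm_minus_commute: "l2_norm M (\<lambda>x. f x - g x) = l2_norm M (\<lambda>x. g x - f x)"
  by (simp add: l2_norm_def norm_minus_commute)

lemma l2_norm_add_sq:
  assumes "f \<in> l2_space M" "g \<in> l2_space M"
  shows "(l2_norm M (\<lambda>x. f x + g x))\<^sup>2 = (l2_norm M f)\<^sup>2 + 2 * Re (l2_inner M f g) + (l2_norm M g)\<^sup>2"
proof -
  have "complex_of_real ((l2_norm M (\<lambda>x. f x + g x))\<^sup>2) =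
     l2_inner M f f + l2_inner M f g + (l2_inner M g f + l2_inner M g g)"
    unfolding l2_inner_self[symmetric] using assms
    by (simp add: l2_inner_add_left l2_inner_add_right l2_space_add)
  hence "Re (complex_of_real ((l2_norm M (\<lambda>x. f x + g x))\<^sup>2)) =
     Re (l2_inner M f f + l2_inner M f g + (l2_inner M g f + l2_inner M g g))" by metis
  thus ?thesis
    by (simp add: l2_inner_self l2_inner_commute[of M g f])
qed

lemma l2_norm_diff_sq:
  assumes "f \<in> l2_space M" "g \<in> l2_space M"
  shows "(l2_norm M (\<lambda>x. f x - g x))\<^sup>2 = (l2_norm M f)\<^sup>2 - 2 * Re (l2_inner M f g) + (l2_norm M g)\<^sup>2"
  using l2_norm_add_sq[OF assms(1) l2_space_cmult[OF assms(2), of "-1"]]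
    l2_inner_cmult_right[of M f "-1" g] by (simp add: l2_norm_uminus)

lemma l2_norm_zeroD:
  assumes "f \<in> l2_space M" "l2_norm M f = 0"
  shows "AE x in M. f x = 0"
proof -
  have "AE x in M. (cmod (f x))\<^sup>2 = 0"
    using assms by (subst integral_nonneg_eq_0_iff_AE[symmetric])
      (auto simp: l2_space_def l2_norm_def)
  thus ?thesis by simp
qed

lemma l2_cauchy_schwarz:
  assumes f: "f \<in> l2_space M" and g: "g \<in> l2_space M"
  shows "cmod (l2_inner M f g) \<le> l2_norm M f * l2_norm M g"
proof (cases "l2_norm M g = 0")
  case True
  hence "l2_inner M f g = l2_inner M f (\<lambda>x. 0)"
    using l2_norm_zeroD[OF g True] f g by (intro l2_inner_cong_AE) (auto intro: l2_measurable)
  thus ?thesis using True by simp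
next
  case False
  define b where "b = (l2_norm M g)\<^sup>2"
  have b: "b > 0" using False by (simp add: b_def)
  define c where "c = l2_inner M f g / complex_of_real b"
  have "0 \<le> (l2_norm M (\<lambda>x. f x - c * g x))\<^sup>2" by simp
  also have "\<dots> = (l2_norm M f)\<^sup>2 - 2 * Re (cnj c * l2_inner M f g) + (cmod c)\<^sup>2 * b"
    by (subst l2_norm_diff_sq) (auto simp: f g l2_space_cmult l2_norm_cmult power_mult_distrib b_def)
  also have "cnj c * l2_inner M f g = complex_of_real ((cmod (l2_inner M f g))\<^sup>2 / b)"
    using complex_norm_square[of "l2_inner M f g"] by (simp add: c_def mult.commute)
  also have "(cmod c)\<^sup>2 * b = (cmod (l2_inner M f g))\<^sup>2 / b"
    using b by (simp add: c_def norm_divide power_divide power2_eq_square)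
  finally have "(cmod (l2_inner M f g))\<^sup>2 / b \<le> (l2_norm M f)\<^sup>2" by simp
  hence "(cmod (l2_inner M f g))\<^sup>2 \<le> (l2_norm M f * l2_norm M g)\<^sup>2"
    using b by (simp add: divide_le_eq b_def power_mult_distrib)
  thus ?thesis by (rule power2_le_imp_le) simp
qed

lemma l2_norm_triangle:
  assumes f: "f \<in> l2_space M" and g: "g \<in> l2_space M"
  shows "l2_norm M (\<lambda>x. f x + g x) \<le> l2_norm M f + l2_norm M g"
proof -
  have "(l2_norm M (\<lambda>x. f x + g x))\<^sup>2 \<le> (l2_norm M f + l2_norm M g)\<^sup>2"
    using l2_norm_add_sq[OF f g] l2_cauchy_schwarz[OF f g] complex_Re_le_cmod[of "l2_inner M f g"]
    by (simp add: power2_sum)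
  thus ?thesis by (rule power2_le_imp_le) simp
qed

lemma l2_norm_diff_triangle:
  assumes "f \<in> l2_space M" "g \<in> l2_space M" "h \<in> l2_space M"
  shows "l2_norm M (\<lambda>x. f x - h x) \<le> l2_norm M (\<lambda>x. f x - g x) + l2_norm M (\<lambda>x. g x - h x)"
  using l2_norm_triangle[OF l2_space_diff[OF assms(1,2)] l2_space_diff[OF assms(2,3)]] by simp

lemma l2_norm_diff_ineq:
  assumes "f \<in> l2_space M" "g \<in> l2_space M"
  shows "\<bar>l2_norm M f - l2_norm M g\<bar> \<le> l2_norm M (\<lambda>x. f x - g x)"
  using l2_norm_triangle[OF l2_space_diff[OF assms] assms(2)]
    l2_norm_triangle[OF l2_space_diff[OF assms(2,1)] assms(1)]
    l2_norm_minus_commute[of M f g] by simp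

subsection \<open>Convergence\<close>

definition l2_tendsto :: "'a measure \<Rightarrow> (nat \<Rightarrow> 'a \<Rightarrow> complex) \<Rightarrow> ('a \<Rightarrow> complex) \<Rightarrow> bool" where
  "l2_tendsto M f g \<longleftrightarrow> (\<forall>n. f n \<in> l2_space M) \<and> g \<in> l2_space M \<and>
     (\<lambda>n. l2_norm M (\<lambda>x. f n x - g x)) \<longlonglongrightarrow> 0"

lemma l2_tendstoD:
  assumes "l2_tendsto M f g"
  shows "f n \<in> l2_space M" "g \<in> l2_space M" "(\<lambda>n. l2_norm M (\<lambda>x. f n x - g x)) \<longlonglongrightarrow> 0"
  using assms by (auto simp: l2_tendsto_def)

lemma l2_tendsto_norm:
  assumes "l2_tendsto M f g"
  shows "(\<lambda>n. l2_norm M (f n)) \<longlonglongrightarrow> l2_norm M g"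
proof -
  have "(\<lambda>n. l2_norm M (f n) - l2_norm M g) \<longlonglongrightarrow> 0"
    by (rule Lim_null_comparison[OF _ l2_tendstoD(3)[OF assms]])
       (intro always_eventually allI, unfold real_norm_def, intro l2_norm_diff_ineq l2_tendstoD[OF assms])
  thus ?thesis by (simp add: LIM_zero_iff)
qed

lemma l2_tendsto_inner:
  assumes f: "l2_tendsto M f f'" and g: "l2_tendsto M g g'"
  shows "(\<lambda>n. l2_inner M (f n) (g n)) \<longlonglongrightarrow> l2_inner M f' g'"
proof -
  note F = l2_tendstoD[OF f] and G = l2_tendstoD[OF g]
  have "(\<lambda>n. l2_inner M (f n) (g n) - l2_inner M f' g') \<longlonglongrightarrow> 0"
  proof (rule Lim_null_comparison)
    show "(\<lambda>n. l2_norm M (\<lambda>x. f n x - f' x) * l2_norm M (g n) +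
        l2_norm M f' * l2_norm M (\<lambda>x. g n x - g' x)) \<longlonglongrightarrow> 0"
      by (rule tendsto_eq_intros F(3) G(3) l2_tendsto_norm[OF g] | simp)+
    show "\<forall>\<^sub>F n in sequentially. norm (l2_inner M (f n) (g n) - l2_inner M f' g') \<le>
        l2_norm M (\<lambda>x. f n x - f' x) * l2_norm M (g n) + l2_norm M f' * l2_norm M (\<lambda>x. g n x - g' x)"
    proof (intro always_eventually allI)
      fix n
      have "l2_inner M (f n) (g n) - l2_inner M f' g' =
          l2_inner M (\<lambda>x. f n x - f' x) (g n) + l2_inner M f' (\<lambda>x. g n x - g' x)"
        using F(1)[of n] F(2) G(1)[of n] G(2) by (simp add: l2_inner_diff_left l2_inner_diff_right)
      also have "norm \<dots> \<le> l2_norm M (\<lambda>x. f n x - f' x) * l2_norm M (g n) +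
          l2_norm M f' * l2_norm M (\<lambda>x. g n x - g' x)"
        by (intro order_trans[OF norm_triangle_ineq] add_mono l2_cauchy_schwarz l2_space_diff F G)
      finally show "norm (l2_inner M (f n) (g n) - l2_inner M f' g') \<le> \<dots>" .
    qed
  qed
  thus ?thesis by (simp add: LIM_zero_iff)
qed

lemma l2_tendsto_const: "f \<in> l2_space M \<Longrightarrow> l2_tendsto M (\<lambda>n. f) f"
  by (simp add: l2_tendsto_def l2_norm_def)

lemma l2_tendsto_add:
  assumes f: "l2_tendsto M f f'" and g: "l2_tendsto M g g'"
  shows "l2_tendsto M (\<lambda>n x. f n x + g n x) (\<lambda>x. f' x + g' x)"
proof -
  note F = l2_tendstoD[OF f] and G = l2_tendstoD[OF g]
  have "(\<lambda>n. l2_norm M (\<lambda>x. (f n x + g n x) - (f' x + g' x))) \<longlonglongrightarrow> 0"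
  proof (rule Lim_null_comparison)
    show "(\<lambda>n. l2_norm M (\<lambda>x. f n x - f' x) + l2_norm M (\<lambda>x. g n x - g' x)) \<longlonglongrightarrow> 0"
      using tendsto_add[OF F(3) G(3)] by simp
    have "l2_norm M (\<lambda>x. (f n x - f' x) + (g n x - g' x)) \<le>
        l2_norm M (\<lambda>x. f n x - f' x) + l2_norm M (\<lambda>x. g n x - g' x)" for n
      by (intro l2_norm_triangle l2_space_diff F G)
    thus "\<forall>\<^sub>F n in sequentially. norm (l2_norm M (\<lambda>x. (f n x + g n x) - (f' x + g' x)))
        \<le> l2_norm M (\<lambda>x. f n x - f' x) + l2_norm M (\<lambda>x. g n x - g' x)"
      by (intro always_eventually) (simp add: algebra_simps)
  qed
  thus ?thesis using F G by (simp add: l2_tendsto_def l2_space_add)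
qed

lemma l2_tendsto_bounded_mult:
  assumes f: "l2_tendsto M f f'" and g: "g \<in> borel_measurable M" and B: "\<And>x. cmod (g x) \<le> B"
  shows "l2_tendsto M (\<lambda>n x. g x * f n x) (\<lambda>x. g x * f' x)"
proof -
  note F = l2_tendstoD[OF f]
  have "(\<lambda>n. l2_norm M (\<lambda>x. g x * f n x - g x * f' x)) \<longlonglongrightarrow> 0"
  proof (rule Lim_null_comparison)
    show "(\<lambda>n. \<bar>B\<bar> * l2_norm M (\<lambda>x. f n x - f' x)) \<longlonglongrightarrow> 0"
      using tendsto_mult_left[OF F(3), of "\<bar>B\<bar>"] by simp
    have "l2_norm M (\<lambda>x. g x * f n x - g x * f' x) \<le> \<bar>B\<bar> * l2_norm M (\<lambda>x. f n x - f' x)" for n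
    proof -
      note [measurable] = g l2_measurable[OF F(1)] l2_measurable[OF F(2)]
      have "l2_norm M (\<lambda>x. g x * f n x - g x * f' x) \<le> l2_norm M (\<lambda>x. complex_of_real B * (f n x - f' x))"
        unfolding l2_norm_def
      proof (intro real_sqrt_le_mono integral_mono)
        show "integrable M (\<lambda>x. (cmod (g x * f n x - g x * f' x))\<^sup>2)"
          by (intro l2_integrable_sq l2_space_diff l2_space_bounded_mult[OF _ g B] F)
        show "integrable M (\<lambda>x. (cmod (complex_of_real B * (f n x - f' x)))\<^sup>2)"
          by (intro l2_integrable_sq l2_space_diff l2_space_cmult F)
        fix x
        have "cmod (g x) \<le> \<bar>B\<bar>" using B[of x] by simp
        thus "(cmod (g x * f n x - g x * f' x))\<^sup>2 \<le> (cmod (complex_of_real B * (f n x - f' x)))\<^sup>2"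
          by (auto simp: norm_mult simp flip: right_diff_distrib intro!: power_mono mult_right_mono)
      qed
      thus ?thesis by (simp only: l2_norm_cmult norm_of_real)
    qed
    thus "\<forall>\<^sub>F n in sequentially. norm (l2_norm M (\<lambda>x. g x * f n x - g x * f' x))
        \<le> \<bar>B\<bar> * l2_norm M (\<lambda>x. f n x - f' x)" by simp
  qed
  thus ?thesis using F by (simp add: l2_tendsto_def l2_space_bounded_mult[OF _ g B])
qed

lemma l2_tendsto_cmult:
  "l2_tendsto M f f' \<Longrightarrow> l2_tendsto M (\<lambda>n x. c * f n x) (\<lambda>x. c * f' x)"
  by (rule l2_tendsto_bounded_mult[where B = "cmod c"]) auto

text \<open>Fatou turns a bound in the mean along an almost everywhere convergent sequence into membership
  of the limit. This is how square integrability for one weight is transferred to another.\<close>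

lemma l2_fatou:
  assumes f: "\<And>n. f n \<in> l2_space M" and g: "g \<in> borel_measurable M"
    and lim: "AE x in M. (\<lambda>n. f n x) \<longlonglongrightarrow> g x" and B: "\<And>n. l2_norm M (f n) \<le> B"
  shows "g \<in> l2_space M" "l2_norm M g \<le> B"
proof -
  note [measurable] = l2_measurable[OF f] g
  have B0: "B \<ge> 0" using B[of 0] l2_norm_nonneg order_trans by blast
  have "nn_sq M g = (\<integral>\<^sup>+x. liminf (\<lambda>n. ennreal ((cmod (f n x))\<^sup>2)) \<partial>M)"
  proof (intro nn_integral_cong_AE, use lim in eventually_elim)
    case (elim x)
    hence "(\<lambda>n. ennreal ((cmod (f n x))\<^sup>2)) \<longlonglongrightarrow> ennreal ((cmod (g x))\<^sup>2)"
      by (intro tendsto_intros)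
    from lim_imp_Liminf[OF trivial_limit_sequentially this] show ?case by (rule sym)
  qed
  also have "\<dots> \<le> liminf (\<lambda>n. nn_sq M (f n))"
    by (intro nn_integral_liminf) simp
  also have "\<dots> \<le> ennreal (B\<^sup>2)"
    by (intro Liminf_le always_eventually allI)
       (auto simp: l2_nn_integral[OF f] B intro!: ennreal_leI power_mono)
  finally have le: "nn_sq M g \<le> ennreal (B\<^sup>2)" .
  hence "nn_sq M g < \<infinity>"
    by (rule order.strict_trans1) (simp add: less_top)
  thus G: "g \<in> l2_space M" by (intro l2_spaceI_nn) auto
  show "l2_norm M g \<le> B"
    using le B0 unfolding l2_nn_integral[OF G]
    by (subst (asm) ennreal_le_iff) (auto intro: power2_le_imp_le)
qed

lemma l2_dominated_convergence:
  assumes f: "\<And>n. f n \<in> borel_measurable M" and g: "g \<in> borel_measurable M"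
    and lim: "AE x in M. (\<lambda>n. f n x) \<longlonglongrightarrow> g x"
    and h: "h \<in> l2_space M" and bound: "\<And>n. AE x in M. cmod (f n x) \<le> cmod (h x)"
  shows "l2_tendsto M f g"
proof -
  note [measurable] = l2_measurable[OF h] g f
  have "AE x in M. \<forall>n. cmod (f n x) \<le> cmod (h x)"
    using bound by (simp add: AE_all_countable)
  hence gb: "AE x in M. cmod (g x) \<le> cmod (h x)"
    using lim
  proof eventually_elim
    case (elim x)
    thus ?case by (intro Lim_bounded[OF tendsto_norm[OF elim(2)], of 0]) auto
  qed
  have L2: "u \<in> l2_space M"
    if u: "u \<in> borel_measurable M" "AE x in M. cmod (u x) \<le> cmod (h x)" for u
  proof -
    have "integrable M (\<lambda>x. (cmod (u x))\<^sup>2)"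
      using l2_integrable_sq[OF h]
      by (rule Bochner_Integration.integrable_bound) (use u in \<open>auto elim!: eventually_mono intro!: power_mono\<close>)
    thus ?thesis using u by (simp add: l2_space_def)
  qed
  have fL: "f n \<in> l2_space M" for n using bound f by (intro L2) auto
  have gL: "g \<in> l2_space M" using gb g by (intro L2) auto
  have "(\<lambda>n. LINT x|M. (cmod (f n x - g x))\<^sup>2) \<longlonglongrightarrow> (LINT x|M. 0)"
  proof (rule integral_dominated_convergence)
    show "integrable M (\<lambda>x. 4 * (cmod (h x))\<^sup>2)" using l2_integrable_sq[OF h] by simp
    show "AE x in M. (\<lambda>n. (cmod (f n x - g x))\<^sup>2) \<longlonglongrightarrow> 0"
      using lim
    proof eventually_elim
      case (elim x)
      thus ?case by (intro tendsto_eq_intros | simp)+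
    qed
    fix n
    show "AE x in M. norm ((cmod (f n x - g x))\<^sup>2) \<le> 4 * (cmod (h x))\<^sup>2"
      using bound[of n] gb
    proof eventually_elim
      case (elim x)
      have "cmod (f n x - g x) \<le> 2 * cmod (h x)"
        using elim norm_triangle_ineq4[of "f n x" "g x"] by linarith
      from power_mono[OF this, of 2] show ?case by (simp add: power_mult_distrib)
    qed
  qed auto
  hence "(\<lambda>n. sqrt (LINT x|M. (cmod (f n x - g x))\<^sup>2)) \<longlonglongrightarrow> sqrt 0"
    by (intro tendsto_intros) simp
  thus ?thesis using fL gL by (simp add: l2_tendsto_def l2_norm_def)
qed

lemma l2_tendsto_AE_subseq:
  assumes "l2_tendsto M f g"
  obtains r :: "nat \<Rightarrow> nat" where "strict_mono r" "AE x in M. (\<lambda>n. f (r n) x) \<longlonglongrightarrow> g x"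
proof -
  note F = l2_tendstoD[OF assms]
  let ?u = "\<lambda>n x. (cmod (f n x - g x))\<^sup>2"
  have "\<exists>r::nat\<Rightarrow>nat. strict_mono r \<and> (AE x in M. (\<lambda>n. ?u (r n) x) \<longlonglongrightarrow> 0)"
  proof (rule tendsto_L1_AE_subseq)
    show "integrable M (?u n)" for n by (intro l2_integrable_sq l2_space_diff F)
    have "(\<lambda>n. (l2_norm M (\<lambda>x. f n x - g x))\<^sup>2) \<longlonglongrightarrow> 0\<^sup>2"
      by (intro tendsto_intros F)
    thus "(\<lambda>n. LINT x|M. norm (?u n x)) \<longlonglongrightarrow> 0" by (simp add: l2_norm_sq)
  qed
  then obtain r :: "nat \<Rightarrow> nat" where r: "strict_mono r" "AE x in M. (\<lambda>n. ?u (r n) x) \<longlonglongrightarrow> 0" by blast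
  show thesis
  proof (rule that[OF r(1)], use r(2) in eventually_elim)
    case (elim x)
    hence "(\<lambda>n. sqrt (?u (r n) x)) \<longlonglongrightarrow> sqrt 0" by (intro tendsto_intros)
    hence "(\<lambda>n. f (r n) x - g x) \<longlonglongrightarrow> 0" by (simp add: tendsto_norm_zero_iff)
    thus ?case by (simp add: LIM_zero_iff)
  qed
qed

lemma l2_tendsto_unique:
  assumes "l2_tendsto M f g" "l2_tendsto M f h"
  shows "AE x in M. g x = h x"
proof -
  note G = l2_tendstoD[OF assms(1)] and H = l2_tendstoD[OF assms(2)]
  have "l2_norm M (\<lambda>x. g x - h x) \<le> 0"
  proof (rule LIMSEQ_le_const)
    show "(\<lambda>n. l2_norm M (\<lambda>x. f n x - g x) + l2_norm M (\<lambda>x. f n x - h x)) \<longlonglongrightarrow> 0"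
      using tendsto_add[OF G(3) H(3)] by simp
    show "\<exists>N. \<forall>n\<ge>N. l2_norm M (\<lambda>x. g x - h x) \<le>
        l2_norm M (\<lambda>x. f n x - g x) + l2_norm M (\<lambda>x. f n x - h x)"
      using l2_norm_diff_triangle[OF G(2) G(1) H(2)] l2_norm_minus_commute[of M g] by auto
  qed
  hence "AE x in M. g x - h x = 0"
    by (intro l2_norm_zeroD l2_space_diff G H antisym) auto
  thus ?thesis by simp
qed

text \<open>Riesz--Fischer. A subsequence with squared increments below \<open>4\<^sup>-\<^sup>n\<close> converges almost everywhere,
  and by Fatou its pointwise limit is also the limit in the mean.\<close>

lemma l2_complete:
  assumes f: "\<And>n. f n \<in> l2_space M"
    and cauchy: "\<And>\<epsilon>. \<epsilon> > 0 \<Longrightarrow> \<exists>N. \<forall>m\<ge>N. \<forall>n\<ge>N. l2_norm M (\<lambda>x. f m x - f n x) < \<epsilon>"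
  obtains g where "l2_tendsto M f g"
proof -
  note [measurable] = l2_measurable[OF f]
  have "\<exists>r. \<forall>n. (\<forall>p\<ge>r n. \<forall>q\<ge>r n. l2_norm M (\<lambda>x. f p x - f q x) < (1/2)^n) \<and> r n < r (Suc n)"
  proof (rule dependent_nat_choice)
    show "\<exists>x. \<forall>p\<ge>x. \<forall>q\<ge>x. l2_norm M (\<lambda>x. f p x - f q x) < (1/2)^0"
      using cauchy[of 1] by simp
  next
    fix x n
    obtain N where "\<forall>p\<ge>N. \<forall>q\<ge>N. l2_norm M (\<lambda>x. f p x - f q x) < (1/2)^Suc n"
      using cauchy[of "(1/2)^Suc n"] by auto
    thus "\<exists>y. (\<forall>p\<ge>y. \<forall>q\<ge>y. l2_norm M (\<lambda>x. f p x - f q x) < (1/2)^Suc n) \<and> x < y"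
      by (intro exI[of _ "max N (Suc x)"]) auto
  qed
  then obtain r where r: "\<And>n p q. p \<ge> r n \<Longrightarrow> q \<ge> r n \<Longrightarrow> l2_norm M (\<lambda>x. f p x - f q x) < (1/2)^n"
    and rS: "\<And>n. r n < r (Suc n)" by blast
  have sm: "strict_mono r" by (simp add: strict_mono_Suc_iff rS)
  define d where "d = (\<lambda>n x. f (r (Suc n)) x - f (r n) x)"
  have [measurable]: "d n \<in> borel_measurable M" for n unfolding d_def by measurable
  have dL: "d n \<in> l2_space M" for n unfolding d_def by (intro l2_space_diff f)
  have dn: "(l2_norm M (d n))\<^sup>2 \<le> (1/4)^n" for n
  proof -
    have "(l2_norm M (d n))\<^sup>2 \<le> ((1/2)^n)\<^sup>2"
      using r[of n "r (Suc n)" "r n"] rS[of n] unfolding d_def by (intro power_mono) auto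
    also have "\<dots> = (1/4)^n" by (simp flip: power_mult_distrib add: power2_eq_square)
    finally show ?thesis .
  qed
  have "(\<integral>\<^sup>+x. (\<Sum>n. ennreal (2^n * (cmod (d n x))\<^sup>2)) \<partial>M) = (\<Sum>n. \<integral>\<^sup>+x. ennreal (2^n * (cmod (d n x))\<^sup>2) \<partial>M)"
    by (rule nn_integral_suminf) measurable
  also have "\<dots> \<le> (\<Sum>n. ennreal ((1/2)^n))"
  proof (intro suminf_le summableI)
    fix n
    have "(\<integral>\<^sup>+x. ennreal (2^n * (cmod (d n x))\<^sup>2) \<partial>M) = ennreal (2^n) * ennreal ((l2_norm M (d n))\<^sup>2)"
      by (simp add: ennreal_mult nn_integral_cmult l2_nn_integral[OF dL])
    also have "\<dots> \<le> ennreal (2^n * (1/4)^n)"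
      using dn[of n] by (subst ennreal_mult[symmetric]) (auto intro!: ennreal_leI mult_left_mono)
    also have "2^n * (1/4)^n = (1/2::real)^n" by (simp flip: power_mult_distrib)
    finally show "(\<integral>\<^sup>+x. ennreal (2^n * (cmod (d n x))\<^sup>2) \<partial>M) \<le> ennreal ((1/2)^n)" .
  qed
  also have "\<dots> = ennreal (\<Sum>n. (1/2)^n)"
    by (rule suminf_ennreal2) (auto intro: summable_geometric)
  also have "\<dots> < \<infinity>" by simp
  finally have "AE x in M. (\<Sum>n. ennreal (2^n * (cmod (d n x))\<^sup>2)) \<noteq> \<infinity>"
    by (intro nn_integral_noteq_infinite) auto
  hence conv: "AE x in M. convergent (\<lambda>n. f (r n) x)"
  proof eventually_elim
    case (elim x)
    have s1: "summable (\<lambda>n. 2^n * (cmod (d n x))\<^sup>2)"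
      using elim by (intro summable_suminf_not_top) auto
    have "summable (\<lambda>n. d n x)"
    proof (rule summable_comparison_test'[of "\<lambda>n. (1/2)^n + 2^n * (cmod (d n x))\<^sup>2" 0])
      show "summable (\<lambda>n. (1/2)^n + 2^n * (cmod (d n x))\<^sup>2)"
        by (intro summable_add s1 summable_geometric) simp
      fix n
      \<comment> \<open>Either the increment is below \<open>2\<^sup>-\<^sup>n\<close>, or multiplying it by \<open>2\<^sup>n\<close> times itself makes it larger.\<close>
      show "norm (d n x) \<le> (1/2)^n + 2^n * (cmod (d n x))\<^sup>2"
      proof (cases "cmod (d n x) \<le> (1/2)^n")
        case False
        hence "1 \<le> 2^n * cmod (d n x)" by (simp add: power_one_over field_simps)
        hence "1 * cmod (d n x) \<le> 2^n * cmod (d n x) * cmod (d n x)"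
          by (intro mult_right_mono) auto
        moreover have "(0::real) \<le> (1/2)^n" by simp
        ultimately show ?thesis
          unfolding power2_eq_square mult.assoc[symmetric] by linarith
      qed (simp add: add_increasing2)
    qed
    hence "(\<lambda>n. f (r 0) x + (\<Sum>i<n. d i x)) \<longlonglongrightarrow> f (r 0) x + (\<Sum>i. d i x)"
      by (intro tendsto_intros summable_LIMSEQ)
    moreover have "f (r 0) x + (\<Sum>i<n. d i x) = f (r n) x" for n
      unfolding d_def by (subst sum_lessThan_telescope) simp
    ultimately show ?case by (auto simp: convergent_def)
  qed
  define g where "g = (\<lambda>x. lim (\<lambda>n. f (r n) x))"
  have [measurable]: "g \<in> borel_measurable M" unfolding g_def by measurable
  have lim: "AE x in M. (\<lambda>n. f (r n) x) \<longlonglongrightarrow> g x"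
    using conv unfolding g_def by eventually_elim (simp add: convergent_LIMSEQ_iff)
  have *: "(\<lambda>x. g x - f (r n) x) \<in> l2_space M \<and> l2_norm M (\<lambda>x. g x - f (r n) x) \<le> (1/2)^n" for n
  proof -
    have a: "(\<lambda>x. f (r (m + n)) x - f (r n) x) \<in> l2_space M" for m by (intro l2_space_diff f)
    have b: "AE x in M. (\<lambda>m. f (r (m + n)) x - f (r n) x) \<longlonglongrightarrow> g x - f (r n) x"
      using lim by eventually_elim (intro tendsto_intros LIMSEQ_ignore_initial_segment)
    have c: "l2_norm M (\<lambda>x. f (r (m + n)) x - f (r n) x) \<le> (1/2)^n" for m
      using r[of n "r (m + n)" "r n"] sm by (simp add: less_imp_le strict_mono_less_eq)
    show ?thesis using l2_fatou[OF a _ b c] by simp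
  qed
  have gL: "g \<in> l2_space M"
    using l2_space_add[OF conjunct1[OF *[of 0]] f[of "r 0"]] by simp
  have "(\<lambda>m. l2_norm M (\<lambda>x. f m x - g x)) \<longlonglongrightarrow> 0"
  proof (rule LIMSEQ_I)
    fix \<epsilon> :: real assume "0 < \<epsilon>"
    then obtain n where n: "(1/2)^n < \<epsilon> / 2"
      using real_arch_pow_inv[of "\<epsilon>/2" "1/2"] by auto
    show "\<exists>N. \<forall>m\<ge>N. norm (l2_norm M (\<lambda>x. f m x - g x) - 0) < \<epsilon>"
    proof (intro exI[of _ "r n"] allI impI)
      fix m assume m: "m \<ge> r n"
      have "l2_norm M (\<lambda>x. f m x - g x) \<le> l2_norm M (\<lambda>x. f m x - f (r n) x) + l2_norm M (\<lambda>x. f (r n) x - g x)"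
        by (intro l2_norm_diff_triangle f gL)
      also have "\<dots> < \<epsilon>"
        using *[of n] r[OF m, of "r n"] n l2_norm_minus_commute[of M g "f (r n)"] by simp
      finally show "norm (l2_norm M (\<lambda>x. f m x - g x) - 0) < \<epsilon>" by simp
    qed
  qed
  with f gL that show thesis by (auto simp: l2_tendsto_def)
qed

lemma l2_tendsto_Cauchy:
  assumes "l2_tendsto M f g" "\<epsilon> > 0"
  shows "\<exists>N. \<forall>m\<ge>N. \<forall>n\<ge>N. l2_norm M (\<lambda>x. f m x - f n x) < \<epsilon>"
proof -
  note F = l2_tendstoD[OF assms(1)]
  obtain N where N: "\<And>n. n \<ge> N \<Longrightarrow> l2_norm M (\<lambda>x. f n x - g x) < \<epsilon> / 2"
    using LIMSEQ_D[OF F(3), of "\<epsilon>/2"] assms(2) by auto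
  show ?thesis
  proof (intro exI[of _ N] allI impI)
    fix m n assume mn: "m \<ge> N" "n \<ge> N"
    show "l2_norm M (\<lambda>x. f m x - f n x) < \<epsilon>"
      using l2_norm_diff_triangle[OF F(1)[of m] F(2) F(1)[of n]] N[OF mn(1)] N[OF mn(2)]
        l2_norm_minus_commute[of M g "f n"] by simp
  qed
qed

lemma l2_norm_lincomb_sq:
  assumes "\<And>i. i \<in> J \<Longrightarrow> f i \<in> l2_space M"
  shows "complex_of_real ((l2_norm M (\<lambda>x. \<Sum>i\<in>J. c i * f i x))\<^sup>2) =
     (\<Sum>i\<in>J. \<Sum>j\<in>J. c i * cnj (c j) * l2_inner M (f i) (f j))"
proof -
  have "l2_inner M (\<lambda>x. \<Sum>i\<in>J. c i * f i x) (\<lambda>x. \<Sum>i\<in>J. c i * f i x) =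
     (\<Sum>i\<in>J. c i * l2_inner M (f i) (\<lambda>x. \<Sum>j\<in>J. c j * f j x))"
    using assms by (intro l2_inner_lincomb_left l2_space_lincomb) auto
  also have "\<dots> = (\<Sum>i\<in>J. c i * (\<Sum>j\<in>J. cnj (c j) * l2_inner M (f i) (f j)))"
    using assms by (intro sum.cong refl arg_cong2[where f = "(*)"] l2_inner_lincomb_right) auto
  finally show ?thesis by (simp add: l2_inner_self sum_distrib_left mult.assoc)
qed

section \<open>Orthonormal families\<close>

definition orthonormal_on :: "'a measure \<Rightarrow> ('i \<Rightarrow> 'a \<Rightarrow> complex) \<Rightarrow> 'i set \<Rightarrow> bool" where
  "orthonormal_on M e I \<longleftrightarrow> (\<forall>i\<in>I. e i \<in> l2_space M) \<and>
     (\<forall>i\<in>I. \<forall>j\<in>I. l2_inner M (e i) (e j) = (if i = j then 1 else 0))"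

definition l2_spanning :: "'a measure \<Rightarrow> ('i \<Rightarrow> 'a \<Rightarrow> complex) \<Rightarrow> 'i set \<Rightarrow> bool" where
  "l2_spanning M e I \<longleftrightarrow> (\<forall>u\<in>l2_space M. \<forall>\<epsilon>>0. \<exists>F c. finite F \<and> F \<subseteq> I \<and>
     l2_norm M (\<lambda>x. u x - (\<Sum>i\<in>F. c i * e i x)) < \<epsilon>)"

context
  fixes M :: "'a measure" and e :: "'i \<Rightarrow> 'a \<Rightarrow> complex" and I :: "'i set"
  assumes on: "orthonormal_on M e I"
begin

lemma orthonormal_in_l2: "i \<in> I \<Longrightarrow> e i \<in> l2_space M"
  using on by (auto simp: orthonormal_on_def)

lemma orthonormal_norm_sq:
  assumes "finite F" "F \<subseteq> I"
  shows "(l2_norm M (\<lambda>x. \<Sum>i\<in>F. c i * e i x))\<^sup>2 = (\<Sum>i\<in>F. (cmod (c i))\<^sup>2)"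
proof -
  have "complex_of_real ((l2_norm M (\<lambda>x. \<Sum>i\<in>F. c i * e i x))\<^sup>2) =
      (\<Sum>i\<in>F. \<Sum>j\<in>F. c i * cnj (c j) * l2_inner M (e i) (e j))"
    using assms by (intro l2_norm_lincomb_sq orthonormal_in_l2) auto
  also have "\<dots> = (\<Sum>i\<in>F. \<Sum>j\<in>F. if i = j then c i * cnj (c j) else 0)"
    using assms on by (intro sum.cong refl) (auto simp: orthonormal_on_def subset_iff)
  also have "\<dots> = (\<Sum>i\<in>F. complex_of_real ((cmod (c i))\<^sup>2))"
    using assms by (simp add: complex_norm_square[symmetric])
  also have "\<dots> = complex_of_real (\<Sum>i\<in>F. (cmod (c i))\<^sup>2)" by simp
  finally show ?thesis by (simp only: of_real_eq_iff)
qed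

lemma orthonormal_residual:
  assumes "finite F" "F \<subseteq> I" and u: "u \<in> l2_space M"
  shows "(l2_norm M (\<lambda>x. u x - (\<Sum>i\<in>F. c i * e i x)))\<^sup>2 =
     (l2_norm M u)\<^sup>2 - (\<Sum>i\<in>F. (cmod (l2_inner M u (e i)))\<^sup>2) + (\<Sum>i\<in>F. (cmod (c i - l2_inner M u (e i)))\<^sup>2)"
proof -
  let ?a = "\<lambda>i. l2_inner M u (e i)"
  have L: "(\<lambda>x. \<Sum>i\<in>F. c i * e i x) \<in> l2_space M"
    using assms by (intro l2_space_lincomb orthonormal_in_l2) auto
  have inn: "l2_inner M u (\<lambda>x. \<Sum>i\<in>F. c i * e i x) = (\<Sum>i\<in>F. cnj (c i) * ?a i)"
    using assms by (intro l2_inner_lincomb_right orthonormal_in_l2) auto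
  have "(cmod (c i - ?a i))\<^sup>2 = (cmod (c i))\<^sup>2 - 2 * Re (cnj (c i) * ?a i) + (cmod (?a i))\<^sup>2" for i
    unfolding cmod_power2 by (simp add: power2_eq_square algebra_simps)
  hence "(\<Sum>i\<in>F. (cmod (c i - ?a i))\<^sup>2) =
      (\<Sum>i\<in>F. (cmod (c i))\<^sup>2) - 2 * Re (\<Sum>i\<in>F. cnj (c i) * ?a i) + (\<Sum>i\<in>F. (cmod (?a i))\<^sup>2)"
    by (simp only: sum.distrib sum_subtractf Re_sum sum_distrib_left)
  thus ?thesis
    unfolding l2_norm_diff_sq[OF u L] inn orthonormal_norm_sq[OF assms(1,2)] by linarith
qed

lemma orthonormal_residual_best:
  assumes "finite F" "F \<subseteq> I" and u: "u \<in> l2_space M"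
  shows "(l2_norm M (\<lambda>x. u x - (\<Sum>i\<in>F. l2_inner M u (e i) * e i x)))\<^sup>2 =
     (l2_norm M u)\<^sup>2 - (\<Sum>i\<in>F. (cmod (l2_inner M u (e i)))\<^sup>2)"
  by (subst orthonormal_residual[OF assms]) simp

lemma orthonormal_bessel:
  assumes "finite F" "F \<subseteq> I" and u: "u \<in> l2_space M"
  shows "(\<Sum>i\<in>F. (cmod (l2_inner M u (e i)))\<^sup>2) \<le> (l2_norm M u)\<^sup>2"
  using orthonormal_residual_best[OF assms] zero_le_power2[of "l2_norm M (\<lambda>x. u x - (\<Sum>i\<in>F. l2_inner M u (e i) * e i x))"]
  by linarith

context
  assumes span: "l2_spanning M e I"
begin

text \<open>Among combinations over a fixed finite set the Fourier coefficients are optimal, and enlarging the set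
  only decreases the residual; so one good combination bounds all later partial sums.\<close>

lemma orthonormal_expansion:
  assumes u: "u \<in> l2_space M" and "\<epsilon> > 0"
  obtains F0 where "finite F0" "F0 \<subseteq> I"
    "\<And>F. finite F \<Longrightarrow> F0 \<subseteq> F \<Longrightarrow> F \<subseteq> I \<Longrightarrow> l2_norm M (\<lambda>x. u x - (\<Sum>i\<in>F. l2_inner M u (e i) * e i x)) < \<epsilon>"
proof -
  obtain F0 c where F0: "finite F0" "F0 \<subseteq> I" "l2_norm M (\<lambda>x. u x - (\<Sum>i\<in>F0. c i * e i x)) < \<epsilon>"
    using span[unfolded l2_spanning_def, rule_format, OF u \<open>\<epsilon> > 0\<close>] by auto
  show thesis
  proof (rule that[OF F0(1,2)])
    fix F assume F: "finite F" "F0 \<subseteq> F" "F \<subseteq> I"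
    have "(l2_norm M (\<lambda>x. u x - (\<Sum>i\<in>F. l2_inner M u (e i) * e i x)))\<^sup>2 \<le>
        (l2_norm M u)\<^sup>2 - (\<Sum>i\<in>F0. (cmod (l2_inner M u (e i)))\<^sup>2)"
      unfolding orthonormal_residual_best[OF F(1,3) u] using F by (simp add: sum_mono2)
    also have "\<dots> \<le> (l2_norm M (\<lambda>x. u x - (\<Sum>i\<in>F0. c i * e i x)))\<^sup>2"
      unfolding orthonormal_residual[OF F0(1,2) u] by (simp add: sum_nonneg)
    finally have "l2_norm M (\<lambda>x. u x - (\<Sum>i\<in>F. l2_inner M u (e i) * e i x)) \<le>
        l2_norm M (\<lambda>x. u x - (\<Sum>i\<in>F0. c i * e i x))" by (rule power2_le_imp_le) simp
    thus "l2_norm M (\<lambda>x. u x - (\<Sum>i\<in>F. l2_inner M u (e i) * e i x)) < \<epsilon>" using F0(3) by simp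
  qed
qed

lemma orthonormal_l2_tendsto:
  assumes u: "u \<in> l2_space M"
    and F: "\<And>n. finite (F n)" "\<And>n. F n \<subseteq> I"
      "\<And>F0. finite F0 \<Longrightarrow> F0 \<subseteq> I \<Longrightarrow> \<exists>N. \<forall>n\<ge>N. F0 \<subseteq> F n"
  shows "l2_tendsto M (\<lambda>n x. \<Sum>i\<in>F n. l2_inner M u (e i) * e i x) u"
proof -
  let ?S = "\<lambda>n x. \<Sum>i\<in>F n. l2_inner M u (e i) * e i x"
  have "(\<lambda>n. l2_norm M (\<lambda>x. ?S n x - u x)) \<longlonglongrightarrow> 0"
  proof (rule LIMSEQ_I)
    fix \<epsilon> :: real assume "\<epsilon> > 0"
    then obtain F0 where F0: "finite F0" "F0 \<subseteq> I"
      "\<And>F. finite F \<Longrightarrow> F0 \<subseteq> F \<Longrightarrow> F \<subseteq> I \<Longrightarrow> l2_norm M (\<lambda>x. u x - (\<Sum>i\<in>F. l2_inner M u (e i) * e i x)) < \<epsilon>"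
      using orthonormal_expansion[OF u] by blast
    from F(3)[OF F0(1,2)] obtain N where N: "\<forall>n\<ge>N. F0 \<subseteq> F n" by blast
    thus "\<exists>N. \<forall>n\<ge>N. norm (l2_norm M (\<lambda>x. ?S n x - u x) - 0) < \<epsilon>"
      using F0(3)[OF F(1) _ F(2)] by (intro exI[of _ N]) (auto simp: l2_norm_minus_commute[of M _ u])
  qed
  moreover have "?S n \<in> l2_space M" for n
    using F(2)[of n] by (intro l2_space_lincomb orthonormal_in_l2) auto
  ultimately show ?thesis using u by (simp add: l2_tendsto_def)
qed

end

end

lemma lessThan_exhausts: "finite F0 \<Longrightarrow> \<exists>N. \<forall>n\<ge>N. F0 \<subseteq> {..<n::nat}"
proof -
  assume "finite F0"
  then obtain k where "F0 \<subseteq> {..k}" by (auto simp: finite_nat_iff_bounded_le)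
  thus ?thesis by (intro exI[of _ "Suc k"]) auto
qed

lemma orthonormal_parseval_sums:
  fixes e :: "nat \<Rightarrow> 'a \<Rightarrow> complex"
  assumes on: "orthonormal_on M e UNIV" and span: "l2_spanning M e UNIV"
    and u: "u \<in> l2_space M" and v: "v \<in> l2_space M"
  shows "(\<lambda>n. l2_inner M u (e n) * cnj (l2_inner M v (e n))) sums l2_inner M u v"
proof -
  have "l2_tendsto M (\<lambda>n x. \<Sum>i<n. l2_inner M u (e i) * e i x) u"
    by (rule orthonormal_l2_tendsto[OF on span u]) (auto intro: lessThan_exhausts)
  from l2_tendsto_inner[OF this l2_tendsto_const[OF v]]
  have "(\<lambda>n. l2_inner M (\<lambda>x. \<Sum>i<n. l2_inner M u (e i) * e i x) v) \<longlonglongrightarrow> l2_inner M u v" .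
  moreover have "l2_inner M (\<lambda>x. \<Sum>i<n. l2_inner M u (e i) * e i x) v =
     (\<Sum>i<n. l2_inner M u (e i) * cnj (l2_inner M v (e i)))" for n
    using v orthonormal_in_l2[OF on]
    by (subst l2_inner_lincomb_left) (auto simp flip: l2_inner_commute)
  ultimately show ?thesis by (simp add: sums_def)
qed

lemma orthonormal_parseval_norm_sums:
  fixes e :: "nat \<Rightarrow> 'a \<Rightarrow> complex"
  assumes on: "orthonormal_on M e UNIV" and span: "l2_spanning M e UNIV" and u: "u \<in> l2_space M"
  shows "(\<lambda>n. (cmod (l2_inner M u (e n)))\<^sup>2) sums (l2_norm M u)\<^sup>2"
proof -
  from sums_Re[OF orthonormal_parseval_sums[OF on span u u]]
  show ?thesis by (simp add: l2_inner_self complex_norm_square[symmetric] flip: of_real_power)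
qed

lemma orthonormal_parseval_ennreal:
  fixes e :: "nat \<Rightarrow> 'a \<Rightarrow> complex"
  assumes on: "orthonormal_on M e UNIV" and span: "l2_spanning M e UNIV" and u: "u \<in> l2_space M"
  shows "(\<Sum>n. ennreal ((cmod (l2_inner M u (e n)))\<^sup>2)) = nn_sq M u"
  unfolding l2_nn_integral[OF u]
  by (intro suminf_ennreal_eq orthonormal_parseval_norm_sums[OF assms]) auto

text \<open>The partial sums of the expansion of \<open>u\<close> converge by Bessel and completeness, and \<open>u\<close> minus
  their limit is orthogonal to the family.\<close>

lemma orthonormal_total_spanning:
  fixes e :: "nat \<Rightarrow> 'a \<Rightarrow> complex"
  assumes on: "orthonormal_on M e UNIV"
    and tot: "\<And>u. u \<in> l2_space M \<Longrightarrow> (\<And>j. l2_inner M u (e j) = 0) \<Longrightarrow> AE x in M. u x = 0"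
  shows "l2_spanning M e UNIV"
  unfolding l2_spanning_def
proof (intro ballI allI impI)
  fix u and \<epsilon> :: real assume u: "u \<in> l2_space M" and "\<epsilon> > 0"
  note eL = orthonormal_in_l2[OF on, OF UNIV_I]
  let ?a = "\<lambda>i. l2_inner M u (e i)"
  define S where "S = (\<lambda>n x. \<Sum>i<n. ?a i * e i x)"
  have SL: "S n \<in> l2_space M" for n unfolding S_def by (intro l2_space_lincomb eL)
  have summ: "summable (\<lambda>i. (cmod (?a i))\<^sup>2)"
    by (rule summableI_nonneg_bounded[where x = "(l2_norm M u)\<^sup>2"]) (auto intro: orthonormal_bessel[OF on _ _ u])
  have tri: "l2_norm M (\<lambda>x. S n x - S m x) < \<delta>"
    if "m \<le> n" "(\<Sum>i\<in>{m..<n}. (cmod (?a i))\<^sup>2) < \<delta>\<^sup>2" "\<delta> > 0" for m n \<delta>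
  proof -
    have "S n x - S m x = (\<Sum>i\<in>{m..<n}. ?a i * e i x)" for x
      unfolding S_def using that(1) sum_diff_nat_ivl[of 0 m n "\<lambda>i. ?a i * e i x"]
      by (simp add: atLeast0LessThan)
    hence "(l2_norm M (\<lambda>x. S n x - S m x))\<^sup>2 = (\<Sum>i\<in>{m..<n}. (cmod (?a i))\<^sup>2)"
      using orthonormal_norm_sq[OF on, of "{m..<n}" ?a] by simp
    thus ?thesis using that by (intro power2_less_imp_less[of _ \<delta>]) auto
  qed
  obtain g where g: "l2_tendsto M S g"
  proof (rule l2_complete[OF SL])
    fix \<delta> :: real assume d: "\<delta> > 0"
    hence "\<delta>\<^sup>2 > 0" by simp
    with summ obtain N where N: "\<And>m n. m \<ge> N \<Longrightarrow> norm (\<Sum>i\<in>{m..<n}. (cmod (?a i))\<^sup>2) < \<delta>\<^sup>2"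
      unfolding summable_Cauchy by metis
    have "l2_norm M (\<lambda>x. S m x - S n x) < \<delta>" if "m \<ge> N" "n \<ge> N" for m n
      using tri[of m n \<delta>] tri[of n m \<delta>] N[of m n] N[of n m] that d l2_norm_minus_commute[of M "S m" "S n"]
      by (cases "m \<le> n") (auto simp: sum_nonneg)
    thus "\<exists>N. \<forall>m\<ge>N. \<forall>n\<ge>N. l2_norm M (\<lambda>x. S m x - S n x) < \<delta>" by blast
  qed
  note gL = l2_tendstoD(2)[OF g]
  have "AE x in M. u x - g x = 0"
  proof (rule tot)
    show "(\<lambda>x. u x - g x) \<in> l2_space M" by (intro l2_space_diff u gL)
    fix j
    have "l2_inner M (S n) (e j) = ?a j" if "n \<ge> Suc j" for n
    proof -
      have "l2_inner M (S n) (e j) = (\<Sum>i<n. ?a i * l2_inner M (e i) (e j))"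
        unfolding S_def by (intro l2_inner_lincomb_left eL)
      also have "\<dots> = (\<Sum>i<n. if i = j then ?a i else 0)"
        using on by (intro sum.cong) (auto simp: orthonormal_on_def)
      finally show ?thesis using that by simp
    qed
    hence "(\<lambda>n. l2_inner M (S n) (e j)) \<longlonglongrightarrow> ?a j"
      by (intro tendsto_eventually) (auto simp: eventually_sequentially)
    with l2_tendsto_inner[OF g l2_tendsto_const[OF eL]] have "l2_inner M g (e j) = ?a j"
      using LIMSEQ_unique by blast
    thus "l2_inner M (\<lambda>x. u x - g x) (e j) = 0"
      by (simp add: l2_inner_diff_left u gL eL)
  qed
  hence ug: "AE x in M. S n x - g x = S n x - u x" for n by eventually_elim simp
  obtain n where n: "l2_norm M (\<lambda>x. S n x - g x) < \<epsilon>"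
    using LIMSEQ_D[OF l2_tendstoD(3)[OF g] \<open>\<epsilon> > 0\<close>] by auto
  have "l2_norm M (\<lambda>x. S n x - g x) = l2_norm M (\<lambda>x. S n x - u x)"
    using ug[of n] SL[of n] gL u by (intro l2_norm_cong_AE) (auto intro: l2_measurable l2_space_diff)
  hence "l2_norm M (\<lambda>x. u x - (\<Sum>i<n. ?a i * e i x)) < \<epsilon>"
    using n unfolding S_def by (simp add: l2_norm_minus_commute[of M u])
  thus "\<exists>F c. finite F \<and> F \<subseteq> UNIV \<and> l2_norm M (\<lambda>x. u x - (\<Sum>i\<in>F. c i * e i x)) < \<epsilon>"
    by (intro exI[of _ "{..<n}"] exI[of _ ?a]) auto
qed

section \<open>Characters and the torus\<close>

definition lattice :: "'a::euclidean_space set" where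
  "lattice = {k. \<forall>b\<in>Basis. k \<bullet> b \<in> \<int>}"

definition unit_box :: "'a::euclidean_space set" where
  "unit_box = {x. \<forall>b\<in>Basis. 0 < x \<bullet> b \<and> x \<bullet> b \<le> 1}"

text \<open>The index \<open>k\<close> ranges over the whole space: lattice points give Fourier series, general points the
  Fourier transform.\<close>

definition chr :: "'a::euclidean_space \<Rightarrow> 'a \<Rightarrow> complex" where
  "chr k x = cis (2 * pi * (k \<bullet> x))"

lemma norm_chr [simp]: "cmod (chr k x) = 1"
  by (simp add: chr_def)

lemma chr_add: "chr (k + l) x = chr k x * chr l x"
  by (simp add: chr_def cis_mult algebra_simps inner_add_left)

lemma chr_add_right: "chr k (x + y) = chr k x * chr k y"
  by (simp add: chr_def cis_mult algebra_simps inner_add_right)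

lemma chr_commute: "chr k x = chr x k"
  by (simp add: chr_def inner_commute)

lemma cnj_chr: "cnj (chr k x) = chr (- k) x"
  by (simp add: chr_def cis_cnj)

lemma chr_zero [simp]: "chr 0 x = 1"
  by (simp add: chr_def)

lemma chr_measurable [measurable]:
  assumes [measurable]: "f \<in> borel_measurable M" "g \<in> borel_measurable M"
  shows "(\<lambda>x. chr (f x) (g x)) \<in> borel_measurable M"
proof -
  have "cis \<in> borel_measurable borel"
    by (intro borel_measurable_continuous_onI continuous_intros)
  thus ?thesis unfolding chr_def by measurable
qed

lemma zero_in_lattice [simp]: "0 \<in> lattice"
  by (simp add: lattice_def)

lemma lattice_add: "k \<in> lattice \<Longrightarrow> l \<in> lattice \<Longrightarrow> k + l \<in> lattice"
  by (auto simp: lattice_def inner_add_left)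

lemma lattice_uminus: "k \<in> lattice \<Longrightarrow> - k \<in> lattice"
  by (auto simp: lattice_def)

lemma lattice_diff: "k \<in> lattice \<Longrightarrow> l \<in> lattice \<Longrightarrow> k - l \<in> lattice"
  using lattice_add[of k "-l"] by (simp add: lattice_uminus)

lemma Basis_in_lattice: "b \<in> Basis \<Longrightarrow> b \<in> lattice"
  by (auto simp: lattice_def inner_Basis)

lemma lattice_inner: "k \<in> lattice \<Longrightarrow> l \<in> lattice \<Longrightarrow> k \<bullet> l \<in> \<int>"
  by (subst euclidean_inner) (auto simp: lattice_def)

lemma chr_lattice: "k \<in> lattice \<Longrightarrow> l \<in> lattice \<Longrightarrow> chr k l = 1"
  using lattice_inner[of k l] by (auto simp: chr_def elim!: Ints_cases intro!: cis_multiple_2pi)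

lemma countable_lattice: "countable (lattice :: 'a::euclidean_space set)"
proof (rule countable_subset)
  show "lattice \<subseteq> (\<lambda>f. \<Sum>b\<in>Basis. f b *\<^sub>R (b::'a)) ` (PiE Basis (\<lambda>_. \<int>))"
  proof
    fix k :: 'a assume "k \<in> lattice"
    hence "k = (\<lambda>f. \<Sum>b\<in>Basis. f b *\<^sub>R b) (restrict (\<lambda>b. k \<bullet> b) Basis)"
      "restrict (\<lambda>b. k \<bullet> b) Basis \<in> PiE Basis (\<lambda>_. \<int>)"
      by (auto simp: lattice_def euclidean_representation)
    thus "k \<in> (\<lambda>f. \<Sum>b\<in>Basis. f b *\<^sub>R (b::'a)) ` (PiE Basis (\<lambda>_. \<int>))" by (rule image_eqI)
  qed
  have "countable (\<int> :: real set)" unfolding Ints_def by (intro countable_image) auto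
  thus "countable ((\<lambda>f. \<Sum>b\<in>Basis. f b *\<^sub>R (b::'a)) ` (PiE Basis (\<lambda>_. \<int>)))"
    by (intro countable_image countable_PiE) auto
qed

lemma infinite_lattice: "infinite (lattice :: 'a::euclidean_space set)"
proof
  assume fin: "finite (lattice :: 'a set)"
  obtain b :: 'a where b: "b \<in> Basis" using nonempty_Basis by blast
  have "range (\<lambda>n. real n *\<^sub>R b) \<subseteq> lattice"
    using b by (auto simp: lattice_def inner_Basis)
  hence "finite (range (\<lambda>n. real n *\<^sub>R b))" using fin finite_subset by blast
  moreover have "inj (\<lambda>n. real n *\<^sub>R b)" using b by (auto intro!: injI simp: nonzero_Basis)
  ultimately show False using finite_imageD infinite_UNIV_nat by blast
qed

text \<open>Series over the lattice are written as series over \<^typ>\<open>nat\<close> through this enumeration.\<close>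

definition lat :: "nat \<Rightarrow> 'a::euclidean_space" where
  "lat = from_nat_into lattice"

lemma bij_lat: "bij_betw (lat :: nat \<Rightarrow> 'a) UNIV (lattice :: 'a::euclidean_space set)"
  unfolding lat_def by (rule bij_betw_from_nat_into[OF countable_lattice infinite_lattice])

lemma lat_in_lattice [simp]: "lat n \<in> lattice"
  using bij_betwE[OF bij_lat] by blast

lemma unit_box_borel [measurable]: "(unit_box :: 'a::euclidean_space set) \<in> sets borel"
proof -
  have "unit_box = (\<Inter>b\<in>Basis. {x::'a. 0 < x \<bullet> b} \<inter> {x. x \<bullet> b \<le> 1})"
    by (auto simp: unit_box_def)
  also have "\<dots> \<in> sets borel" by (intro sets.countable_INT'' sets.finite_INT) (auto simp: nonempty_Basis)
  finally show ?thesis .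
qed

subsection \<open>Density of the trigonometric polynomials\<close>

text \<open>The closed span of the lattice characters. It is studied for an arbitrary finite measure on the box,
  because it is needed both for Lebesgue measure and for the weighted measure \<open>w ds\<close>.\<close>

definition trig_closure :: "'a::euclidean_space measure \<Rightarrow> ('a \<Rightarrow> complex) set" where
  "trig_closure \<mu> = {f \<in> l2_space \<mu>. \<forall>\<epsilon>>0. \<exists>F c. finite F \<and> F \<subseteq> lattice \<and>
     l2_norm \<mu> (\<lambda>x. f x - (\<Sum>k\<in>F. c k * chr k x)) < \<epsilon>}"

context
  fixes \<mu> :: "'a::euclidean_space measure"
  assumes fin: "finite_measure \<mu>" and sets_mu [measurable_cong]: "sets \<mu> = sets borel"
    and box: "AE x in \<mu>. x \<in> unit_box"
begin

interpretation finite_measure \<mu> by (fact fin)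

lemma space_mu: "space \<mu> = UNIV"
  using sets_eq_imp_space_eq[OF sets_mu] by simp

lemma bounded_in_l2:
  assumes [measurable]: "f \<in> borel_measurable \<mu>" and "\<And>x. cmod (f x) \<le> B"
  shows "f \<in> l2_space \<mu>"
  using l2_space_bounded_mult[of "\<lambda>_. 1" \<mu> f B] assms by (simp add: l2_space_def)

lemma chr_in_l2: "chr k \<in> l2_space \<mu>"
  by (rule bounded_in_l2[where B = 1]) auto

lemma trig_in_l2: "(\<lambda>x. \<Sum>k\<in>F. c k * chr k x) \<in> l2_space \<mu>"
  by (intro l2_space_lincomb chr_in_l2)

lemma trig_closure_in_l2: "f \<in> trig_closure \<mu> \<Longrightarrow> f \<in> l2_space \<mu>"
  by (simp add: trig_closure_def)

lemma trig_closure_limit: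
  assumes "l2_tendsto \<mu> f g" "\<And>n. f n \<in> trig_closure \<mu>"
  shows "g \<in> trig_closure \<mu>"
  unfolding trig_closure_def
proof (intro CollectI conjI allI impI)
  note F = l2_tendstoD[OF assms(1)]
  show "g \<in> l2_space \<mu>" by (rule F)
  fix \<epsilon> :: real assume "\<epsilon> > 0"
  hence e: "\<epsilon>/2 > 0" by simp
  obtain n where n: "l2_norm \<mu> (\<lambda>x. f n x - g x) < \<epsilon>/2"
    using LIMSEQ_D[OF F(3) e] by auto
  obtain K c where K: "finite K" "K \<subseteq> lattice" "l2_norm \<mu> (\<lambda>x. f n x - (\<Sum>k\<in>K. c k * chr k x)) < \<epsilon>/2"
    using assms(2)[of n] e unfolding trig_closure_def by blast
  have "l2_norm \<mu> (\<lambda>x. g x - (\<Sum>k\<in>K. c k * chr k x)) < \<epsilon>"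
    using l2_norm_diff_triangle[OF F(2) F(1)[of n] trig_in_l2[of c K]] n K(3)
      l2_norm_minus_commute[of \<mu> g "f n"] by simp
  with K show "\<exists>F c. finite F \<and> F \<subseteq> lattice \<and> l2_norm \<mu> (\<lambda>x. g x - (\<Sum>k\<in>F. c k * chr k x)) < \<epsilon>"
    by blast
qed

lemma trig_closure_seq:
  assumes f: "f \<in> trig_closure \<mu>"
  obtains F c where "\<And>n. finite (F n)" "\<And>n. F n \<subseteq> lattice"
    "l2_tendsto \<mu> (\<lambda>n x. \<Sum>k\<in>F n. c n k * chr k x) f"
proof -
  have "\<forall>n. \<exists>F c. finite F \<and> F \<subseteq> lattice \<and> l2_norm \<mu> (\<lambda>x. f x - (\<Sum>k\<in>F. c k * chr k x)) < 1 / real (Suc n)"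
  proof
    fix n
    have "0 < 1 / real (Suc n)" by simp
    thus "\<exists>F c. finite F \<and> F \<subseteq> lattice \<and> l2_norm \<mu> (\<lambda>x. f x - (\<Sum>k\<in>F. c k * chr k x)) < 1 / real (Suc n)"
      using f unfolding trig_closure_def by blast
  qed
  then obtain F c where F: "\<And>n. finite (F n)" "\<And>n. F n \<subseteq> lattice"
    "\<And>n. l2_norm \<mu> (\<lambda>x. f x - (\<Sum>k\<in>F n. c n k * chr k x)) < 1 / real (Suc n)"
    unfolding choice_iff by blast
  have "(\<lambda>n. l2_norm \<mu> (\<lambda>x. (\<Sum>k\<in>F n. c n k * chr k x) - f x)) \<longlonglongrightarrow> 0"
    by (rule Lim_null_comparison[OF _ LIMSEQ_inverse_real_of_nat])
       (use F(3) in \<open>auto simp: l2_norm_minus_commute[of _ _ f] inverse_eq_divide less_imp_le\<close>)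
  hence "l2_tendsto \<mu> (\<lambda>n x. \<Sum>k\<in>F n. c n k * chr k x) f"
    using trig_closure_in_l2[OF f] by (simp add: l2_tendsto_def trig_in_l2)
  with F that show thesis by blast
qed

lemma trig_in_trig_closure:
  assumes "finite F" "F \<subseteq> lattice"
  shows "(\<lambda>x. \<Sum>k\<in>F. c k * chr k x) \<in> trig_closure \<mu>"
  unfolding trig_closure_def
  by (intro CollectI conjI trig_in_l2 allI impI exI[of _ F] exI[of _ c] assms) (simp add: l2_norm_def)

lemma chr_in_trig_closure: "k \<in> lattice \<Longrightarrow> chr k \<in> trig_closure \<mu>"
  using trig_in_trig_closure[of "{k}" "\<lambda>_. 1"] by simp

lemma trig_closure_cmult:
  assumes f: "f \<in> trig_closure \<mu>"
  shows "(\<lambda>x. a * f x) \<in> trig_closure \<mu>"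
proof -
  obtain F c where F: "\<And>n. finite (F n)" "\<And>n. F n \<subseteq> lattice"
    "l2_tendsto \<mu> (\<lambda>n x. \<Sum>k\<in>F n. c n k * chr k x) f" using trig_closure_seq[OF f] by blast
  show ?thesis
    by (rule trig_closure_limit[OF l2_tendsto_cmult[OF F(3)]])
       (use F(1,2) in \<open>auto simp: sum_distrib_left mult.assoc[symmetric] intro!: trig_in_trig_closure\<close>)
qed

lemma trig_closure_add:
  assumes f: "f \<in> trig_closure \<mu>" and g: "g \<in> trig_closure \<mu>"
  shows "(\<lambda>x. f x + g x) \<in> trig_closure \<mu>"
proof -
  obtain F c where F: "\<And>n. finite (F n)" "\<And>n. F n \<subseteq> lattice"
    "l2_tendsto \<mu> (\<lambda>n x. \<Sum>k\<in>F n. c n k * chr k x) f" using trig_closure_seq[OF f] by blast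
  obtain H d where H: "\<And>n. finite (H n)" "\<And>n. H n \<subseteq> lattice"
    "l2_tendsto \<mu> (\<lambda>n x. \<Sum>k\<in>H n. d n k * chr k x) g" using trig_closure_seq[OF g] by blast
  show ?thesis
  proof (rule trig_closure_limit[OF l2_tendsto_add[OF F(3) H(3)]])
    fix n
    let ?c = "\<lambda>k. (if k \<in> F n then c n k else 0) + (if k \<in> H n then d n k else 0)"
    have "(\<Sum>k\<in>F n. c n k * chr k x) + (\<Sum>k\<in>H n. d n k * chr k x) =
        (\<Sum>k\<in>F n \<union> H n. ?c k * chr k x)" for x
    proof -
      have "(\<Sum>k\<in>F n. c n k * chr k x) = (\<Sum>k\<in>F n \<union> H n. (if k \<in> F n then c n k else 0) * chr k x)"
        by (rule sum.mono_neutral_cong_left) (use F(1) H(1) in auto)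
      moreover have "(\<Sum>k\<in>H n. d n k * chr k x) = (\<Sum>k\<in>F n \<union> H n. (if k \<in> H n then d n k else 0) * chr k x)"
        by (rule sum.mono_neutral_cong_left) (use F(1) H(1) in auto)
      ultimately show ?thesis by (simp add: sum.distrib[symmetric] ring_distribs)
    qed
    thus "(\<lambda>x. (\<Sum>k\<in>F n. c n k * chr k x) + (\<Sum>k\<in>H n. d n k * chr k x)) \<in> trig_closure \<mu>"
      using F(1,2) H(1,2) trig_in_trig_closure[of "F n \<union> H n" ?c] by simp
  qed
qed

lemma trig_closure_sum:
  "(\<And>i. i \<in> I \<Longrightarrow> f i \<in> trig_closure \<mu>) \<Longrightarrow> (\<lambda>x. \<Sum>i\<in>I. f i x) \<in> trig_closure \<mu>"
  using trig_in_trig_closure[of "{}"]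
  by (induction I rule: infinite_finite_induct) (auto intro: trig_closure_add)

lemma trig_closure_chr_mult:
  assumes f: "f \<in> trig_closure \<mu>" and l: "l \<in> lattice"
  shows "(\<lambda>x. chr l x * f x) \<in> trig_closure \<mu>"
proof -
  obtain F c where F: "\<And>n. finite (F n)" "\<And>n. F n \<subseteq> lattice"
    "l2_tendsto \<mu> (\<lambda>n x. \<Sum>k\<in>F n. c n k * chr k x) f" using trig_closure_seq[OF f] by blast
  show ?thesis
  proof (rule trig_closure_limit[OF l2_tendsto_bounded_mult[OF F(3), where B = 1]])
    fix n
    have "(\<lambda>x. chr l x * (\<Sum>k\<in>F n. c n k * chr k x)) = (\<lambda>x. \<Sum>k\<in>F n. c n k * chr (l + k) x)"
      by (auto simp: sum_distrib_left chr_add mult_ac)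
    also have "\<dots> \<in> trig_closure \<mu>"
      using F(2)[of n] l by (intro trig_closure_sum trig_closure_cmult chr_in_trig_closure lattice_add) auto
    finally show "(\<lambda>x. chr l x * (\<Sum>k\<in>F n. c n k * chr k x)) \<in> trig_closure \<mu>" .
  qed auto
qed

text \<open>Multiplying \<open>g\<close> by a trigonometric polynomial stays in the closure, and approximating \<open>f\<close> by such
  polynomials is harmless when \<open>g\<close> is bounded. Hence the bounded elements of the closure form an algebra.\<close>

lemma trig_closure_mult:
  assumes f: "f \<in> trig_closure \<mu>" and g: "g \<in> trig_closure \<mu>" and B: "\<And>x. cmod (g x) \<le> B"
  shows "(\<lambda>x. f x * g x) \<in> trig_closure \<mu>"
proof -
  obtain F c where F: "\<And>n. finite (F n)" "\<And>n. F n \<subseteq> lattice"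
    "l2_tendsto \<mu> (\<lambda>n x. \<Sum>k\<in>F n. c n k * chr k x) f" using trig_closure_seq[OF f] by blast
  have "(\<lambda>x. g x * f x) \<in> trig_closure \<mu>"
  proof (rule trig_closure_limit[OF l2_tendsto_bounded_mult[OF F(3) _ B]])
    show "g \<in> borel_measurable \<mu>" using trig_closure_in_l2[OF g] by (rule l2_measurable)
    fix n
    have "(\<lambda>x. g x * (\<Sum>k\<in>F n. c n k * chr k x)) = (\<lambda>x. \<Sum>k\<in>F n. c n k * (chr k x * g x))"
      by (auto simp: sum_distrib_left mult_ac)
    also have "\<dots> \<in> trig_closure \<mu>"
      using F(2)[of n] g by (intro trig_closure_sum trig_closure_cmult trig_closure_chr_mult) auto
    finally show "(\<lambda>x. g x * (\<Sum>k\<in>F n. c n k * chr k x)) \<in> trig_closure \<mu>" .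
  qed
  thus ?thesis by (simp add: mult.commute)
qed

lemma trig_closure_bounded_limit:
  assumes f: "\<And>n. f n \<in> trig_closure \<mu>" and B: "\<And>n x. cmod (f n x) \<le> B"
    and lim: "\<And>x. (\<lambda>n. f n x) \<longlonglongrightarrow> g x"
  shows "g \<in> trig_closure \<mu>"
proof -
  have m [measurable]: "f n \<in> borel_measurable \<mu>" for n
    using f[of n] trig_closure_in_l2 l2_measurable by blast
  have "g \<in> borel_measurable \<mu>" using lim by (rule borel_measurable_LIMSEQ_metric[OF m])
  moreover have "(\<lambda>_. complex_of_real B) \<in> l2_space \<mu>" by (simp add: l2_space_def)
  moreover have "cmod (f n x) \<le> cmod (complex_of_real B)" for n x
    using B[of n x] by simp
  ultimately have "l2_tendsto \<mu> f g"
    by (intro l2_dominated_convergence[where h = "\<lambda>_. complex_of_real B"] m) (auto simp: lim)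
  from trig_closure_limit[OF this f] show ?thesis .
qed

lemma trig_closure_cong_AE:
  assumes f: "f \<in> trig_closure \<mu>" and g: "g \<in> borel_measurable \<mu>" and eq: "AE x in \<mu>. f x = g x"
  shows "g \<in> trig_closure \<mu>"
proof (rule trig_closure_limit)
  note fL = trig_closure_in_l2[OF f]
  have "l2_norm \<mu> (\<lambda>x. f x - g x) = l2_norm \<mu> (\<lambda>x. 0)"
    using eq g l2_measurable[OF fL] by (intro l2_norm_cong_AE) auto
  thus "l2_tendsto \<mu> (\<lambda>n. f) g"
    using fL l2_space_cong_AE[OF fL g eq] by (simp add: l2_tendsto_def l2_norm_def)
qed (rule f)

lemma trig_closure_polynomial:
  assumes p: "real_polynomial_function p" and b: "b \<in> lattice"
  shows "(\<lambda>x. complex_of_real (p (chr b x))) \<in> trig_closure \<mu> \<and> (\<exists>B. \<forall>x. \<bar>p (chr b x)\<bar> \<le> B)"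
  using p
proof (induction p rule: real_polynomial_function.induct)
  case (linear h)
  interpret h: bounded_linear h by (rule linear)
  have h: "complex_of_real (h z) = complex_of_real (h 1) * ((z + cnj z) / 2) + complex_of_real (h \<i>) * (\<i> * (cnj z - z) / 2)" for z
  proof -
    have "z = Re z *\<^sub>R 1 + Im z *\<^sub>R \<i>" by (simp add: complex_eq_iff)
    hence "h z = Re z * h 1 + Im z * h \<i>" by (metis h.add h.scaleR real_scaleR_def)
    moreover have "(z + cnj z) / 2 = complex_of_real (Re z)" "\<i> * (cnj z - z) / 2 = complex_of_real (Im z)"
      by (simp_all add: complex_eq_iff)
    ultimately show ?thesis by simp
  qed
  have "(\<lambda>x. complex_of_real (h (chr b x))) =
      (\<lambda>x. (complex_of_real (h 1) / 2 - complex_of_real (h \<i>) * \<i> / 2) * chr b x +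
        (complex_of_real (h 1) / 2 + complex_of_real (h \<i>) * \<i> / 2) * chr (- b) x)"
    by (subst h) (auto simp: cnj_chr field_simps)
  also have "\<dots> \<in> trig_closure \<mu>"
    using b by (intro trig_closure_add trig_closure_cmult chr_in_trig_closure lattice_uminus)
  finally have 1: "(\<lambda>x. complex_of_real (h (chr b x))) \<in> trig_closure \<mu>" .
  obtain K where "\<And>z. norm (h z) \<le> norm z * K" using h.bounded by blast
  from this[of "chr b _"] have "\<forall>x. \<bar>h (chr b x)\<bar> \<le> K" by simp
  with 1 show ?case by blast
next
  case (const c)
  show ?case using trig_closure_cmult[OF chr_in_trig_closure[OF zero_in_lattice], of "complex_of_real c"] by auto
next
  case (add p q)
  then obtain B C where BC: "\<forall>x. \<bar>p (chr b x)\<bar> \<le> B" "\<forall>x. \<bar>q (chr b x)\<bar> \<le> C" by blast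
  hence "\<forall>x. \<bar>p (chr b x) + q (chr b x)\<bar> \<le> B + C" by (auto intro!: order_trans[OF abs_triangle_ineq] add_mono)
  moreover from add have "(\<lambda>x. complex_of_real (p (chr b x)) + complex_of_real (q (chr b x))) \<in> trig_closure \<mu>"
    by (intro trig_closure_add) auto
  ultimately show ?case by auto
next
  case (mult p q)
  then obtain B C where BC: "\<forall>x. \<bar>p (chr b x)\<bar> \<le> B" "\<forall>x. \<bar>q (chr b x)\<bar> \<le> C" by blast
  hence "\<forall>x. \<bar>p (chr b x) * q (chr b x)\<bar> \<le> B * C"
    by (auto simp: abs_mult intro!: mult_mono')
  moreover from mult BC have "(\<lambda>x. complex_of_real (p (chr b x)) * complex_of_real (q (chr b x))) \<in> trig_closure \<mu>"
    by (intro trig_closure_mult[where B = C]) auto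
  ultimately show ?case by auto
qed

text \<open>The character of \<open>b\<close> takes values in the unit circle, where \<open>h\<close> is a uniform limit of
  polynomials in the real and imaginary parts.\<close>

lemma trig_closure_continuous:
  assumes h: "continuous_on UNIV (h :: complex \<Rightarrow> real)" and b: "b \<in> lattice"
  shows "(\<lambda>x. complex_of_real (h (chr b x))) \<in> trig_closure \<mu>"
proof -
  have "\<exists>p. polynomial_function p \<and> (\<forall>z\<in>sphere 0 1. norm (h z - p z) < 1 / real (Suc n))" for n
    using h by (intro Stone_Weierstrass_polynomial_function) (auto intro: continuous_on_subset)
  then obtain p where p: "\<And>n. polynomial_function (p n)"
    "\<And>n z. z \<in> sphere 0 1 \<Longrightarrow> norm (h z - p n z) < 1 / real (Suc n)" by metis
  have pc: "\<bar>h (chr b x) - p n (chr b x)\<bar> < 1 / real (Suc n)" for n x using p(2)[of "chr b x" n] by simp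
  have "compact (h ` sphere 0 1)" using h by (intro compact_continuous_image) (auto intro: continuous_on_subset)
  then obtain B where "\<And>z. z \<in> sphere 0 1 \<Longrightarrow> \<bar>h z\<bar> \<le> B"
    by (force simp: bounded_iff dest!: compact_imp_bounded)
  hence B: "\<bar>h (chr b x)\<bar> \<le> B" for x by simp
  show ?thesis
  proof (rule trig_closure_bounded_limit)
    show "(\<lambda>x. complex_of_real (p n (chr b x))) \<in> trig_closure \<mu>" for n
      using trig_closure_polynomial[OF _ b, of "p n"] p(1)[of n] by (simp add: real_polynomial_function_eq)
    show "cmod (complex_of_real (p n (chr b x))) \<le> B + 1" for n x
    proof -
      have "1 / real (Suc n) \<le> 1" by simp
      with pc[where x=x and n=n] B[of x] show ?thesis unfolding norm_of_real by linarith
    qed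
    show "(\<lambda>n. complex_of_real (p n (chr b x))) \<longlonglongrightarrow> complex_of_real (h (chr b x))" for x
    proof (intro tendsto_of_real)
      have "(\<lambda>n. p n (chr b x) - h (chr b x)) \<longlonglongrightarrow> 0"
        by (rule Lim_null_comparison[OF _ LIMSEQ_inverse_real_of_nat])
           (use pc in \<open>auto simp: inverse_eq_divide abs_minus_commute less_imp_le\<close>)
      thus "(\<lambda>n. p n (chr b x)) \<longlonglongrightarrow> h (chr b x)" by (simp add: LIM_zero_iff)
    qed
  qed
qed

text \<open>The sets whose indicator is a limit of trigonometric polynomials form a \<open>\<sigma>\<close>-algebra, and it
  contains the half spaces because on the box a coordinate is a Borel function of its character.\<close>

definition trig_sets :: "'a set set" where
  "trig_sets = {A \<in> sets borel. (\<lambda>x. indicator A x) \<in> trig_closure \<mu>}"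

lemma trig_sets_cong_AE:
  assumes "A \<in> trig_sets" "B \<in> sets borel" "AE x in \<mu>. x \<in> A \<longleftrightarrow> x \<in> B"
  shows "B \<in> trig_sets"
proof -
  have [measurable]: "B \<in> sets \<mu>" using assms(2) by (simp add: sets_mu)
  have "(\<lambda>x. indicator B x) \<in> trig_closure \<mu>"
  proof (rule trig_closure_cong_AE)
    show "(\<lambda>x. indicator A x) \<in> trig_closure \<mu>" using assms(1) by (simp add: trig_sets_def)
    show "AE x in \<mu>. indicator A x = (indicator B x :: complex)"
      using assms(3) by eventually_elim (simp add: indicator_def)
  qed measurable
  thus ?thesis using assms(2) by (simp add: trig_sets_def)
qed

lemma trig_sets_UNIV: "UNIV \<in> trig_sets"
proof -
  have "(\<lambda>x. indicator UNIV x) = (chr 0 :: 'a \<Rightarrow> complex)" by (simp add: fun_eq_iff)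
  thus ?thesis using chr_in_trig_closure[OF zero_in_lattice] by (simp add: trig_sets_def)
qed

lemma trig_sets_Compl: "A \<in> trig_sets \<Longrightarrow> - A \<in> trig_sets"
proof -
  assume A: "A \<in> trig_sets"
  have "(\<lambda>x. indicator UNIV x + (-1) * indicator A x) \<in> trig_closure \<mu>"
    using A trig_sets_UNIV by (intro trig_closure_add trig_closure_cmult) (auto simp: trig_sets_def)
  also have "(\<lambda>x. indicator UNIV x + (-1) * indicator A x) = (\<lambda>x. indicator (- A) x :: complex)"
    by (auto simp: indicator_def)
  finally show ?thesis using A by (auto simp: trig_sets_def)
qed

lemma trig_sets_Int: "A \<in> trig_sets \<Longrightarrow> B \<in> trig_sets \<Longrightarrow> A \<inter> B \<in> trig_sets"
proof -
  assume A: "A \<in> trig_sets" and B: "B \<in> trig_sets"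
  have "(\<lambda>x. indicator A x * indicator B x) \<in> trig_closure \<mu>"
    using A B by (intro trig_closure_mult[where B = 1]) (auto simp: trig_sets_def indicator_def)
  also have "(\<lambda>x. indicator A x * indicator B x) = (indicator (A \<inter> B) :: 'a \<Rightarrow> complex)"
    by (auto simp: fun_eq_iff indicator_def)
  finally show "A \<inter> B \<in> trig_sets" using A B by (auto simp: trig_sets_def)
qed

lemma trig_sets_Un: "A \<in> trig_sets \<Longrightarrow> B \<in> trig_sets \<Longrightarrow> A \<union> B \<in> trig_sets"
  using trig_sets_Compl[OF trig_sets_Int[OF trig_sets_Compl trig_sets_Compl]] by simp

lemma trig_sets_UN:
  fixes A :: "nat \<Rightarrow> 'a set"
  assumes A: "\<And>n. A n \<in> trig_sets"
  shows "(\<Union>n. A n) \<in> trig_sets"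
proof -
  have fin: "(\<Union>i<n. A i) \<in> trig_sets" for n
    using trig_sets_Compl[OF trig_sets_UNIV]
    by (induction n) (auto simp: lessThan_Suc intro!: trig_sets_Un A)
  have "(\<lambda>x. indicator (\<Union>n. A n) x) \<in> trig_closure \<mu>"
  proof (rule trig_closure_bounded_limit)
    show "(\<lambda>x. indicator (\<Union>i<n. A i) x) \<in> trig_closure \<mu>" for n
      using fin[of n] by (simp add: trig_sets_def)
    show "cmod (indicator (\<Union>i<n. A i) x) \<le> 1" for n x by (simp add: indicator_def)
    show "(\<lambda>n. indicator (\<Union>i<n. A i) x) \<longlonglongrightarrow> (indicator (\<Union>n. A n) x :: complex)" for x
      by (rule LIMSEQ_indicator_UN)
  qed
  thus ?thesis using A by (auto simp: trig_sets_def)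
qed

lemma trig_sets_chr_vimage:
  assumes K: "closed K" "K \<noteq> {}" and b: "b \<in> lattice"
  shows "{x. chr b x \<in> K} \<in> trig_sets"
proof -
  have "(\<lambda>x. indicator {x. chr b x \<in> K} x) \<in> trig_closure \<mu>"
  proof (rule trig_closure_bounded_limit)
    let ?h = "\<lambda>n z. max 0 (1 - real n * infdist z K)"
    show "(\<lambda>x. complex_of_real (?h n (chr b x))) \<in> trig_closure \<mu>" for n
      by (rule trig_closure_continuous[OF _ b]) (intro continuous_intros)
    show "cmod (complex_of_real (?h n (chr b x))) \<le> 1" for n x
      using mult_nonneg_nonneg[OF of_nat_0_le_iff[of n, where 'a = real] infdist_nonneg[of "chr b x" K]]
      unfolding norm_of_real by (auto simp: max_def)
    show "(\<lambda>n. complex_of_real (?h n (chr b x))) \<longlonglongrightarrow> indicator {x. chr b x \<in> K} x" for x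
    proof (cases "chr b x \<in> K")
      case False
      hence pos: "infdist (chr b x) K > 0" using K by (simp add: infdist_pos_not_in_closed)
      obtain N where N: "1 / infdist (chr b x) K < real N" using reals_Archimedean2 by blast
      have "?h n (chr b x) = 0" if "n \<ge> N" for n
      proof -
        have "1 / infdist (chr b x) K < real n" using N that by linarith
        hence "1 < real n * infdist (chr b x) K" using pos by (simp add: field_simps)
        thus ?thesis by simp
      qed
      hence "eventually (\<lambda>n. complex_of_real (?h n (chr b x)) = 0) sequentially"
        by (auto simp: eventually_sequentially)
      thus ?thesis using False by (simp add: tendsto_eventually)
    qed simp
  qed
  moreover have "{x. chr b x \<in> K} \<in> sets borel"
    using borel_closed[OF K(1)] by measurable
  ultimately show ?thesis by (simp add: trig_sets_def)
qed

text \<open>Up to a null set the half space is a countable union of preimages of compact arcs under one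
  character: \<open>x \<mapsto> cis(2\<pi>x)\<close> is injective on \<open>(0,1]\<close>, and \<open>(0,c]\<close> is a union of compact intervals.\<close>

lemma trig_sets_halfspace:
  assumes b: "b \<in> Basis"
  shows "{x. x \<bullet> b \<le> c} \<in> trig_sets"
proof -
  have bl: "b \<in> lattice" using b by (rule Basis_in_lattice)
  consider "c \<ge> 1" | "c \<le> 0" | "0 < c" "c < 1" by linarith
  thus ?thesis
  proof cases
    case 1
    have "AE x in \<mu>. x \<in> UNIV \<longleftrightarrow> x \<in> {x. x \<bullet> b \<le> c}"
      using box by eventually_elim (use b 1 in \<open>force simp: unit_box_def\<close>)
    thus ?thesis by (intro trig_sets_cong_AE[OF trig_sets_UNIV]) auto
  next
    case 2
    have "AE x in \<mu>. x \<in> - UNIV \<longleftrightarrow> x \<in> {x. x \<bullet> b \<le> c}"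
      using box by eventually_elim (use b 2 in \<open>force simp: unit_box_def\<close>)
    thus ?thesis by (intro trig_sets_cong_AE[OF trig_sets_Compl[OF trig_sets_UNIV]]) auto
  next
    case 3
    define K where "K = (\<lambda>n. (\<lambda>t. cis (2 * pi * t)) ` {min c (1 / real (Suc n))..c})"
    have "compact (K n)" for n unfolding K_def by (intro compact_continuous_image continuous_intros) auto
    moreover have "K n \<noteq> {}" for n by (auto simp: K_def)
    ultimately have "{x. chr b x \<in> K n} \<in> trig_sets" for n
      using bl by (intro trig_sets_chr_vimage compact_imp_closed)
    hence S: "(\<Union>n. {x. chr b x \<in> K n}) \<in> trig_sets" by (rule trig_sets_UN)
    have "AE x in \<mu>. x \<in> (\<Union>n. {x. chr b x \<in> K n}) \<longleftrightarrow> x \<in> {x. x \<bullet> b \<le> c}"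
      using box
    proof eventually_elim
      case (elim x)
      hence x: "0 < x \<bullet> b" "x \<bullet> b \<le> 1" using b by (auto simp: unit_box_def)
      show ?case
      proof
        assume "x \<in> (\<Union>n. {x. chr b x \<in> K n})"
        then obtain n t where t: "min c (1 / real (Suc n)) \<le> t" "t \<le> c" "cis (2 * pi * (b \<bullet> x)) = cis (2 * pi * t)"
          by (auto simp: K_def chr_def)
        have "min c (1 / real (Suc n)) > 0" using 3 by simp
        hence "0 < t" using t(1) by (rule less_le_trans)
        hence t0: "0 < t" "t < 1" using t(2) 3 by auto
        have "\<i> * complex_of_real (2 * pi * (b \<bullet> x)) = \<i> * complex_of_real (2 * pi * t)"
        proof (rule exp_complex_eqI)
          show "exp (\<i> * complex_of_real (2 * pi * (b \<bullet> x))) = exp (\<i> * complex_of_real (2 * pi * t))"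
            using t(3) by (simp add: cis_conv_exp)
          have "\<bar>b \<bullet> x - t\<bar> < 1" using x t0 unfolding inner_commute[of b x] by linarith
          hence "2 * pi * \<bar>b \<bullet> x - t\<bar> < 2 * pi" by simp
          thus "\<bar>Im (\<i> * complex_of_real (2 * pi * (b \<bullet> x))) - Im (\<i> * complex_of_real (2 * pi * t))\<bar> < 2 * pi"
            by (simp flip: right_diff_distrib add: abs_mult)
        qed
        hence "b \<bullet> x = t" by (simp only: mult_cancel_left of_real_eq_iff) simp
        thus "x \<in> {x. x \<bullet> b \<le> c}" using t(2) by (simp add: inner_commute)
      next
        assume xc: "x \<in> {x. x \<bullet> b \<le> c}"
        obtain n where "inverse (real (Suc n)) < x \<bullet> b" using reals_Archimedean[OF x(1)] by blast
        hence "x \<bullet> b \<in> {min c (1 / real (Suc n))..c}" using xc by (simp add: inverse_eq_divide)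
        hence "chr b x \<in> K n" unfolding K_def chr_def inner_commute[of b x] by (rule imageI)
        thus "x \<in> (\<Union>n. {x. chr b x \<in> K n})" by blast
      qed
    qed
    thus ?thesis by (intro trig_sets_cong_AE[OF S]) auto
  qed
qed

lemma trig_sets_borel: "trig_sets = sets borel"
proof
  show "trig_sets \<subseteq> sets borel" by (auto simp: trig_sets_def)
  interpret S: sigma_algebra UNIV trig_sets
    unfolding sigma_algebra_iff2
    using trig_sets_Compl[OF trig_sets_UNIV] trig_sets_Compl trig_sets_UN
    by (auto simp: Compl_eq_Diff_UNIV[symmetric] image_subset_iff)
  have "sets borel = sigma_sets UNIV ((\<lambda> (a, i). {x::'a. x \<bullet> i \<le> a}) ` (UNIV \<times> Basis))"
    by (subst borel_eq_halfspace_le) (simp add: sets_measure_of)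
  also have "\<dots> \<subseteq> trig_sets"
    by (intro S.sigma_sets_subset) (auto intro: trig_sets_halfspace)
  finally show "sets borel \<subseteq> trig_sets" .
qed

lemma trig_closure_eq: "trig_closure \<mu> = l2_space \<mu>"
proof
  show "trig_closure \<mu> \<subseteq> l2_space \<mu>" by (auto simp: trig_closure_def)
  show "l2_space \<mu> \<subseteq> trig_closure \<mu>"
  proof
    fix f assume f: "f \<in> l2_space \<mu>"
    note [measurable] = l2_measurable[OF f]
    obtain s where s: "\<And>i. simple_function \<mu> (s i)" "\<And>x. (\<lambda>i. s i x) \<longlonglongrightarrow> f x"
      "\<And>i x. dist (s i x) 0 \<le> 2 * dist (f x) 0"
      using borel_measurable_implies_sequence_metric[OF l2_measurable[OF f], of 0] by (auto simp: space_mu)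
    have sC: "s i \<in> trig_closure \<mu>" for i
    proof -
      have "s i = (\<lambda>x. \<Sum>y\<in>s i ` UNIV. y * indicator (s i -` {y}) x)"
      proof
        fix x
        have "s i x = (\<Sum>y\<in>s i ` UNIV. indicator (s i -` {y}) x *\<^sub>R y)"
          by (rule simple_function_indicator_representation_banach[OF s(1)[of i], of x, unfolded space_mu Int_UNIV_right, OF UNIV_I])
        also have "\<dots> = (\<Sum>y\<in>s i ` UNIV. y * indicator (s i -` {y}) x)"
          by (intro sum.cong) (auto simp: indicator_def)
        finally show "s i x = \<dots>" .
      qed
      also have "\<dots> \<in> trig_closure \<mu>"
      proof (intro trig_closure_sum trig_closure_cmult)
        fix y
        have "s i -` {y} \<in> trig_sets"
          using simple_functionD(2)[OF s(1)[of i], of "{y}"] by (simp add: space_mu sets_mu trig_sets_borel)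
        thus "indicator (s i -` {y}) \<in> trig_closure \<mu>" by (simp add: trig_sets_def)
      qed
      finally show ?thesis .
    qed
    have "l2_tendsto \<mu> s f"
    proof (rule l2_dominated_convergence)
      show "(\<lambda>x. 2 * f x) \<in> l2_space \<mu>" using f by (rule l2_space_cmult)
      show "AE x in \<mu>. cmod (s n x) \<le> cmod (2 * f x)" for n using s(3) by (simp add: norm_mult)
      show "s n \<in> borel_measurable \<mu>" for n using s(1) by (rule borel_measurable_simple_function)
    qed (use s(2) in auto)
    from trig_closure_limit[OF this sC] show "f \<in> trig_closure \<mu>" .
  qed
qed

theorem trigonometric_spanning: "l2_spanning \<mu> chr lattice"
  unfolding l2_spanning_def using trig_closure_eq by (auto simp: trig_closure_def)

end

subsection \<open>Tiling by translates of the unit box\<close>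

lemma nn_integral_lborel_translate:
  fixes c :: "'a::euclidean_space"
  assumes [measurable]: "f \<in> borel_measurable borel"
  shows "(\<integral>\<^sup>+x. f (x + c) \<partial>lborel) = (\<integral>\<^sup>+x. f x \<partial>lborel)"
proof -
  have "(\<integral>\<^sup>+x. f x \<partial>lborel) = (\<integral>\<^sup>+x. f x \<partial>distr lborel borel ((+) c))"
    by (simp add: lborel_distr_plus)
  also have "\<dots> = (\<integral>\<^sup>+x. f (c + x) \<partial>lborel)" by (subst nn_integral_distr) auto
  finally show ?thesis by (simp add: add.commute)
qed

lemma integral_lborel_translate:
  fixes f :: "'a::euclidean_space \<Rightarrow> 'b::{banach, second_countable_topology}"
  assumes [measurable]: "f \<in> borel_measurable borel"
  shows "(LINT x|lborel. f (x + c)) = (LINT x|lborel. f x)"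
proof -
  have "(LINT x|lborel. f x) = (LINT x|distr lborel borel ((+) c). f x)"
    by (simp add: lborel_distr_plus)
  also have "\<dots> = (LINT x|lborel. f (c + x))" by (subst integral_distr) auto
  finally show ?thesis by (simp add: add.commute)
qed

lemma integrable_lborel_translate:
  fixes f :: "'a::euclidean_space \<Rightarrow> 'b::{banach, second_countable_topology}"
  assumes "integrable lborel f"
  shows "integrable lborel (\<lambda>x. f (x + c))"
proof -
  have "integrable (distr lborel borel ((+) c)) f" using assms by (simp add: lborel_distr_plus)
  from integrable_distr[OF _ this] have "integrable lborel (\<lambda>x. f (c + x))" by simp
  thus ?thesis by (simp add: add.commute)
qed

text \<open>Lebesgue measure on the unit box, kept as a measure on the whole space so that measurability on the
  box is Borel measurability.\<close>

definition torus :: "'a::euclidean_space measure" where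
  "torus = density lborel (\<lambda>x. ennreal (indicator unit_box x))"

lemma sets_torus [measurable_cong, simp]: "sets torus = sets borel"
  by (simp add: torus_def)

lemma space_torus [simp]: "space torus = UNIV"
  by (simp add: torus_def)

lemma nn_integral_torus:
  "f \<in> borel_measurable borel \<Longrightarrow> (\<integral>\<^sup>+x. f x \<partial>torus) = (\<integral>\<^sup>+x. indicator unit_box x * f x \<partial>lborel)"
  unfolding torus_def by (subst nn_integral_density) (auto simp: ennreal_indicator)

lemma integral_torus:
  fixes f :: "'a::euclidean_space \<Rightarrow> 'b::{banach, second_countable_topology}"
  shows "f \<in> borel_measurable borel \<Longrightarrow> (LINT x|torus. f x) = (LINT x|lborel. indicator unit_box x *\<^sub>R f x)"
  unfolding torus_def by (subst integral_density) auto

lemma integrable_torus: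
  fixes f :: "'a::euclidean_space \<Rightarrow> 'b::{banach, second_countable_topology}"
  shows "f \<in> borel_measurable borel \<Longrightarrow> integrable torus f \<longleftrightarrow> integrable lborel (\<lambda>x. indicator unit_box x *\<^sub>R f x)"
  unfolding torus_def by (subst integrable_density) auto

lemma AE_torus: "(AE x in torus. P x) \<longleftrightarrow> (AE x in lborel. x \<in> unit_box \<longrightarrow> P x)"
  unfolding torus_def by (subst AE_density) (auto simp: indicator_def)

lemma AE_torus_box: "AE x in torus. x \<in> unit_box"
  unfolding AE_torus by simp

lemma AE_lborel_torus: "(AE x in lborel. P x) \<Longrightarrow> (AE x in torus. P x)"
  unfolding AE_torus by (auto elim: eventually_mono)

lemma finite_measure_torus: "finite_measure (torus :: 'a::euclidean_space measure)"
proof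
  have "unit_box \<subseteq> cbox 0 (One :: 'a)"
    by (auto simp: unit_box_def cbox_def less_imp_le inner_sum_left inner_Basis)
  hence "emeasure lborel (unit_box :: 'a set) \<le> emeasure lborel (cbox 0 (One :: 'a))"
    by (intro emeasure_mono) auto
  also have "\<dots> < \<infinity>" by (rule emeasure_lborel_cbox_finite)
  finally show "emeasure torus (space (torus :: 'a measure)) \<noteq> \<infinity>"
    unfolding torus_def by (subst emeasure_density) (auto simp: ennreal_indicator)
qed

lemma sigma_finite_torus: "sigma_finite_measure (torus :: 'a::euclidean_space measure)"
  using finite_measure_torus by (rule finite_measure.axioms)

lemma lattice_tile:
  fixes x :: "'a::euclidean_space"
  shows "\<exists>!n. x - lat n \<in> unit_box"
proof -
  define k :: 'a where "k = (\<Sum>b\<in>Basis. (\<lceil>x \<bullet> b\<rceil> - 1) *\<^sub>R b)"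
  have kb: "k \<bullet> b = \<lceil>x \<bullet> b\<rceil> - 1" if "b \<in> Basis" for b
    using that unfolding k_def by (simp add: inner_sum_left_Basis)
  hence "k \<in> lattice" by (auto simp: lattice_def)
  then obtain n where n: "lat n = k" using bij_betw_imp_surj_on[OF bij_lat] by (metis imageE)
  show ?thesis
  proof (rule ex1I[of _ n])
    show "x - lat n \<in> unit_box"
      unfolding unit_box_def n
    proof (intro CollectI ballI)
      fix b :: 'a assume "b \<in> Basis"
      thus "0 < (x - k) \<bullet> b \<and> (x - k) \<bullet> b \<le> 1"
        unfolding inner_diff_left kb[OF \<open>b \<in> Basis\<close>]
        using ceiling_correct[of "x \<bullet> b"] by simp
    qed
    fix m assume m: "x - lat m \<in> unit_box"
    have "lat m \<bullet> b = k \<bullet> b" if b: "b \<in> Basis" for b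
    proof -
      obtain i where i: "(lat m :: 'a) \<bullet> b = of_int i"
        using lat_in_lattice[of m, where 'a = 'a] b by (auto simp: lattice_def elim!: Ints_cases)
      have "0 < x \<bullet> b - of_int i" "x \<bullet> b - of_int i \<le> 1"
        using m b i by (auto simp: unit_box_def inner_diff_left)
      hence "\<lceil>x \<bullet> b\<rceil> = i + 1" by (simp add: ceiling_eq_iff)
      thus ?thesis using kb[OF b] i by simp
    qed
    hence "lat m = k" by (rule euclidean_eqI)
    hence "lat m = (lat n :: 'a)" using n by simp
    thus "m = n" by (rule injD[OF bij_betw_imp_inj_on[OF bij_lat]])
  qed
qed

lemma nn_integral_tile:
  fixes f :: "'a::euclidean_space \<Rightarrow> ennreal"
  assumes [measurable]: "f \<in> borel_measurable borel"
  shows "(\<integral>\<^sup>+x. f x \<partial>lborel) = (\<Sum>n. \<integral>\<^sup>+x. f (x + lat n) \<partial>torus)"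
proof -
  have "f x = (\<Sum>n. indicator unit_box (x - lat n) * f x)" for x
  proof -
    obtain m where m: "\<And>n. x - lat n \<in> unit_box \<longleftrightarrow> n = m"
      using lattice_tile[of x] by blast
    have "(\<lambda>n. indicator unit_box (x - lat n) * f x) = (\<lambda>n. if n = m then f x else 0)"
      using m by (auto simp: indicator_def)
    thus ?thesis by (simp only: sums_unique[OF sums_single[of m "\<lambda>_. f x"], symmetric])
  qed
  hence "(\<integral>\<^sup>+x. f x \<partial>lborel) = (\<integral>\<^sup>+x. (\<Sum>n. indicator unit_box (x - lat n) * f x) \<partial>lborel)"
    by (rule nn_integral_cong)
  also have "\<dots> = (\<Sum>n. \<integral>\<^sup>+x. indicator unit_box (x - lat n) * f x \<partial>lborel)"
    by (rule nn_integral_suminf) measurable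
  also have "\<dots> = (\<Sum>n. \<integral>\<^sup>+x. indicator unit_box x * f (x + lat n) \<partial>lborel)"
  proof (rule suminf_cong)
    fix n
    show "(\<integral>\<^sup>+x. indicator unit_box (x - lat n) * f x \<partial>lborel) = (\<integral>\<^sup>+x. indicator unit_box x * f (x + lat n) \<partial>lborel)"
      by (subst nn_integral_lborel_translate[symmetric, where c = "lat n"]) auto
  qed
  also have "\<dots> = (\<Sum>n. \<integral>\<^sup>+x. f (x + lat n) \<partial>torus)"
    by (intro suminf_cong nn_integral_torus[symmetric]) measurable
  finally show ?thesis .
qed

lemma integral_tile:
  fixes f :: "'a::euclidean_space \<Rightarrow> complex"
  assumes f: "integrable lborel f"
  shows "integrable torus (\<lambda>x. f (x + lat n))"
    and "(\<lambda>n. LINT x|torus. f (x + lat n)) sums (LINT x|lborel. f x)"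
    and "AE x in torus. summable (\<lambda>n. cmod (f (x + lat n)))"
proof -
  have [measurable]: "f \<in> borel_measurable borel" using borel_measurable_integrable[OF f] by simp
  have int: "integrable torus (\<lambda>x. f (x + lat n))" for n
    using integrable_mult_indicator[OF _ integrable_lborel_translate[OF f, of "lat n"], of unit_box]
    by (simp add: integrable_torus)
  thus "integrable torus (\<lambda>x. f (x + lat n))" .
  have "(\<integral>\<^sup>+x. (\<Sum>n. ennreal (cmod (f (x + lat n)))) \<partial>torus) = (\<integral>\<^sup>+x. ennreal (cmod (f x)) \<partial>lborel)"
    by (subst nn_integral_suminf) (auto simp: nn_integral_tile)
  also have fin: "\<dots> < \<infinity>" using f by (simp add: integrable_iff_bounded)
  finally have "AE x in torus. (\<Sum>n. ennreal (cmod (f (x + lat n)))) \<noteq> \<infinity>"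
    by (intro nn_integral_noteq_infinite) auto
  thus "AE x in torus. summable (\<lambda>n. cmod (f (x + lat n)))"
    by eventually_elim (auto intro: summable_suminf_not_top)
  have int': "integrable lborel (\<lambda>x. indicator unit_box (x - lat n) *\<^sub>R f x)" for n
    using f by (intro integrable_mult_indicator[of "{x. x - lat n \<in> unit_box}" lborel f, unfolded indicator_def mem_Collect_eq, folded indicator_def]) auto
  have tr: "(LINT x|lborel. indicator unit_box (x - lat n) *\<^sub>R f x) = (LINT x|torus. f (x + lat n))" for n
    by (subst integral_lborel_translate[symmetric, where c = "lat n"]) (auto simp: integral_torus)
  have trn: "(LINT x|lborel. norm (indicator unit_box (x - lat n) *\<^sub>R f x)) = (LINT x|torus. norm (f (x + lat n)))" for n
    by (subst integral_lborel_translate[symmetric, where c = "lat n"]) (auto simp: integral_torus)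
  have one: "(\<lambda>n. indicator unit_box (x - lat n) *\<^sub>R f x) sums f x \<and>
      summable (\<lambda>n. norm (indicator unit_box (x - lat n) *\<^sub>R f x))" for x
  proof -
    obtain m where m: "\<And>n. x - lat n \<in> unit_box \<longleftrightarrow> n = m"
      using lattice_tile[of x] by blast
    have "(\<lambda>n. indicator unit_box (x - lat n) *\<^sub>R f x) = (\<lambda>n. if n = m then f x else 0)"
      "(\<lambda>n. norm (indicator unit_box (x - lat n) *\<^sub>R f x)) = (\<lambda>n. if n = m then cmod (f x) else 0)"
      using m by (auto simp: indicator_def)
    thus ?thesis using sums_single[of m "\<lambda>_. f x"] sums_single[of m "\<lambda>_. cmod (f x)"]
      by (auto simp: sums_iff)
  qed
  have "(\<lambda>n. LINT x|lborel. indicator unit_box (x - lat n) *\<^sub>R f x) sums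
      (LINT x|lborel. (\<Sum>n. indicator unit_box (x - lat n) *\<^sub>R f x))"
  proof (rule sums_integral[OF int'])
    show "AE x in lborel. summable (\<lambda>n. norm (indicator unit_box (x - lat n) *\<^sub>R f x))"
      using one by simp
    show "summable (\<lambda>n. LINT x|lborel. norm (indicator unit_box (x - lat n) *\<^sub>R f x))"
      unfolding trn
    proof (rule summable_suminf_not_top)
      have "ennreal (LINT x|torus. norm (f (x + lat n))) = (\<integral>\<^sup>+x. ennreal (cmod (f (x + lat n))) \<partial>torus)" for n
        using int[of n] by (intro nn_integral_eq_integral[symmetric]) auto
      thus "(\<Sum>n. ennreal (LINT x|torus. norm (f (x + lat n)))) \<noteq> top"
        using fin by (simp add: nn_integral_tile less_top)
    qed simp
  qed
  moreover have "(\<Sum>n. indicator unit_box (x - lat n) *\<^sub>R f x) = f x" for x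
    using one[of x] by (auto simp: sums_iff)
  ultimately show "(\<lambda>n. LINT x|torus. f (x + lat n)) sums (LINT x|lborel. f x)"
    by (simp add: tr)
qed

subsection \<open>Orthogonality of the characters on the box\<close>

lemma integral_lborel_product:
  fixes f :: "'a::euclidean_space \<Rightarrow> real \<Rightarrow> complex"
  assumes f: "\<And>b. b \<in> Basis \<Longrightarrow> integrable lborel (f b)"
  shows "(LINT x|lborel. (\<Prod>b\<in>Basis. f b (x \<bullet> b))) = (\<Prod>b\<in>Basis. (LINT t|lborel. f b t))"
proof -
  interpret product_sigma_finite "\<lambda>_::'a. lborel :: real measure" by standard
  have [measurable]: "f b \<in> borel_measurable borel" if "b \<in> Basis" for b
    using borel_measurable_integrable[OF f[OF that]] by simp
  have "(LINT x|lborel. (\<Prod>b\<in>Basis. f b (x \<bullet> b))) =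
      (LINT g|(\<Pi>\<^sub>M b\<in>Basis. lborel). (\<Prod>b\<in>Basis. f b ((\<Sum>c\<in>Basis. g c *\<^sub>R c) \<bullet> b)))"
    by (subst lborel_eq, subst integral_distr) auto
  also have "\<dots> = (LINT g|(\<Pi>\<^sub>M b\<in>Basis. lborel). (\<Prod>b\<in>(Basis :: 'a set). f b (g b)))"
    by (intro Bochner_Integration.integral_cong refl prod.cong) (simp add: inner_sum_left_Basis)
  also have "\<dots> = (\<Prod>b\<in>Basis. (LINT t|lborel. f b t))"
    by (rule product_integral_prod) (auto simp: f)
  finally show ?thesis .
qed

lemma integral_cis_unit_interval:
  assumes m: "m \<in> \<int>"
  shows "integrable lborel (\<lambda>t. indicator {0<..1} t *\<^sub>R cis (2 * pi * m * t))"
    and "(LINT t|lborel. indicator {0<..1} t *\<^sub>R cis (2 * pi * m * t)) = (if m = 0 then 1 else 0)"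
proof -
  let ?F = "\<lambda>t. if m = 0 then complex_of_real t else cis (2 * pi * m * t) / (\<i> * complex_of_real (2 * pi * m))"
  have *: "has_bochner_integral lborel (\<lambda>t. indicator {0..1} t *\<^sub>R cis (2 * pi * m * t)) (?F 1 - ?F 0)"
  proof (rule has_bochner_integral_FTC_Icc)
    fix t :: real
    show "(?F has_vector_derivative cis (2 * pi * m * t)) (at t within {0..1})"
    proof (cases "m = 0")
      case True
      thus ?thesis by (auto simp: has_vector_derivative_def scaleR_conv_of_real fun_eq_iff intro!: derivative_eq_intros)
    next
      case False
      define a where "a = \<i> * complex_of_real (2 * pi * m)"
      have "a \<noteq> 0" using False by (simp add: a_def)
      hence "((\<lambda>z. exp (a * z) / a) has_field_derivative exp (a * of_real t)) (at (of_real t))"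
        by (auto intro!: derivative_eq_intros)
      from has_vector_derivative_real_field[OF this]
      have "((\<lambda>t. exp (a * of_real t) / a) has_vector_derivative exp (a * of_real t)) (at t within {0..1})" .
      moreover have "exp (a * of_real t) = cis (2 * pi * m * t)" for t
        by (simp add: cis_conv_exp a_def mult.assoc)
      ultimately show ?thesis using False by (simp add: a_def)
    qed
  qed (auto intro!: continuous_intros)
  have F: "?F 1 - ?F 0 = (if m = 0 then 1 else 0)"
    using m cis_multiple_2pi[of m] by auto
  have ae: "AE t in lborel. indicator {0..1} t *\<^sub>R cis (2 * pi * m * t) = indicator {0<..1} t *\<^sub>R cis (2 * pi * m * t)"
    using AE_lborel_singleton[of 0] by eventually_elim (auto simp: indicator_def)
  have cm: "(\<lambda>t. cis (2 * pi * m * t)) \<in> borel_measurable borel"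
    by (intro borel_measurable_continuous_onI continuous_intros)
  note [measurable] = cm
  show "integrable lborel (\<lambda>t. indicator {0<..1} t *\<^sub>R cis (2 * pi * m * t))"
    using has_bochner_integral_iff[THEN iffD1, OF *] ae
    by (subst integrable_cong_AE[symmetric, OF _ _ ae]) auto
  show "(LINT t|lborel. indicator {0<..1} t *\<^sub>R cis (2 * pi * m * t)) = (if m = 0 then 1 else 0)"
    using has_bochner_integral_iff[THEN iffD1, OF *] F
    by (subst integral_cong_AE[symmetric, OF _ _ ae]) auto
qed

lemma integral_torus_chr:
  assumes k: "k \<in> lattice"
  shows "(LINT x|torus. chr k x) = (if k = 0 then 1 else 0)"
proof -
  have "indicator unit_box x *\<^sub>R chr k x =
      (\<Prod>b\<in>Basis. indicator {0<..1} (x \<bullet> b) *\<^sub>R cis (2 * pi * (k \<bullet> b) * (x \<bullet> b)))" for x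
  proof -
    have "chr k x = (\<Prod>b\<in>Basis. cis (2 * pi * (k \<bullet> b) * (x \<bullet> b)))"
      unfolding chr_def cis_conv_exp
      by (subst exp_sum[symmetric], simp, subst euclidean_inner)
         (simp add: sum_distrib_left algebra_simps)
    moreover have "indicator unit_box x = (\<Prod>b\<in>Basis. indicator {0<..1} (x \<bullet> b) :: real)"
    proof (cases "x \<in> unit_box")
      case True
      hence "(\<Prod>b\<in>Basis. indicator {0<..1} (x \<bullet> b) :: real) = (\<Prod>b\<in>(Basis :: 'a set). 1)"
        by (intro prod.cong) (auto simp: unit_box_def)
      thus ?thesis using True by simp
    next
      case False
      then obtain b where "b \<in> Basis" "\<not> (0 < x \<bullet> b \<and> x \<bullet> b \<le> 1)" by (auto simp: unit_box_def)
      thus ?thesis using False by (auto intro!: prod_zero[symmetric] bexI[of _ b])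
    qed
    ultimately show ?thesis by (simp add: scaleR_conv_of_real prod.distrib)
  qed
  hence "(LINT x|torus. chr k x) =
      (LINT x|lborel. (\<Prod>b\<in>Basis. indicator {0<..1} (x \<bullet> b) *\<^sub>R cis (2 * pi * (k \<bullet> b) * (x \<bullet> b))))"
    by (simp add: integral_torus)
  also have "\<dots> = (\<Prod>b\<in>Basis. (LINT t|lborel. indicator {0<..1} t *\<^sub>R cis (2 * pi * (k \<bullet> b) * t)))"
    using k by (intro integral_lborel_product integral_cis_unit_interval) (auto simp: lattice_def)
  also have "\<dots> = (\<Prod>b\<in>Basis. if k \<bullet> b = 0 then 1 else 0)"
    using k by (intro prod.cong integral_cis_unit_interval) (auto simp: lattice_def)
  also have "\<dots> = (if k = 0 then 1 else 0)"
  proof (cases "k = 0")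
    case False
    then obtain b where "b \<in> Basis" "k \<bullet> b \<noteq> 0" using euclidean_all_zero_iff by blast
    thus ?thesis using False by (auto intro!: prod_zero bexI[of _ b])
  qed simp
  finally show ?thesis .
qed

lemma chr_in_l2_torus: "chr k \<in> l2_space torus"
  by (rule chr_in_l2[OF finite_measure_torus sets_torus AE_torus_box])

lemma chr_orthonormal: "orthonormal_on torus chr lattice"
  unfolding orthonormal_on_def
proof (intro conjI ballI chr_in_l2_torus)
  fix k l :: 'a assume "k \<in> lattice" "l \<in> lattice"
  hence "k - l \<in> lattice" by (rule lattice_diff)
  from integral_torus_chr[OF this] show "l2_inner torus (chr k) (chr l) = (if k = l then 1 else 0)"
    unfolding l2_inner_def cnj_chr chr_add[symmetric] by simp
qed

lemma chr_spanning: "l2_spanning torus chr lattice"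
  by (rule trigonometric_spanning[OF finite_measure_torus sets_torus AE_torus_box])

lemma orthonormal_on_reindex:
  "orthonormal_on M e I \<Longrightarrow> bij_betw h J I \<Longrightarrow> orthonormal_on M (\<lambda>j. e (h j)) J"
  unfolding orthonormal_on_def bij_betw_def by (auto simp: inj_on_eq_iff)

lemma l2_spanning_reindex:
  assumes "l2_spanning M e I" and h: "bij_betw h J I"
  shows "l2_spanning M (\<lambda>j. e (h j)) J"
  unfolding l2_spanning_def
proof (intro ballI allI impI)
  fix u and \<epsilon> :: real assume u: "u \<in> l2_space M" "\<epsilon> > 0"
  obtain F c where F: "finite F" "F \<subseteq> I" "l2_norm M (\<lambda>x. u x - (\<Sum>i\<in>F. c i * e i x)) < \<epsilon>"
    using assms(1)[unfolded l2_spanning_def, rule_format, OF u] by auto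
  let ?g = "inv_into J h"
  have inj: "inj_on ?g F" using F(2) bij_betw_imp_surj_on[OF h] by (auto intro: inj_on_inv_into)
  have hg: "h (?g i) = i" if "i \<in> F" for i using that F(2) bij_betw_imp_surj_on[OF h] by (auto intro: f_inv_into_f)
  have "(\<Sum>j\<in>?g ` F. c (h j) * e (h j) x) = (\<Sum>i\<in>F. c i * e i x)" for x
    by (subst sum.reindex[OF inj]) (auto simp: hg)
  moreover have "?g ` F \<subseteq> J" using F(2) bij_betw_imp_surj_on[OF h] by (auto intro: inv_into_into)
  ultimately show "\<exists>F c. finite F \<and> F \<subseteq> J \<and> l2_norm M (\<lambda>x. u x - (\<Sum>j\<in>F. c j * e (h j) x)) < \<epsilon>"
    using F by (intro exI[of _ "?g ` F"] exI[of _ "\<lambda>j. c (h j)"]) auto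
qed

lemma chr_lat_orthonormal: "orthonormal_on torus (\<lambda>n. chr (lat n :: 'a::euclidean_space)) UNIV"
  by (rule orthonormal_on_reindex[OF chr_orthonormal bij_lat])

lemma chr_lat_spanning: "l2_spanning torus (\<lambda>n. chr (lat n :: 'a::euclidean_space)) UNIV"
  by (rule l2_spanning_reindex[OF chr_spanning bij_lat])

text \<open>Partial sums of an absolutely summable series converge with a uniform bound, so only
  orthonormality is needed to compute the norm of the sum.\<close>

lemma parseval_absolutely_summable:
  fixes c :: "nat \<Rightarrow> complex"
  assumes c: "summable (\<lambda>n. cmod (c n))"
  shows "nn_sq torus (\<lambda>x. \<Sum>n. c n * chr (lat n :: 'a::euclidean_space) x) = (\<Sum>n. ennreal ((cmod (c n))\<^sup>2))"
proof -
  let ?S = "\<lambda>N x. \<Sum>n<N. c n * chr (lat n :: 'a) x"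
  let ?T = "\<lambda>x. \<Sum>n. c n * chr (lat n :: 'a) x"
  have summ: "summable (\<lambda>n. cmod (c n * chr (lat n :: 'a) x))" for x using c by (simp add: norm_mult)
  have lim: "(\<lambda>N. ?S N x) \<longlonglongrightarrow> ?T x" for x
    by (rule summable_LIMSEQ[OF summable_norm_cancel[OF summ]])
  have bd: "cmod (?S N x) \<le> (\<Sum>n. cmod (c n))" for N x
  proof -
    have "cmod (?S N x) \<le> (\<Sum>n<N. cmod (c n))" by (rule norm_sum[THEN order_trans]) (simp add: norm_mult)
    also have "\<dots> \<le> (\<Sum>n. cmod (c n))" by (rule sum_le_suminf[OF c]) auto
    finally show ?thesis .
  qed
  have L: "l2_tendsto torus ?S ?T"
  proof (rule l2_dominated_convergence)
    show "(\<lambda>_. complex_of_real (\<Sum>n. cmod (c n))) \<in> l2_space torus"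
      using l2_space_cmult[OF chr_in_l2_torus[of 0], of "complex_of_real (\<Sum>n. cmod (c n))"] by simp
    have "0 \<le> (\<Sum>n. cmod (c n))" by (rule suminf_nonneg[OF c]) simp
    thus "AE x in torus. cmod (?S N x) \<le> cmod (complex_of_real (\<Sum>n. cmod (c n)))" for N
      using bd by (simp only: norm_of_real abs_of_nonneg) simp
  qed (use lim in auto)
  have "(\<lambda>N. (l2_norm torus (?S N))\<^sup>2) \<longlonglongrightarrow> (l2_norm torus ?T)\<^sup>2"
    by (intro tendsto_power l2_tendsto_norm L)
  moreover have "(l2_norm torus (?S N))\<^sup>2 = (\<Sum>n<N. (cmod (c n))\<^sup>2)" for N
    by (rule orthonormal_norm_sq[OF chr_lat_orthonormal]) auto
  ultimately have "(\<lambda>n. (cmod (c n))\<^sup>2) sums (l2_norm torus ?T)\<^sup>2" by (simp add: sums_def)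
  hence "(\<Sum>n. ennreal ((cmod (c n))\<^sup>2)) = ennreal ((l2_norm torus ?T)\<^sup>2)"
    by (intro suminf_ennreal_eq) auto
  thus ?thesis by (simp add: l2_nn_integral[OF l2_tendstoD(2)[OF L]])
qed

subsection \<open>An orthonormal basis of square-integrable functions on Euclidean space\<close>

lemma l2_torus_translate:
  assumes u: "u \<in> l2_space (lborel :: 'a::euclidean_space measure)"
  shows "(\<lambda>x. u (x + c)) \<in> l2_space torus"
proof (rule l2_spaceI_nn)
  have [measurable]: "u \<in> borel_measurable borel" using l2_measurable[OF u] by simp
  show "(\<lambda>x. u (x + c)) \<in> borel_measurable torus" by measurable
  have "nn_sq torus (\<lambda>x. u (x + c)) \<le> nn_sq lborel (\<lambda>x. u (x + c))"
    by (subst nn_integral_torus) (auto intro!: nn_integral_mono simp: indicator_def)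
  also have "\<dots> = ennreal ((l2_norm lborel u)\<^sup>2)"
    by (subst nn_integral_lborel_translate) (auto simp: l2_nn_integral[OF u])
  also have "\<dots> < \<infinity>" by simp
  finally show "nn_sq torus (\<lambda>x. u (x + c)) < \<infinity>" .
qed

text \<open>The waves on the translates of the unit box; they form an orthonormal basis because the
  translates tile the space and a lattice character is periodic.\<close>

definition box_wave :: "nat \<Rightarrow> nat \<Rightarrow> 'a::euclidean_space \<Rightarrow> complex" where
  "box_wave m n x = indicator unit_box (x - lat m) * chr (lat n) x"

lemma box_wave_measurable [measurable]: "box_wave m n \<in> borel_measurable borel"
  unfolding box_wave_def by measurable

lemma inner_box_wave:
  assumes [measurable]: "u \<in> borel_measurable (borel :: 'a::euclidean_space measure)"
  shows "l2_inner lborel u (box_wave m n) = l2_inner torus (\<lambda>x. u (x + lat m)) (chr (lat n))"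
proof -
  have "l2_inner lborel u (box_wave m n) = (LINT x|lborel. u (x + lat m) * cnj (box_wave m n (x + lat m)))"
    unfolding l2_inner_def by (rule integral_lborel_translate[symmetric]) measurable
  also have "\<dots> = (LINT x|lborel. indicator unit_box x *\<^sub>R (u (x + lat m) * cnj (chr (lat n) x)))"
    by (intro Bochner_Integration.integral_cong)
       (auto simp: box_wave_def chr_add_right chr_lattice indicator_def)
  also have "\<dots> = l2_inner torus (\<lambda>x. u (x + lat m)) (chr (lat n))"
    unfolding l2_inner_def by (rule integral_torus[symmetric]) measurable
  finally show ?thesis .
qed

lemma box_wave_in_l2: "box_wave m n \<in> l2_space (lborel :: 'a::euclidean_space measure)"
proof (rule l2_spaceI_nn)
  have "nn_sq (lborel :: 'a measure) (box_wave m n) =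
     nn_sq (lborel :: 'a measure) (\<lambda>x. box_wave m n (x + lat m))"
    by (subst nn_integral_lborel_translate) auto
  also have "\<dots> = (\<integral>\<^sup>+x. 1 \<partial>(torus :: 'a measure))"
    by (subst nn_integral_torus) (auto simp: box_wave_def indicator_def intro!: nn_integral_cong)
  also have "\<dots> < \<infinity>" using finite_measure.finite_emeasure_space[OF finite_measure_torus] by (simp add: less_top)
  finally show "nn_sq (lborel :: 'a measure) (box_wave m n) < \<infinity>" .
qed simp

lemma box_wave_orthonormal:
  "l2_inner (lborel :: 'a::euclidean_space measure) (box_wave m n) (box_wave p q) = (if m = p \<and> n = q then 1 else 0)"
proof (cases "m = p")
  case False
  have "box_wave m n x * cnj (box_wave p q x) = 0" for x :: 'a
    using lattice_tile[of x] False by (auto simp: box_wave_def indicator_def)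
  hence "l2_inner (lborel :: 'a measure) (box_wave m n) (box_wave p q) = 0"
    unfolding l2_inner_def by (simp only: Bochner_Integration.integral_zero)
  thus ?thesis using False by simp
next
  case True
  have "l2_inner (lborel :: 'a measure) (box_wave m n) (box_wave p q) = l2_inner torus (\<lambda>x. box_wave m n (x + lat p)) (chr (lat q :: 'a))"
    by (rule inner_box_wave) measurable
  also have "\<dots> = l2_inner torus (chr (lat n)) (chr (lat q :: 'a))"
    using True by (intro l2_inner_cong_AE)
      (auto simp: AE_torus box_wave_def chr_add_right chr_lattice)
  also have "\<dots> = (if n = q then 1 else 0)"
    using chr_lat_orthonormal[where 'a = 'a] by (auto simp: orthonormal_on_def)
  finally show ?thesis using True by simp
qed

lemma orthonormal_basis_exists: "orthonormal_basis (\<lambda>j. case prod_decode j of (m, n) \<Rightarrow> box_wave m n)"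
  unfolding orthonormal_basis_def
proof (intro conjI allI ballI impI)
  fix i j
  show "(case prod_decode j of (m, n) \<Rightarrow> box_wave m n) \<in> l2_space lborel"
    by (simp add: box_wave_in_l2 split: prod.split)
  have "i = j \<longleftrightarrow> prod_decode i = prod_decode j" by (metis prod_decode_inverse)
  thus "l2_inner lborel (case prod_decode i of (m, n) \<Rightarrow> box_wave m n) (case prod_decode j of (m, n) \<Rightarrow> box_wave m n)
      = (if i = j then 1 else 0)"
    by (cases "prod_decode i"; cases "prod_decode j") (simp add: box_wave_orthonormal)
next
  fix u assume u: "u \<in> l2_space lborel"
    and 0: "\<forall>j. l2_inner lborel u (case prod_decode j of (m, n) \<Rightarrow> box_wave m n) = 0"
  have [measurable]: "u \<in> borel_measurable borel" using l2_measurable[OF u] by simp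
  have "l2_inner torus (\<lambda>x. u (x + lat m)) (chr (lat n)) = 0" for m n
    using 0[rule_format, of "prod_encode (m, n)"] by (simp add: inner_box_wave)
  hence "nn_sq torus (\<lambda>x. u (x + lat m)) = 0" for m
    using orthonormal_parseval_ennreal[OF chr_lat_orthonormal chr_lat_spanning l2_torus_translate[OF u, of "lat m"]] by simp
  hence "nn_sq lborel u = 0"
    by (subst nn_integral_tile) auto
  thus "AE x in lborel. u x = 0"
    by (subst (asm) nn_integral_0_iff_AE) auto
qed

lemma the_basis: "orthonormal_basis the_basis"
  unfolding the_basis_def by (rule someI[of orthonormal_basis, OF orthonormal_basis_exists])

lemma the_basis_orthonormal: "orthonormal_on lborel the_basis UNIV"
  using the_basis by (auto simp: orthonormal_on_def orthonormal_basis_def)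

lemma the_basis_spanning: "l2_spanning lborel the_basis UNIV"
  using the_basis by (intro orthonormal_total_spanning the_basis_orthonormal) (auto simp: orthonormal_basis_def)

lemma the_basis_in_l2: "the_basis j \<in> l2_space lborel"
  using the_basis by (auto simp: orthonormal_basis_def)

section \<open>The Plancherel theorem on Euclidean space\<close>

lemma measurable_fst_borel [measurable]:
  "fst \<in> borel_measurable (borel :: ('a::topological_space \<times> 'b::topological_space) measure)"
  by (intro borel_measurable_continuous_onI continuous_intros)

lemma measurable_snd_borel [measurable]:
  "snd \<in> borel_measurable (borel :: ('a::topological_space \<times> 'b::topological_space) measure)"
  by (intro borel_measurable_continuous_onI continuous_intros)

lemma nn_integral_lborel_pair:
  fixes f :: "'a::euclidean_space \<times> 'b::euclidean_space \<Rightarrow> ennreal"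
  assumes "f \<in> borel_measurable borel"
  shows "(\<integral>\<^sup>+p. f p \<partial>lborel) = (\<integral>\<^sup>+x. \<integral>\<^sup>+y. f (x, y) \<partial>lborel \<partial>lborel)"
proof -
  have "f \<in> borel_measurable (lborel \<Otimes>\<^sub>M lborel)" using assms by (simp add: lborel_prod)
  from lborel.nn_integral_fst[OF this] show ?thesis by (simp add: lborel_prod)
qed

lemma nn_integral_lborel_swap:
  fixes f :: "'a::euclidean_space \<Rightarrow> 'b::euclidean_space \<Rightarrow> ennreal"
  assumes "case_prod f \<in> borel_measurable borel"
  shows "(\<integral>\<^sup>+x. \<integral>\<^sup>+y. f x y \<partial>lborel \<partial>lborel) = (\<integral>\<^sup>+y. \<integral>\<^sup>+x. f x y \<partial>lborel \<partial>lborel)"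
proof -
  have "case_prod f \<in> borel_measurable (lborel \<Otimes>\<^sub>M lborel)" using assms by (simp add: lborel_prod)
  from lborel_pair.Fubini'[OF this] show ?thesis by simp
qed

lemma AE_lborel_pairI:
  fixes P :: "'a::euclidean_space \<times> 'b::euclidean_space \<Rightarrow> bool"
  assumes "{p. P p} \<in> sets borel" "AE x in lborel. AE y in lborel. P (x, y)"
  shows "AE p in lborel. P p"
  by (rule lborel_pair.AE_pair_measure[of P, unfolded lborel_prod]) (use assms in auto)

lemma integral_tile_suminf:
  fixes f :: "'a::euclidean_space \<Rightarrow> complex"
  assumes f: "integrable lborel f"
  shows "(LINT x|torus. (\<Sum>n. f (x + lat n))) = (LINT x|lborel. f x)"
proof -
  have "integrable lborel (\<lambda>x. complex_of_real (cmod (f x)))" using f by simp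
  from integral_tile(2)[OF this]
  have "summable (\<lambda>n. LINT x|torus. complex_of_real (cmod (f (x + lat n))))" by (rule sums_summable)
  hence s: "summable (\<lambda>n. LINT x|torus. cmod (f (x + lat n)))"
    by (simp add: summable_complex_of_real)
  have "(\<lambda>n. LINT x|torus. f (x + lat n)) sums (LINT x|torus. (\<Sum>n. f (x + lat n)))"
    by (rule sums_integral[OF integral_tile(1)[OF f] integral_tile(3)[OF f] s])
  with integral_tile(2)[OF f] show ?thesis by (simp add: sums_iff)
qed

definition ft :: "('a::euclidean_space \<Rightarrow> complex) \<Rightarrow> 'a \<Rightarrow> complex" where
  "ft f \<xi> = (LINT x|lborel. f x * chr \<xi> x)"

lemma integrable_mult_chr:
  assumes f: "integrable lborel f"
  shows "integrable lborel (\<lambda>x. f x * chr \<xi> x)"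
proof (rule Bochner_Integration.integrable_bound[OF f])
  have [measurable]: "f \<in> borel_measurable borel" using borel_measurable_integrable[OF f] by simp
  show "(\<lambda>x. f x * chr \<xi> x) \<in> borel_measurable lborel" by measurable
qed (simp add: norm_mult)

text \<open>Parseval in \<open>\<xi>\<close> for fixed \<open>x\<close> evaluates the mean square of \<open>P\<close> as that of \<open>f\<close>, because
  \<open>f(x + k)\<close> are its coefficients. For fixed \<open>\<xi>\<close> the coefficients in \<open>x\<close> are the values of the
  transform at \<open>\<xi> + k\<close>, by unfolding the sum over the tiling; so Parseval in \<open>x\<close> evaluates the same mean square as that
  of the transform.\<close>

theorem plancherel_L1_L2:
  fixes f :: "'a::euclidean_space \<Rightarrow> complex"
  assumes f: "integrable lborel f" and f2: "f \<in> l2_space lborel"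
  shows "nn_sq lborel (ft f) = nn_sq lborel f"
proof -
  have [measurable]: "f \<in> borel_measurable borel" using borel_measurable_integrable[OF f] by simp
  have [measurable]: "ft f \<in> borel_measurable borel" unfolding ft_def by measurable
  interpret T: sigma_finite_measure "torus :: 'a measure" by (rule sigma_finite_torus)
  interpret P: pair_sigma_finite "torus :: 'a measure" "torus :: 'a measure" ..
  define P where "P = (\<lambda>\<xi> x. \<Sum>n. f (x + lat n) * chr \<xi> (x + lat n))"
  have [measurable]: "case_prod P \<in> borel_measurable (torus \<Otimes>\<^sub>M torus)"
    unfolding P_def by measurable
  have [measurable]: "P \<xi> \<in> borel_measurable borel" for \<xi>
    unfolding P_def by measurable
  \<comment> \<open>Parseval in \<open>\<xi>\<close>: up to the unimodular factor \<open>e\<^bsup>2\<pi>i\<xi>\<cdot>x\<^esup>\<close>, a series with coefficients \<open>f(x + k)\<close>.\<close>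
  have step1: "nn_sq torus (\<lambda>\<xi>. P \<xi> x) = (\<Sum>n. ennreal ((cmod (f (x + lat n)))\<^sup>2))"
    if s: "summable (\<lambda>n. cmod (f (x + lat n)))" for x
  proof -
    have "cmod (P \<xi> x) = cmod (\<Sum>n. f (x + lat n) * chr (lat n) \<xi>)" for \<xi>
    proof -
      have "summable (\<lambda>n. f (x + lat n) * chr (lat n) \<xi>)"
        using s by (intro summable_norm_cancel[of "\<lambda>n. f (x + lat n) * chr (lat n) \<xi>"]) (simp add: norm_mult)
      from suminf_mult[OF this, of "chr \<xi> x"]
      have "P \<xi> x = chr \<xi> x * (\<Sum>n. f (x + lat n) * chr (lat n) \<xi>)"
        unfolding P_def chr_add_right chr_commute[of \<xi> "lat _"] by (simp add: mult_ac)
      thus ?thesis by (simp add: norm_mult)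
    qed
    thus ?thesis by (simp add: parseval_absolutely_summable[OF s])
  qed
  have "(\<integral>\<^sup>+\<xi>. nn_sq torus (P \<xi>) \<partial>torus) =
      (\<integral>\<^sup>+x. nn_sq torus (\<lambda>\<xi>. P \<xi> x) \<partial>torus)"
    by (rule P.Fubini'[symmetric]) measurable
  also have "\<dots> = (\<integral>\<^sup>+x. (\<Sum>n. ennreal ((cmod (f (x + lat n)))\<^sup>2)) \<partial>torus)"
    using integral_tile(3)[OF f] by (intro nn_integral_cong_AE) (auto elim!: eventually_mono simp: step1)
  also have "\<dots> = (\<Sum>n. nn_sq torus (\<lambda>x. f (x + lat n)))"
    by (rule nn_integral_suminf) measurable
  also have "\<dots> = nn_sq lborel f"
    by (rule nn_integral_tile[symmetric]) measurable
  finally have step2: "(\<integral>\<^sup>+\<xi>. nn_sq torus (P \<xi>) \<partial>torus) =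
      nn_sq lborel f" .
  have "AE \<xi> in torus. nn_sq torus (P \<xi>) \<noteq> \<infinity>"
  proof (rule nn_integral_noteq_infinite)
    show "(\<lambda>\<xi>. nn_sq torus (P \<xi>)) \<in> borel_measurable torus" by measurable
    show "(\<integral>\<^sup>+\<xi>. nn_sq torus (P \<xi>) \<partial>torus) \<noteq> \<infinity>"
      unfolding step2 l2_nn_integral[OF f2] by simp
  qed
  hence PL: "AE \<xi> in torus. P \<xi> \<in> l2_space torus"
    by eventually_elim (auto intro!: l2_spaceI_nn simp: less_top)
  \<comment> \<open>Coefficients in \<open>x\<close>: the characters are 1 on the lattice, so the sum over the tiling unfolds.\<close>
  have step3: "(LINT x|torus. P \<xi> x * chr (lat m) x) = ft f (\<xi> + lat m)" for \<xi> m
  proof -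
    have "P \<xi> x * chr (lat m) x = (\<Sum>n. f (x + lat n) * chr (\<xi> + lat m) (x + lat n))"
      if s: "summable (\<lambda>n. cmod (f (x + lat n)))" for x
    proof -
      have "summable (\<lambda>n. f (x + lat n) * chr \<xi> (x + lat n))"
        using s by (intro summable_norm_cancel[of "\<lambda>n. f (x + lat n) * chr \<xi> (x + lat n)"]) (simp add: norm_mult)
      from suminf_mult2[OF this, of "chr (lat m) x"] show ?thesis
        unfolding P_def by (simp add: chr_add chr_add_right chr_lattice mult_ac)
    qed
    hence "(LINT x|torus. P \<xi> x * chr (lat m) x) = (LINT x|torus. (\<Sum>n. f (x + lat n) * chr (\<xi> + lat m) (x + lat n)))"
      using integral_tile(3)[OF f] by (intro integral_cong_AE) (measurable, auto elim!: eventually_mono)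
    also have "\<dots> = ft f (\<xi> + lat m)"
      unfolding ft_def by (rule integral_tile_suminf[OF integrable_mult_chr[OF f]])
    finally show ?thesis .
  qed
  \<comment> \<open>Parseval in \<open>x\<close>, applied to the conjugate since the transform has the sign \<open>+2\<pi>i\<close>.\<close>
  have step4: "(\<Sum>m. ennreal ((cmod (ft f (\<xi> + lat m)))\<^sup>2)) = nn_sq torus (P \<xi>)"
    if "P \<xi> \<in> l2_space torus" for \<xi>
  proof -
    have "l2_inner torus (\<lambda>x. cnj (P \<xi> x)) (chr (lat m)) = cnj (ft f (\<xi> + lat m))" for m
      unfolding l2_inner_def step3[symmetric]
      by (subst Bochner_Integration.integral_cnj[symmetric]) simp
    with orthonormal_parseval_ennreal[OF chr_lat_orthonormal chr_lat_spanning l2_space_cnj[OF that]]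
    show ?thesis by simp
  qed
  have "nn_sq lborel (ft f) = (\<Sum>m. nn_sq torus (\<lambda>\<xi>. ft f (\<xi> + lat m)))"
    by (rule nn_integral_tile) measurable
  also have "\<dots> = (\<integral>\<^sup>+\<xi>. (\<Sum>m. ennreal ((cmod (ft f (\<xi> + lat m)))\<^sup>2)) \<partial>torus)"
    by (rule nn_integral_suminf[symmetric]) measurable
  also have "\<dots> = (\<integral>\<^sup>+\<xi>. nn_sq torus (P \<xi>) \<partial>torus)"
    using PL by (intro nn_integral_cong_AE) (auto elim!: eventually_mono simp: step4)
  finally show ?thesis unfolding step2 .
qed

subsection \<open>Transform in the second variable\<close>

definition part_ft :: "('a::euclidean_space \<times> 'b::euclidean_space \<Rightarrow> complex) \<Rightarrow> 'a \<times> 'b \<Rightarrow> complex" where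
  "part_ft f p = ft (\<lambda>z. f (fst p, z)) (snd p)"

lemma part_ft_measurable [measurable]:
  assumes [measurable]: "f \<in> borel_measurable borel"
  shows "part_ft f \<in> borel_measurable borel"
  unfolding part_ft_def ft_def by measurable

lemma AE_l2_slice:
  fixes f :: "'a::euclidean_space \<times> 'b::euclidean_space \<Rightarrow> complex"
  assumes f: "f \<in> l2_space lborel"
  shows "AE y in lborel. (\<lambda>z. f (y, z)) \<in> l2_space lborel"
proof -
  have [measurable]: "f \<in> borel_measurable borel" using l2_measurable[OF f] by simp
  have "(\<integral>\<^sup>+y. nn_sq lborel (\<lambda>z. f (y, z)) \<partial>lborel) = nn_sq lborel f"
    by (rule nn_integral_lborel_pair[symmetric]) measurable
  hence "AE y in lborel. nn_sq lborel (\<lambda>z. f (y, z)) \<noteq> \<infinity>"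
    by (intro nn_integral_noteq_infinite) (auto simp: l2_nn_integral[OF f])
  thus ?thesis by eventually_elim (auto intro!: l2_spaceI_nn simp: less_top)
qed

lemma AE_integrable_slice:
  fixes f :: "'a::euclidean_space \<times> 'b::euclidean_space \<Rightarrow> complex"
  assumes f: "integrable lborel f"
  shows "AE y in lborel. integrable lborel (\<lambda>z. f (y, z))"
  using lborel_pair.AE_integrable_fst'[of f] f by (simp add: lborel_prod)

lemma part_ft_plancherel:
  fixes f :: "'a::euclidean_space \<times> 'b::euclidean_space \<Rightarrow> complex"
  assumes f: "integrable lborel f" and f2: "f \<in> l2_space lborel"
  shows "part_ft f \<in> l2_space lborel" and "l2_norm lborel (part_ft f) = l2_norm lborel f"
proof -
  have [measurable]: "f \<in> borel_measurable borel" using borel_measurable_integrable[OF f] by simp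
  have "nn_sq lborel (part_ft f) =
      (\<integral>\<^sup>+y. nn_sq lborel (\<lambda>\<zeta>. ft (\<lambda>z. f (y, z)) \<zeta>) \<partial>lborel)"
    by (subst nn_integral_lborel_pair, measurable) (simp add: part_ft_def)
  also have "\<dots> = (\<integral>\<^sup>+y. nn_sq lborel (\<lambda>z. f (y, z)) \<partial>lborel)"
    by (intro nn_integral_cong_AE, use AE_integrable_slice[OF f] AE_l2_slice[OF f2] in eventually_elim)
       (rule plancherel_L1_L2)
  also have "\<dots> = nn_sq lborel f"
    by (rule nn_integral_lborel_pair[symmetric]) measurable
  finally have eq: "nn_sq lborel (part_ft f) = ennreal ((l2_norm lborel f)\<^sup>2)"
    by (simp add: l2_nn_integral[OF f2])
  show L: "part_ft f \<in> l2_space lborel" by (rule l2_spaceI_nn) (auto simp: eq)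
  have "(l2_norm lborel (part_ft f))\<^sup>2 = (l2_norm lborel f)\<^sup>2"
    using eq by (simp add: l2_nn_integral[OF L])
  thus "l2_norm lborel (part_ft f) = l2_norm lborel f" by simp
qed

lemma AE_part_ft_lincomb:
  fixes f g :: "'a::euclidean_space \<times> 'b::euclidean_space \<Rightarrow> complex"
  assumes f: "integrable lborel f" and g: "integrable lborel g"
  shows "AE p in lborel. part_ft (\<lambda>p. f p + c * g p) p = part_ft f p + c * part_ft g p"
proof (rule AE_lborel_pairI)
  have [measurable]: "f \<in> borel_measurable borel" "g \<in> borel_measurable borel"
    using borel_measurable_integrable[OF f] borel_measurable_integrable[OF g] by simp_all
  show "{p. part_ft (\<lambda>p. f p + c * g p) p = part_ft f p + c * part_ft g p} \<in> sets borel" by measurable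
  show "AE y in lborel. AE \<zeta> in lborel. part_ft (\<lambda>p. f p + c * g p) (y, \<zeta>) = part_ft f (y, \<zeta>) + c * part_ft g (y, \<zeta>)"
    using AE_integrable_slice[OF f] AE_integrable_slice[OF g]
  proof eventually_elim
    case (elim y)
    have "part_ft (\<lambda>p. f p + c * g p) (y, \<zeta>) = part_ft f (y, \<zeta>) + c * part_ft g (y, \<zeta>)" for \<zeta>
      unfolding part_ft_def ft_def fst_conv snd_conv
      using integrable_mult_chr[OF elim(1), of \<zeta>] integrable_mult_chr[OF elim(2), of \<zeta>]
      by (simp add: ring_distribs mult.assoc)
    thus ?case by simp
  qed
qed

lemma part_ft_lincomb_norm:
  fixes f g :: "'a::euclidean_space \<times> 'b::euclidean_space \<Rightarrow> complex"
  assumes f: "integrable lborel f" "f \<in> l2_space lborel" and g: "integrable lborel g" "g \<in> l2_space lborel"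
  shows "l2_norm lborel (\<lambda>p. part_ft f p + c * part_ft g p) = l2_norm lborel (\<lambda>p. f p + c * g p)"
proof -
  have [measurable]: "f \<in> borel_measurable borel" "g \<in> borel_measurable borel"
    using l2_measurable[OF f(2)] l2_measurable[OF g(2)] by simp_all
  have "l2_norm lborel (\<lambda>p. part_ft f p + c * part_ft g p) = l2_norm lborel (part_ft (\<lambda>p. f p + c * g p))"
    using AE_part_ft_lincomb[OF f(1) g(1), of c] by (intro l2_norm_cong_AE) (auto elim: eventually_mono)
  also have "\<dots> = l2_norm lborel (\<lambda>p. f p + c * g p)"
    using f g by (intro part_ft_plancherel l2_space_add l2_space_cmult) auto
  finally show ?thesis .
qed

text \<open>The norms of \<open>f + g\<close> and \<open>f + i g\<close> determine the real and the imaginary part of the inner product.\<close>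

lemma l2_inner_eq_by_polarization:
  assumes L: "f \<in> l2_space M" "g \<in> l2_space M" "F \<in> l2_space N" "H \<in> l2_space N"
    and norm: "l2_norm M f = l2_norm N F" "l2_norm M g = l2_norm N H"
      "\<And>c. l2_norm M (\<lambda>x. f x + c * g x) = l2_norm N (\<lambda>x. F x + c * H x)"
  shows "l2_inner M f g = l2_inner N F H"
proof -
  have "2 * Re (cnj c * l2_inner M f g) = 2 * Re (cnj c * l2_inner N F H)" for c
    using l2_norm_add_sq[OF L(1) l2_space_cmult[OF L(2), of c]]
      l2_norm_add_sq[OF L(3) l2_space_cmult[OF L(4), of c]] norm
    by (simp add: l2_norm_cmult)
  from this[of 1] this[of \<i>] show ?thesis by (simp add: complex_eq_iff)
qed

lemma part_ft_inner:
  assumes f: "integrable lborel f" "f \<in> l2_space lborel" and g: "integrable lborel g" "g \<in> l2_space lborel"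
  shows "l2_inner lborel f g = l2_inner lborel (part_ft f) (part_ft g)"
  using part_ft_plancherel[OF f] part_ft_plancherel[OF g] part_ft_lincomb_norm[OF f g] assms
  by (intro l2_inner_eq_by_polarization) auto

definition L12_approx :: "(nat \<Rightarrow> 'a::euclidean_space \<Rightarrow> complex) \<Rightarrow> ('a \<Rightarrow> complex) \<Rightarrow> bool" where
  "L12_approx g f \<longleftrightarrow> (\<forall>k. integrable lborel (g k)) \<and> l2_tendsto lborel g f"

lemma L12_approx_exists:
  assumes f: "f \<in> l2_space (lborel :: 'a::euclidean_space measure)"
  obtains g where "L12_approx g f"
proof -
  have [measurable]: "f \<in> borel_measurable borel" using l2_measurable[OF f] by simp
  define g where "g = (\<lambda>k x. indicator (cball 0 (real k)) x * f x)"
  have "integrable lborel (g k)" for k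
    unfolding g_def
  proof (rule l2_integrable_mult[OF _ f])
    have "integrable (lborel :: 'a measure) (\<lambda>x. (cmod (indicator (cball 0 (real k)) x))\<^sup>2)"
      by (rule Bochner_Integration.integrable_cong[THEN iffD1, OF refl _ integrable_real_indicator[of "cball 0 (real k)"]])
         (use emeasure_lborel_cball_finite[of "0 :: 'a" "real k"] in \<open>auto simp: indicator_def\<close>)
    thus "indicator (cball 0 (real k)) \<in> l2_space (lborel :: 'a measure)"
      by (auto simp: l2_space_def intro!: borel_measurable_indicator)
  qed
  moreover have "l2_tendsto lborel g f"
  proof (rule l2_dominated_convergence[OF _ _ _ f])
    show "AE x in lborel. (\<lambda>k. g k x) \<longlonglongrightarrow> f x"
    proof (intro AE_I2 tendsto_eventually)
      fix x :: 'a
      obtain N where "norm x \<le> real N" using real_arch_simple by blast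
      hence "\<forall>n\<ge>N. g n x = f x" by (auto simp: g_def)
      thus "\<forall>\<^sub>F n in sequentially. g n x = f x" by (auto simp: eventually_sequentially)
    qed
  qed (auto simp: g_def indicator_def)
  ultimately have "L12_approx g f" by (simp add: L12_approx_def)
  thus thesis by (rule that)
qed

text \<open>The extension of the partial transform to square-integrable functions, as a relation since the
  transform is determined only almost everywhere. Quantifying over all approximations makes independence of the
  approximation part of the definition; existence then has to show it.\<close>

definition is_part_ft :: "('a::euclidean_space \<times> 'b::euclidean_space \<Rightarrow> complex) \<Rightarrow> ('a \<times> 'b \<Rightarrow> complex) \<Rightarrow> bool" where
  "is_part_ft f \<Phi> \<longleftrightarrow> f \<in> l2_space lborel \<and> (\<forall>g. L12_approx g f \<longrightarrow> l2_tendsto lborel (\<lambda>k. part_ft (g k)) \<Phi>)"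

lemma is_part_ft_exists:
  fixes f :: "'a::euclidean_space \<times> 'b::euclidean_space \<Rightarrow> complex"
  assumes f: "f \<in> l2_space lborel"
  obtains \<Phi> where "is_part_ft f \<Phi>"
proof -
  obtain h where h: "L12_approx h f" using L12_approx_exists[OF f] .
  have dist: "l2_norm lborel (\<lambda>p. part_ft a p - part_ft b p) = l2_norm lborel (\<lambda>p. a p - b p)"
    if "integrable lborel a" "a \<in> l2_space lborel" "integrable lborel b" "b \<in> l2_space lborel"
    for a b :: "'a \<times> 'b \<Rightarrow> complex"
    using part_ft_lincomb_norm[OF that, of "-1"] by simp
  note hD = h[unfolded L12_approx_def, THEN conjunct1, rule_format] and hT = h[unfolded L12_approx_def, THEN conjunct2]
  obtain \<Phi> where \<Phi>: "l2_tendsto lborel (\<lambda>k. part_ft (h k)) \<Phi>"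
  proof (rule l2_complete)
    show "part_ft (h k) \<in> l2_space lborel" for k by (rule part_ft_plancherel[OF hD l2_tendstoD(1)[OF hT]])
    fix \<epsilon> :: real assume "\<epsilon> > 0"
    from l2_tendsto_Cauchy[OF hT this]
    show "\<exists>N. \<forall>m\<ge>N. \<forall>n\<ge>N. l2_norm lborel (\<lambda>x. part_ft (h m) x - part_ft (h n) x) < \<epsilon>"
      by (simp add: dist[OF hD l2_tendstoD(1)[OF hT] hD l2_tendstoD(1)[OF hT]])
  qed
  have "l2_tendsto lborel (\<lambda>k. part_ft (g k)) \<Phi>" if g: "L12_approx g f" for g
  proof -
    note gD = g[unfolded L12_approx_def, THEN conjunct1, rule_format] and gT = g[unfolded L12_approx_def, THEN conjunct2]
    have gL: "part_ft (g k) \<in> l2_space lborel" for k by (rule part_ft_plancherel[OF gD l2_tendstoD(1)[OF gT]])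
    have "(\<lambda>k. l2_norm lborel (\<lambda>p. part_ft (g k) p - \<Phi> p)) \<longlonglongrightarrow> 0"
    proof (rule Lim_null_comparison)
      show "(\<lambda>k. (l2_norm lborel (\<lambda>p. g k p - f p) + l2_norm lborel (\<lambda>p. h k p - f p)) +
          l2_norm lborel (\<lambda>p. part_ft (h k) p - \<Phi> p)) \<longlonglongrightarrow> 0"
        using tendsto_add[OF tendsto_add[OF l2_tendstoD(3)[OF gT] l2_tendstoD(3)[OF hT]] l2_tendstoD(3)[OF \<Phi>]] by simp
      have "l2_norm lborel (\<lambda>p. part_ft (g k) p - \<Phi> p) \<le> (l2_norm lborel (\<lambda>p. g k p - f p) + l2_norm lborel (\<lambda>p. h k p - f p)) +
          l2_norm lborel (\<lambda>p. part_ft (h k) p - \<Phi> p)" for k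
      proof -
        have "l2_norm lborel (\<lambda>p. part_ft (g k) p - \<Phi> p) \<le> l2_norm lborel (\<lambda>p. part_ft (g k) p - part_ft (h k) p) +
            l2_norm lborel (\<lambda>p. part_ft (h k) p - \<Phi> p)"
          by (intro l2_norm_diff_triangle gL l2_tendstoD[OF \<Phi>])
        moreover have "l2_norm lborel (\<lambda>p. part_ft (g k) p - part_ft (h k) p) = l2_norm lborel (\<lambda>p. g k p - h k p)"
          by (intro dist gD hD l2_tendstoD[OF gT] l2_tendstoD[OF hT])
        moreover have "l2_norm lborel (\<lambda>p. g k p - h k p) \<le> l2_norm lborel (\<lambda>p. g k p - f p) + l2_norm lborel (\<lambda>p. f p - h k p)"
          by (intro l2_norm_diff_triangle f l2_tendstoD[OF gT] l2_tendstoD[OF hT])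
        ultimately show ?thesis by (simp add: l2_norm_minus_commute[of lborel f])
      qed
      thus "\<forall>\<^sub>F k in sequentially. norm (l2_norm lborel (\<lambda>p. part_ft (g k) p - \<Phi> p)) \<le>
          (l2_norm lborel (\<lambda>p. g k p - f p) + l2_norm lborel (\<lambda>p. h k p - f p)) + l2_norm lborel (\<lambda>p. part_ft (h k) p - \<Phi> p)"
        by simp
    qed
    thus ?thesis using gL l2_tendstoD(2)[OF \<Phi>] by (simp add: l2_tendsto_def)
  qed
  with f have "is_part_ft f \<Phi>" by (simp add: is_part_ft_def)
  thus thesis by (rule that)
qed

lemma is_part_ft_in_l2: "is_part_ft f \<Phi> \<Longrightarrow> \<Phi> \<in> l2_space lborel"
  using L12_approx_exists[of f] l2_tendstoD(2) unfolding is_part_ft_def by blast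

lemma is_part_ft_inner:
  assumes "is_part_ft f \<Phi>" "is_part_ft g \<Psi>"
  shows "l2_inner lborel f g = l2_inner lborel \<Phi> \<Psi>"
proof -
  obtain a where a: "L12_approx a f" using L12_approx_exists assms(1) unfolding is_part_ft_def by blast
  obtain b where b: "L12_approx b g" using L12_approx_exists assms(2) unfolding is_part_ft_def by blast
  note A = a[unfolded L12_approx_def] and B = b[unfolded L12_approx_def]
  have "(\<lambda>k. l2_inner lborel (a k) (b k)) \<longlonglongrightarrow> l2_inner lborel f g"
    using A B by (intro l2_tendsto_inner) auto
  moreover have "(\<lambda>k. l2_inner lborel (part_ft (a k)) (part_ft (b k))) \<longlonglongrightarrow> l2_inner lborel \<Phi> \<Psi>"
    using assms a b by (intro l2_tendsto_inner) (auto simp: is_part_ft_def)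
  moreover have "l2_inner lborel (a k) (b k) = l2_inner lborel (part_ft (a k)) (part_ft (b k))" for k
    using A B by (intro part_ft_inner) (auto intro: l2_tendstoD)
  ultimately show ?thesis using LIMSEQ_unique by simp
qed

lemma l2_norm_lborel_translate:
  fixes f :: "'a::euclidean_space \<Rightarrow> complex"
  assumes [measurable]: "f \<in> borel_measurable borel"
  shows "l2_norm lborel (\<lambda>x. f (x + c)) = l2_norm lborel f"
  unfolding l2_norm_def by (subst integral_lborel_translate[symmetric, where c = c]) auto

lemma l2_space_translate:
  fixes f :: "'a::euclidean_space \<Rightarrow> complex"
  assumes f: "f \<in> l2_space lborel"
  shows "(\<lambda>x. f (x + c)) \<in> l2_space lborel"
proof -
  have [measurable]: "f \<in> borel_measurable borel" using l2_measurable[OF f] by simp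
  show ?thesis using integrable_lborel_translate[OF l2_integrable_sq[OF f], of c] by (simp add: l2_space_def)
qed

text \<open>Translation in the transformed variable becomes modulation. Applied to the central variable, this
  produces the factors \<open>e\<^bsup>2\<pi>im\<lambda>\<^esup>\<close>.\<close>

lemma part_ft_translate:
  fixes f :: "'a::euclidean_space \<times> 'b::euclidean_space \<Rightarrow> complex"
  assumes [measurable]: "f \<in> borel_measurable borel"
  shows "part_ft (\<lambda>p. f (p + (0, - v))) p = chr (snd p) v * part_ft f p"
proof -
  have "(LINT z|lborel. f (fst p, z - v) * chr (snd p) z) =
      (LINT z|lborel. f (fst p, z + v - v) * chr (snd p) (z + v))"
    by (rule integral_lborel_translate[symmetric]) measurable
  also have "\<dots> = (LINT z|lborel. chr (snd p) v * (f (fst p, z) * chr (snd p) z))"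
    by (simp add: chr_add_right mult_ac)
  also have "\<dots> = chr (snd p) v * (LINT z|lborel. f (fst p, z) * chr (snd p) z)"
    by (rule integral_mult_right_zero)
  finally show ?thesis by (cases p) (simp add: part_ft_def ft_def)
qed

lemma is_part_ft_translate:
  fixes f :: "'a::euclidean_space \<times> 'b::euclidean_space \<Rightarrow> complex"
  assumes f: "is_part_ft f \<Phi>"
  obtains \<Phi>' where "is_part_ft (\<lambda>p. f (p + (0, - v))) \<Phi>'" "AE p in lborel. \<Phi>' p = chr (snd p) v * \<Phi> p"
proof -
  have fL: "f \<in> l2_space lborel" using f by (simp add: is_part_ft_def)
  have [measurable]: "f \<in> borel_measurable borel" using l2_measurable[OF fL] by simp
  obtain \<Phi>' where \<Phi>': "is_part_ft (\<lambda>p. f (p + (0, - v))) \<Phi>'"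
    using is_part_ft_exists[OF l2_space_translate[OF fL]] .
  obtain a where a: "L12_approx a f" using L12_approx_exists[OF fL] .
  note A = a[unfolded L12_approx_def, THEN conjunct1, rule_format] and T = a[unfolded L12_approx_def, THEN conjunct2]
  have aL: "a k \<in> l2_space lborel" for k by (rule l2_tendstoD(1)[OF T])
  have [measurable]: "a k \<in> borel_measurable borel" for k using l2_measurable[OF aL[of k]] by simp
  have "L12_approx (\<lambda>k p. a k (p + (0, - v))) (\<lambda>p. f (p + (0, - v)))"
    unfolding L12_approx_def l2_tendsto_def
  proof (intro conjI allI l2_space_translate integrable_lborel_translate aL A fL)
    have "l2_norm lborel (\<lambda>x. a n (x + (0, - v)) - f (x + (0, - v))) = l2_norm lborel (\<lambda>x. a n x - f x)" for n
      by (rule l2_norm_lborel_translate) measurable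
    thus "(\<lambda>n. l2_norm lborel (\<lambda>x. a n (x + (0, - v)) - f (x + (0, - v)))) \<longlonglongrightarrow> 0"
      using l2_tendstoD(3)[OF T] by simp
  qed
  hence "l2_tendsto lborel (\<lambda>k. part_ft (\<lambda>p. a k (p + (0, - v)))) \<Phi>'"
    using \<Phi>' by (simp add: is_part_ft_def)
  moreover have "part_ft (\<lambda>p. a k (p + (0, - v))) = (\<lambda>p. chr (snd p) v * part_ft (a k) p)" for k
    by (rule ext, rule part_ft_translate) measurable
  ultimately have 1: "l2_tendsto lborel (\<lambda>k p. chr (snd p) v * part_ft (a k) p) \<Phi>'" by simp
  have 2: "l2_tendsto lborel (\<lambda>k p. chr (snd p) v * part_ft (a k) p) (\<lambda>p. chr (snd p) v * \<Phi> p)"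
    using f a by (intro l2_tendsto_bounded_mult[where B = 1]) (auto simp: is_part_ft_def)
  from that[OF \<Phi>' l2_tendsto_unique[OF 1 2]] show thesis .
qed

section \<open>Integral operators\<close>

definition kernel_op :: "((real^'n::finite) \<times> (real^'n) \<Rightarrow> complex) \<Rightarrow> 'n op" where
  "kernel_op K u \<xi> = (LINT \<eta>|lborel. K (\<xi>, \<eta>) * u \<eta>)"

lemma kernel_op_measurable:
  assumes "K \<in> borel_measurable borel" "u \<in> borel_measurable borel"
  shows "kernel_op K u \<in> borel_measurable borel"
proof -
  note [measurable] = assms
  show ?thesis unfolding kernel_op_def by measurable
qed

lemma kernel_op_eq_inner: "kernel_op K u \<xi> = cnj (l2_inner lborel (\<lambda>\<eta>. cnj (K (\<xi>, \<eta>))) u)"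
  unfolding kernel_op_def l2_inner_def
  by (subst Bochner_Integration.integral_cnj[symmetric]) simp

context
  fixes K :: "(real^'n::finite) \<times> (real^'n) \<Rightarrow> complex"
  assumes K: "K \<in> l2_space lborel"
begin

lemma kernel_measurable: "K \<in> borel_measurable borel"
  using l2_measurable[OF K] by simp

lemma kernel_op_l2:
  assumes u: "u \<in> l2_space lborel"
  shows "kernel_op K u \<in> l2_space lborel" and "l2_norm lborel (kernel_op K u) \<le> l2_norm lborel K * l2_norm lborel u"
proof -
  have [measurable]: "u \<in> borel_measurable borel" using l2_measurable[OF u] by simp
  note [measurable] = kernel_measurable kernel_op_measurable[OF kernel_measurable this]
  have "nn_sq lborel (kernel_op K u) \<le>
      (\<integral>\<^sup>+\<xi>. nn_sq lborel (\<lambda>\<eta>. K (\<xi>, \<eta>)) * ennreal ((l2_norm lborel u)\<^sup>2) \<partial>lborel)"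
  proof (intro nn_integral_mono_AE, use AE_l2_slice[OF K] in eventually_elim)
    case (elim \<xi>)
    have "cmod (kernel_op K u \<xi>) \<le> l2_norm lborel (\<lambda>\<eta>. K (\<xi>, \<eta>)) * l2_norm lborel u"
      using l2_cauchy_schwarz[OF l2_space_cnj[OF elim] u]
      by (simp add: kernel_op_eq_inner l2_norm_def)
    hence "(cmod (kernel_op K u \<xi>))\<^sup>2 \<le> (l2_norm lborel (\<lambda>\<eta>. K (\<xi>, \<eta>)))\<^sup>2 * (l2_norm lborel u)\<^sup>2"
      unfolding power_mult_distrib[symmetric] by (intro power_mono) auto
    thus ?case by (simp add: l2_nn_integral[OF elim] ennreal_mult[symmetric] ennreal_leI)
  qed
  also have "\<dots> = (\<integral>\<^sup>+\<xi>. nn_sq lborel (\<lambda>\<eta>. K (\<xi>, \<eta>)) \<partial>lborel) * ennreal ((l2_norm lborel u)\<^sup>2)"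
    by (rule nn_integral_multc) measurable
  also have "(\<integral>\<^sup>+\<xi>. nn_sq lborel (\<lambda>\<eta>. K (\<xi>, \<eta>)) \<partial>lborel) = ennreal ((l2_norm lborel K)\<^sup>2)"
    using l2_nn_integral[OF K] by (subst (asm) nn_integral_lborel_pair) auto
  finally have le: "nn_sq lborel (kernel_op K u) \<le> ennreal ((l2_norm lborel K * l2_norm lborel u)\<^sup>2)"
    by (simp add: ennreal_mult[symmetric] power_mult_distrib)
  show L: "kernel_op K u \<in> l2_space lborel"
    by (rule l2_spaceI_nn[OF _ order.strict_trans1[OF le]]) auto
  have "(l2_norm lborel (kernel_op K u))\<^sup>2 \<le> (l2_norm lborel K * l2_norm lborel u)\<^sup>2"
    using le unfolding l2_nn_integral[OF L] by (subst (asm) ennreal_le_iff) auto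
  thus "l2_norm lborel (kernel_op K u) \<le> l2_norm lborel K * l2_norm lborel u" by (rule power2_le_imp_le) simp
qed

lemma kernel_op_bounded_op: "bounded_op (kernel_op K)"
  unfolding bounded_op_def
proof (intro conjI ballI allI exI)
  fix u v :: "real^'n \<Rightarrow> complex" and a b assume u: "u \<in> l2_space lborel" and v: "v \<in> l2_space lborel"
  show "AE \<xi> in lborel. kernel_op K (\<lambda>\<eta>. a * u \<eta> + b * v \<eta>) \<xi> = a * kernel_op K u \<xi> + b * kernel_op K v \<xi>"
    using AE_l2_slice[OF K]
  proof eventually_elim
    case (elim \<xi>)
    have "K (\<xi>, \<eta>) * (a * u \<eta> + b * v \<eta>) = a * (K (\<xi>, \<eta>) * u \<eta>) + b * (K (\<xi>, \<eta>) * v \<eta>)" for \<eta>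
      by (simp add: algebra_simps)
    thus ?case unfolding kernel_op_def
      using l2_integrable_mult[OF elim u] l2_integrable_mult[OF elim v] by simp
  qed
qed (use kernel_op_l2 in auto)

text \<open>Applied to the basis vectors, the operator yields for each \<open>\<xi>\<close> the coefficients of the row
  \<open>K(\<xi>,\<cdot>)\<close> up to conjugation; Parseval sums them to the norm of the row.\<close>

lemma hs_norm_sq_kernel_op: "hs_norm_sq (kernel_op K) = nn_sq lborel K"
proof -
  note [measurable] = kernel_measurable
  have [measurable]: "the_basis j \<in> borel_measurable borel" for j :: nat
    using l2_measurable[OF the_basis_in_l2] by simp
  have [measurable]: "kernel_op K (the_basis j) \<in> borel_measurable borel" for j
    by (rule kernel_op_measurable) measurable
  have "hs_norm_sq (kernel_op K) = (\<integral>\<^sup>+\<xi>. (\<Sum>j. ennreal ((cmod (kernel_op K (the_basis j) \<xi>))\<^sup>2)) \<partial>lborel)"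
    unfolding hs_norm_sq_def by (rule nn_integral_suminf[symmetric]) measurable
  also have "\<dots> = (\<integral>\<^sup>+\<xi>. nn_sq lborel (\<lambda>\<eta>. K (\<xi>, \<eta>)) \<partial>lborel)"
  proof (intro nn_integral_cong_AE, use AE_l2_slice[OF K] in eventually_elim)
    case (elim \<xi>)
    from orthonormal_parseval_ennreal[OF the_basis_orthonormal the_basis_spanning l2_space_cnj[OF elim]]
    show ?case by (simp add: kernel_op_eq_inner)
  qed
  also have "\<dots> = nn_sq lborel K"
    by (rule nn_integral_lborel_pair[symmetric]) measurable
  finally show ?thesis .
qed

lemma kernel_op_hilbert_schmidt: "hilbert_schmidt (kernel_op K)"
  by (simp add: hilbert_schmidt_def kernel_op_bounded_op hs_norm_sq_kernel_op l2_nn_integral[OF K])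

lemma kernel_op_norm_sums: "(\<lambda>j. (l2_norm lborel (kernel_op K (the_basis j)))\<^sup>2) sums (l2_norm lborel K)\<^sup>2"
proof -
  have eq: "(\<Sum>j. ennreal ((l2_norm lborel (kernel_op K (the_basis j)))\<^sup>2)) = ennreal ((l2_norm lborel K)\<^sup>2)"
    using hs_norm_sq_kernel_op unfolding hs_norm_sq_def
    by (simp add: l2_nn_integral[OF kernel_op_l2(1)[OF the_basis_in_l2]] l2_nn_integral[OF K])
  have s: "summable (\<lambda>j. (l2_norm lborel (kernel_op K (the_basis j)))\<^sup>2)"
    by (rule summable_suminf_not_top) (simp_all add: eq)
  from suminf_ennreal2[OF _ s] eq
  have "ennreal (\<Sum>j. (l2_norm lborel (kernel_op K (the_basis j)))\<^sup>2) = ennreal ((l2_norm lborel K)\<^sup>2)" by simp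
  hence "(\<Sum>j. (l2_norm lborel (kernel_op K (the_basis j)))\<^sup>2) = (l2_norm lborel K)\<^sup>2"
    by (subst (asm) ennreal_inj) (auto intro: suminf_nonneg[OF s])
  thus ?thesis using s by (simp add: sums_iff)
qed

end

lemma AE_kernel_op_lincomb:
  assumes K: "K \<in> l2_space lborel" and L: "L \<in> l2_space lborel" and u: "u \<in> l2_space lborel"
  shows "AE \<xi> in lborel. kernel_op (\<lambda>p. K p + c * L p) u \<xi> = kernel_op K u \<xi> + c * kernel_op L u \<xi>"
  using AE_l2_slice[OF K] AE_l2_slice[OF L]
proof eventually_elim
  case (elim \<xi>)
  have "(K (\<xi>, \<eta>) + c * L (\<xi>, \<eta>)) * u \<eta> = K (\<xi>, \<eta>) * u \<eta> + c * (L (\<xi>, \<eta>) * u \<eta>)" for \<eta>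
    by (simp add: algebra_simps)
  thus ?case unfolding kernel_op_def
    using l2_integrable_mult[OF elim(1) u] l2_integrable_mult[OF elim(2) u] by simp
qed

text \<open>Polarization, inside the series over the basis, of the formula for the Hilbert--Schmidt norm.\<close>

lemma kernel_op_inner_sums:
  assumes K: "K \<in> l2_space lborel" and L: "L \<in> l2_space lborel"
  shows "(\<lambda>j. l2_inner lborel (kernel_op K (the_basis j)) (kernel_op L (the_basis j))) sums l2_inner lborel K L"
proof -
  have re: "(\<lambda>j. 2 * Re (cnj c * l2_inner lborel (kernel_op K (the_basis j)) (kernel_op L (the_basis j)))) sums
      (2 * Re (cnj c * l2_inner lborel K L))" for c
  proof -
    note KL = l2_space_add[OF K l2_space_cmult[OF L, of c]]
    have pol: "2 * Re (cnj c * l2_inner M f g) = (l2_norm M (\<lambda>x. f x + c * g x))\<^sup>2 - (l2_norm M f)\<^sup>2 - (cmod c)\<^sup>2 * (l2_norm M g)\<^sup>2"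
      if "f \<in> l2_space M" "g \<in> l2_space M" for M :: "'b measure" and f g
      using l2_norm_add_sq[OF that(1) l2_space_cmult[OF that(2), of c]] by (simp add: l2_norm_cmult power_mult_distrib)
    note kK = kernel_op_l2(1)[OF K the_basis_in_l2] and kL = kernel_op_l2(1)[OF L the_basis_in_l2] and kKL = kernel_op_l2(1)[OF KL the_basis_in_l2]
    have "l2_norm lborel (\<lambda>\<xi>. kernel_op K (the_basis j) \<xi> + c * kernel_op L (the_basis j) \<xi>) =
        l2_norm lborel (kernel_op (\<lambda>p. K p + c * L p) (the_basis j))" for j
      using AE_kernel_op_lincomb[OF K L the_basis_in_l2, of c j]
        l2_measurable[OF kKL] l2_measurable[OF l2_space_add[OF kK l2_space_cmult[OF kL, of c]]]
      by (intro l2_norm_cong_AE) (auto elim: eventually_mono)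
    moreover have "(\<lambda>j. (l2_norm lborel (kernel_op (\<lambda>p. K p + c * L p) (the_basis j)))\<^sup>2 -
        (l2_norm lborel (kernel_op K (the_basis j)))\<^sup>2 - (cmod c)\<^sup>2 * (l2_norm lborel (kernel_op L (the_basis j)))\<^sup>2) sums
        ((l2_norm lborel (\<lambda>p. K p + c * L p))\<^sup>2 - (l2_norm lborel K)\<^sup>2 - (cmod c)\<^sup>2 * (l2_norm lborel L)\<^sup>2)"
      by (intro sums_diff sums_mult kernel_op_norm_sums K L KL)
    ultimately show ?thesis unfolding pol[OF kK kL] pol[OF K L] by simp
  qed
  have a: "(\<lambda>j. Re (l2_inner lborel (kernel_op K (the_basis j)) (kernel_op L (the_basis j)))) sums Re (l2_inner lborel K L)"
    using sums_mult[OF re[of 1], of "1/2"] by simp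
  have b: "(\<lambda>j. Im (l2_inner lborel (kernel_op K (the_basis j)) (kernel_op L (the_basis j)))) sums Im (l2_inner lborel K L)"
    using sums_mult[OF re[of \<i>], of "1/2"] by simp
  from a b show ?thesis by (simp add: sums_complex_iff)
qed

lemma hs_inner_kernel_op:
  "K \<in> l2_space lborel \<Longrightarrow> L \<in> l2_space lborel \<Longrightarrow> hs_inner (kernel_op K) (kernel_op L) = l2_inner lborel K L"
  unfolding hs_inner_def by (rule sums_unique[symmetric, OF kernel_op_inner_sums])

section \<open>Fields of integral operators in Schroedinger coordinates\<close>

text \<open>The space \<open>\<real>\<^sup>n \<times> (\<real>\<^sup>n \<times> \<real>)\<close> carries the variables \<open>(y, (a, \<lambda>))\<close>, where \<open>(a, \<lambda>)\<close> is dual to \<open>(x, t)\<close>.\<close>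

type_synonym 'n dual = "(real^'n) \<times> ((real^'n) \<times> real)"

definition slice :: "('n::finite dual \<Rightarrow> complex) \<Rightarrow> real \<Rightarrow> (real^'n) \<times> (real^'n) \<Rightarrow> complex" where
  "slice \<Phi> s p = \<Phi> (fst p, (snd p, s))"

text \<open>The kernel of the transform at \<open>s\<close> in terms of the slice at \<open>s\<close> of the partial Euclidean transform.\<close>

definition twisted_kernel :: "('n::finite dual \<Rightarrow> complex) \<Rightarrow> real \<Rightarrow> (real^'n) \<times> (real^'n) \<Rightarrow> complex" where
  "twisted_kernel \<Phi> s p = slice \<Phi> s (snd p - fst p, (s / 2) *\<^sub>R (fst p + snd p))"

lemma slice_measurable [measurable]:
  assumes [measurable]: "\<Phi> \<in> borel_measurable borel"
  shows "slice \<Phi> s \<in> borel_measurable borel"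
  unfolding slice_def by measurable

lemma twisted_kernel_measurable [measurable]:
  assumes [measurable]: "\<Phi> \<in> borel_measurable borel"
  shows "twisted_kernel \<Phi> s \<in> borel_measurable borel"
  unfolding twisted_kernel_def by measurable

lemma nn_integral_slice:
  fixes F :: "'n::finite dual \<Rightarrow> ennreal"
  assumes [measurable]: "F \<in> borel_measurable borel"
  shows "(\<integral>\<^sup>+s. \<integral>\<^sup>+p. F (fst p, (snd p, s)) \<partial>lborel \<partial>lborel) = (\<integral>\<^sup>+q. F q \<partial>lborel)"
proof -
  have "(\<integral>\<^sup>+q. F q \<partial>lborel) = (\<integral>\<^sup>+y. \<integral>\<^sup>+z. F (y, z) \<partial>lborel \<partial>lborel)"
    by (rule nn_integral_lborel_pair) measurable
  also have "\<dots> = (\<integral>\<^sup>+y. \<integral>\<^sup>+a. \<integral>\<^sup>+s. F (y, (a, s)) \<partial>lborel \<partial>lborel \<partial>lborel)"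
    by (intro nn_integral_cong nn_integral_lborel_pair) measurable
  also have "\<dots> = (\<integral>\<^sup>+p. \<integral>\<^sup>+s. F (fst p, (snd p, s)) \<partial>lborel \<partial>lborel)"
    by (subst nn_integral_lborel_pair) auto
  also have "\<dots> = (\<integral>\<^sup>+s. \<integral>\<^sup>+p. F (fst p, (snd p, s)) \<partial>lborel \<partial>lborel)"
    by (rule nn_integral_lborel_swap) measurable
  finally show ?thesis by simp
qed

text \<open>Substituting \<open>\<eta> = \<xi> + y\<close> and then \<open>a = s\<xi> + (s/2)y\<close> gives the Jacobian \<open>|s|\<^sup>n\<close>.\<close>

lemma nn_integral_twisted_kernel:
  fixes h :: "(real^'n::finite) \<times> (real^'n) \<Rightarrow> ennreal"
  assumes [measurable]: "h \<in> borel_measurable borel" and s: "s \<noteq> 0"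
  shows "ennreal (\<bar>s\<bar> ^ CARD('n)) * (\<integral>\<^sup>+p. h (snd p - fst p, (s / 2) *\<^sub>R (fst p + snd p)) \<partial>lborel) = (\<integral>\<^sup>+q. h q \<partial>lborel)"
proof -
  have aff: "(\<integral>\<^sup>+a. k a \<partial>lborel) = ennreal (\<bar>s\<bar> ^ CARD('n)) * (\<integral>\<^sup>+\<xi>. k (t + s *\<^sub>R \<xi>) \<partial>lborel)"
    if [measurable]: "k \<in> borel_measurable borel" for k :: "real^'n \<Rightarrow> ennreal" and t
    by (subst lborel_affine[OF s, of t])
       (simp add: nn_integral_density nn_integral_distr nn_integral_cmult)
  have "(\<integral>\<^sup>+p. h (snd p - fst p, (s / 2) *\<^sub>R (fst p + snd p)) \<partial>lborel) =
      (\<integral>\<^sup>+\<xi>. \<integral>\<^sup>+\<eta>. h (\<eta> - \<xi>, (s / 2) *\<^sub>R (\<xi> + \<eta>)) \<partial>lborel \<partial>lborel)"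
    by (subst nn_integral_lborel_pair) auto
  also have "\<dots> = (\<integral>\<^sup>+\<xi>. \<integral>\<^sup>+y. h (y + \<xi> - \<xi>, (s / 2) *\<^sub>R (\<xi> + (y + \<xi>))) \<partial>lborel \<partial>lborel)"
    by (intro nn_integral_cong nn_integral_lborel_translate[symmetric]) measurable
  also have "\<dots> = (\<integral>\<^sup>+\<xi>. \<integral>\<^sup>+y. h (y, (s / 2) *\<^sub>R y + s *\<^sub>R \<xi>) \<partial>lborel \<partial>lborel)"
  proof -
    have "(s / 2) *\<^sub>R (\<xi> + (y + \<xi>)) = (s / 2) *\<^sub>R y + s *\<^sub>R \<xi>" for \<xi> y :: "real^'n"
    proof -
      have "s *\<^sub>R \<xi> = (s / 2) *\<^sub>R \<xi> + (s / 2) *\<^sub>R \<xi>" by (simp flip: scaleR_add_left)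
      thus ?thesis by (simp add: scaleR_add_right add_ac)
    qed
    thus ?thesis by simp
  qed
  also have "\<dots> = (\<integral>\<^sup>+y. \<integral>\<^sup>+\<xi>. h (y, (s / 2) *\<^sub>R y + s *\<^sub>R \<xi>) \<partial>lborel \<partial>lborel)"
    by (rule nn_integral_lborel_swap) measurable
  finally have "ennreal (\<bar>s\<bar> ^ CARD('n)) * (\<integral>\<^sup>+p. h (snd p - fst p, (s / 2) *\<^sub>R (fst p + snd p)) \<partial>lborel) =
      (\<integral>\<^sup>+y. ennreal (\<bar>s\<bar> ^ CARD('n)) * (\<integral>\<^sup>+\<xi>. h (y, (s / 2) *\<^sub>R y + s *\<^sub>R \<xi>) \<partial>lborel) \<partial>lborel)"
    by (simp add: nn_integral_cmult)
  also have "\<dots> = (\<integral>\<^sup>+y. \<integral>\<^sup>+a. h (y, a) \<partial>lborel \<partial>lborel)"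
    by (intro nn_integral_cong aff[symmetric]) measurable
  also have "\<dots> = (\<integral>\<^sup>+q. h q \<partial>lborel)"
    by (rule nn_integral_lborel_pair[symmetric]) measurable
  finally show ?thesis .
qed

lemma AE_slice_l2:
  fixes \<Phi> :: "'n::finite dual \<Rightarrow> complex"
  assumes \<Phi>: "\<Phi> \<in> l2_space lborel"
  shows "AE s in lborel. slice \<Phi> s \<in> l2_space lborel"
proof -
  have [measurable]: "\<Phi> \<in> borel_measurable borel" using l2_measurable[OF \<Phi>] by simp
  have "(\<integral>\<^sup>+s. nn_sq lborel (slice \<Phi> s) \<partial>lborel) = nn_sq lborel \<Phi>"
    unfolding slice_def by (rule nn_integral_slice[of "\<lambda>q. ennreal ((cmod (\<Phi> q))\<^sup>2)"]) measurable
  moreover have "(\<lambda>s. nn_sq lborel (slice \<Phi> s)) \<in> borel_measurable lborel"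
    unfolding slice_def by measurable
  ultimately have "AE s in lborel. nn_sq lborel (slice \<Phi> s) \<noteq> \<infinity>"
    by (intro nn_integral_noteq_infinite) (auto simp: l2_nn_integral[OF \<Phi>])
  thus ?thesis by eventually_elim (auto intro!: l2_spaceI_nn simp: less_top)
qed

lemma twisted_kernel_l2:
  fixes \<Phi> :: "'n::finite dual \<Rightarrow> complex"
  assumes [measurable]: "\<Phi> \<in> borel_measurable borel" and L: "slice \<Phi> s \<in> l2_space lborel" and s: "s \<noteq> 0"
  shows "twisted_kernel \<Phi> s \<in> l2_space lborel"
    and "\<bar>s\<bar> ^ CARD('n) * (l2_norm lborel (twisted_kernel \<Phi> s))\<^sup>2 = (l2_norm lborel (slice \<Phi> s))\<^sup>2"
proof -
  have eq: "ennreal (\<bar>s\<bar> ^ CARD('n)) * nn_sq lborel (twisted_kernel \<Phi> s) = ennreal ((l2_norm lborel (slice \<Phi> s))\<^sup>2)"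
    unfolding twisted_kernel_def using nn_integral_twisted_kernel[of "\<lambda>p. ennreal ((cmod (slice \<Phi> s p))\<^sup>2)", OF _ s]
    by (simp add: l2_nn_integral[OF L])
  have "ennreal (\<bar>s\<bar> ^ CARD('n)) * nn_sq lborel (twisted_kernel \<Phi> s) < top"
    unfolding eq by simp
  hence "nn_sq lborel (twisted_kernel \<Phi> s) < top"
    using s by (auto simp: ennreal_mult_less_top)
  thus 1: "twisted_kernel \<Phi> s \<in> l2_space lborel" by (intro l2_spaceI_nn) auto
  show "\<bar>s\<bar> ^ CARD('n) * (l2_norm lborel (twisted_kernel \<Phi> s))\<^sup>2 = (l2_norm lborel (slice \<Phi> s))\<^sup>2"
    using eq by (simp add: l2_nn_integral[OF 1] ennreal_mult[symmetric])
qed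

lemma twisted_kernel_inner:
  fixes \<Phi> \<Psi> :: "'n::finite dual \<Rightarrow> complex"
  assumes m [measurable]: "\<Phi> \<in> borel_measurable borel" "\<Psi> \<in> borel_measurable borel"
    and L: "slice \<Phi> s \<in> l2_space lborel" "slice \<Psi> s \<in> l2_space lborel" and s: "s \<noteq> 0"
  shows "l2_inner lborel (twisted_kernel \<Phi> s) (twisted_kernel \<Psi> s) * complex_of_real (\<bar>s\<bar> ^ CARD('n)) =
     l2_inner lborel (slice \<Phi> s) (slice \<Psi> s)"
proof -
  define r where "r = sqrt (\<bar>s\<bar> ^ CARD('n))"
  have r: "r \<ge> 0" "r\<^sup>2 = \<bar>s\<bar> ^ CARD('n)" by (auto simp: r_def)
  have norm: "l2_norm lborel (\<lambda>p. complex_of_real r * twisted_kernel \<Theta> s p) = l2_norm lborel (slice \<Theta> s)"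
    if "\<Theta> \<in> borel_measurable borel" "slice \<Theta> s \<in> l2_space lborel" for \<Theta> :: "'n dual \<Rightarrow> complex"
  proof -
    have "(r * l2_norm lborel (twisted_kernel \<Theta> s))\<^sup>2 = (l2_norm lborel (slice \<Theta> s))\<^sup>2"
      using twisted_kernel_l2(2)[OF that s] by (simp add: power_mult_distrib r)
    hence "r * l2_norm lborel (twisted_kernel \<Theta> s) = l2_norm lborel (slice \<Theta> s)" using r(1) by simp
    thus ?thesis using r(1) by (simp add: l2_norm_cmult)
  qed
  have "l2_inner lborel (\<lambda>p. complex_of_real r * twisted_kernel \<Phi> s p) (\<lambda>p. complex_of_real r * twisted_kernel \<Psi> s p) =
      l2_inner lborel (slice \<Phi> s) (slice \<Psi> s)"
  proof (rule l2_inner_eq_by_polarization)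
    fix c
    have sl: "slice (\<lambda>q. \<Phi> q + c * \<Psi> q) s = (\<lambda>p. slice \<Phi> s p + c * slice \<Psi> s p)"
      by (simp add: slice_def fun_eq_iff)
    have "slice (\<lambda>q. \<Phi> q + c * \<Psi> q) s \<in> l2_space lborel"
      unfolding sl by (intro l2_space_add l2_space_cmult L)
    from norm[OF _ this]
    have "l2_norm lborel (\<lambda>p. complex_of_real r * twisted_kernel (\<lambda>q. \<Phi> q + c * \<Psi> q) s p) =
        l2_norm lborel (\<lambda>p. slice \<Phi> s p + c * slice \<Psi> s p)" unfolding sl by simp
    moreover have "complex_of_real r * twisted_kernel (\<lambda>q. \<Phi> q + c * \<Psi> q) s p =
        complex_of_real r * twisted_kernel \<Phi> s p + c * (complex_of_real r * twisted_kernel \<Psi> s p)" for p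
      by (simp add: twisted_kernel_def slice_def algebra_simps)
    ultimately show "l2_norm lborel (\<lambda>p. complex_of_real r * twisted_kernel \<Phi> s p + c * (complex_of_real r * twisted_kernel \<Psi> s p)) =
        l2_norm lborel (\<lambda>p. slice \<Phi> s p + c * slice \<Psi> s p)" by simp
  qed (auto intro!: L norm m l2_space_cmult twisted_kernel_l2(1)[OF _ _ s])
  thus ?thesis by (simp flip: r(2) add: power2_eq_square mult_ac)
qed

text \<open>The value is 0 at the exceptional parameters, which form a null set: a field of
  Hilbert--Schmidt operators must be one at every \<open>s \<noteq> 0\<close>.\<close>

definition kernel_field :: "('n::finite dual \<Rightarrow> complex) \<Rightarrow> real \<Rightarrow> 'n op" where
  "kernel_field \<Phi> s = (if s \<noteq> 0 \<and> slice \<Phi> s \<in> l2_space lborel then kernel_op (twisted_kernel \<Phi> s) else (\<lambda>u \<xi>. 0))"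

lemma kernel_field_hilbert_schmidt:
  assumes "\<Phi> \<in> borel_measurable borel"
  shows "hilbert_schmidt (kernel_field \<Phi> s)"
proof (cases "s \<noteq> 0 \<and> slice \<Phi> s \<in> l2_space lborel")
  case True
  thus ?thesis using kernel_op_hilbert_schmidt[OF twisted_kernel_l2(1)[OF assms]] by (simp add: kernel_field_def)
next
  case False
  have "bounded_op (\<lambda>u \<xi>. 0)" by (auto simp: bounded_op_def l2_norm_def intro!: exI[of _ 0])
  thus ?thesis using False by (auto simp: kernel_field_def hilbert_schmidt_def hs_norm_sq_def)
qed

lemma AE_plancherel_measure: "(AE s in lborel. P s) \<Longrightarrow> (AE s in plancherel_measure n. P s)"
proof -
  assume "AE s in lborel. P s"
  hence "AE s in restrict_space lborel (- {0}). P s"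
    by (subst AE_restrict_space_iff) (auto elim: eventually_mono)
  thus ?thesis unfolding plancherel_measure_def
    by (subst AE_density) (auto intro!: measurable_restrict_space1 elim: eventually_mono)
qed

lemma AE_plancherel_measureD: "(AE s in plancherel_measure n. P s) \<Longrightarrow> (AE s in lborel. P s)"
proof -
  assume "AE s in plancherel_measure n. P s"
  hence "AE s in restrict_space lborel (- {0}). 0 < ennreal (\<bar>s\<bar> ^ n) \<longrightarrow> P s"
    unfolding plancherel_measure_def
    by (subst (asm) AE_density) (auto intro!: measurable_restrict_space1)
  hence "AE s in lborel. s \<in> - {0} \<longrightarrow> 0 < ennreal (\<bar>s\<bar> ^ n) \<longrightarrow> P s"
    by (subst (asm) AE_restrict_space_iff) auto
  thus ?thesis using AE_lborel_singleton[of "0 :: real"] by eventually_elim auto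
qed

lemma measurable_plancherel_measure:
  "f \<in> borel_measurable borel \<Longrightarrow> f \<in> borel_measurable (plancherel_measure n)"
  by (simp add: plancherel_measure_def measurable_restrict_space1)

lemma nn_integral_plancherel_measure:
  assumes [measurable]: "h \<in> borel_measurable borel"
  shows "(\<integral>\<^sup>+s. h s \<partial>plancherel_measure n) = (\<integral>\<^sup>+s. ennreal (\<bar>s\<bar> ^ n) * h s \<partial>lborel)"
proof -
  have "(\<integral>\<^sup>+s. h s \<partial>plancherel_measure n) = (\<integral>\<^sup>+s. ennreal (\<bar>s\<bar> ^ n) * h s \<partial>restrict_space lborel (- {0}))"
    unfolding plancherel_measure_def
    by (intro nn_integral_density) (auto intro!: measurable_restrict_space1)
  also have "\<dots> = (\<integral>\<^sup>+s. ennreal (\<bar>s\<bar> ^ n) * h s * indicator (- {0}) s \<partial>lborel)"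
    by (intro nn_integral_restrict_space) auto
  also have "\<dots> = (\<integral>\<^sup>+s. ennreal (\<bar>s\<bar> ^ n) * h s \<partial>lborel)"
    using AE_lborel_singleton[of "0 :: real"]
    by (intro nn_integral_cong_AE) (auto elim!: eventually_mono)
  finally show ?thesis .
qed

lemma kernel_field_weakly_measurable:
  fixes \<Phi> :: "'n::finite dual \<Rightarrow> complex"
  assumes [measurable]: "\<Phi> \<in> borel_measurable borel" and u: "u \<in> l2_space lborel" and v: "v \<in> l2_space lborel"
  shows "(\<lambda>s. l2_inner lborel (kernel_field \<Phi> s u) v) \<in> borel_measurable borel"
proof -
  have [measurable]: "u \<in> borel_measurable borel" "v \<in> borel_measurable borel"
    using l2_measurable[OF u] l2_measurable[OF v] by simp_all
  have good: "slice \<Phi> s \<in> l2_space lborel \<longleftrightarrow> nn_sq lborel (slice \<Phi> s) < \<infinity>" for s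
    by (auto intro!: l2_spaceI_nn simp: l2_nn_integral)
  have "l2_inner lborel (kernel_field \<Phi> s u) v =
      (if s \<noteq> 0 \<and> nn_sq lborel (slice \<Phi> s) < \<infinity>
       then (LINT \<xi>|lborel. (LINT \<eta>|lborel. twisted_kernel \<Phi> s (\<xi>, \<eta>) * u \<eta>) * cnj (v \<xi>)) else 0)" for s
    unfolding kernel_field_def good l2_inner_def kernel_op_def by simp
  thus ?thesis unfolding slice_def twisted_kernel_def by simp
qed

text \<open>The weight \<open>|\<lambda>|\<^sup>n\<close> of the Plancherel measure is the Jacobian of \<open>(\<xi>, \<eta>) \<mapsto> (\<eta> - \<xi>, \<lambda>(\<xi> + \<eta>)/2)\<close>.\<close>

lemma nn_integral_hs_norm_kernel_field:
  fixes \<Phi> :: "'n::finite dual \<Rightarrow> complex"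
  assumes \<Phi>: "\<Phi> \<in> l2_space lborel"
  shows "(\<integral>\<^sup>+s. hs_norm_sq (kernel_field \<Phi> s) \<partial>plancherel_measure CARD('n)) = ennreal ((l2_norm lborel \<Phi>)\<^sup>2)"
proof -
  have [measurable]: "\<Phi> \<in> borel_measurable borel" using l2_measurable[OF \<Phi>] by simp
  have "(\<integral>\<^sup>+s. hs_norm_sq (kernel_field \<Phi> s) \<partial>plancherel_measure CARD('n)) =
      (\<integral>\<^sup>+s. nn_sq lborel (twisted_kernel \<Phi> s) \<partial>plancherel_measure CARD('n))"
  proof (rule nn_integral_cong_AE, rule AE_plancherel_measure, use AE_slice_l2[OF \<Phi>] AE_lborel_singleton[of "0 :: real"] in eventually_elim)
    case (elim s)
    thus ?case using hs_norm_sq_kernel_op[OF twisted_kernel_l2(1)[of \<Phi> s]] by (simp add: kernel_field_def)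
  qed
  also have "\<dots> = (\<integral>\<^sup>+s. ennreal (\<bar>s\<bar> ^ CARD('n)) * nn_sq lborel (twisted_kernel \<Phi> s) \<partial>lborel)"
    by (rule nn_integral_plancherel_measure) (unfold twisted_kernel_def slice_def, measurable)
  also have "\<dots> = (\<integral>\<^sup>+s. nn_sq lborel (slice \<Phi> s) \<partial>lborel)"
  proof (rule nn_integral_cong_AE, use AE_lborel_singleton[of "0 :: real"] in eventually_elim)
    case (elim s)
    show ?case unfolding twisted_kernel_def
      by (rule nn_integral_twisted_kernel[of "\<lambda>p. ennreal ((cmod (slice \<Phi> s p))\<^sup>2)", OF _ elim]) measurable
  qed
  also have "\<dots> = ennreal ((l2_norm lborel \<Phi>)\<^sup>2)"
    unfolding slice_def l2_nn_integral[OF \<Phi>, symmetric]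
    by (rule nn_integral_slice[of "\<lambda>q. ennreal ((cmod (\<Phi> q))\<^sup>2)"]) measurable
  finally show ?thesis .
qed

lemma kernel_field_in_hs_fields:
  fixes \<Phi> :: "'n::finite dual \<Rightarrow> complex"
  assumes \<Phi>: "\<Phi> \<in> l2_space lborel"
  shows "kernel_field \<Phi> \<in> hs_fields"
proof -
  have m: "\<Phi> \<in> borel_measurable borel" using l2_measurable[OF \<Phi>] by simp
  show ?thesis unfolding hs_fields_def
    using nn_integral_hs_norm_kernel_field[OF \<Phi>]
    by (auto intro!: kernel_field_hilbert_schmidt m measurable_plancherel_measure kernel_field_weakly_measurable)
qed

lemma hs_norm_sq_cong:
  assumes "\<And>j. AE \<xi> in lborel. S (the_basis j) \<xi> = T (the_basis j) \<xi>"
  shows "hs_norm_sq S = hs_norm_sq T"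
  unfolding hs_norm_sq_def
proof (intro suminf_cong nn_integral_cong_AE)
  fix j
  show "AE \<xi> in lborel. ennreal ((cmod (S (the_basis j) \<xi>))\<^sup>2) = ennreal ((cmod (T (the_basis j) \<xi>))\<^sup>2)"
    using assms[of j] by eventually_elim simp
qed

lemma AE_hs_norm_sq_kernel_field_diff:
  fixes \<Phi> \<Psi> :: "'n::finite dual \<Rightarrow> complex"
  assumes \<Phi>: "\<Phi> \<in> l2_space lborel" and \<Psi>: "\<Psi> \<in> l2_space lborel"
  shows "AE s in lborel. hs_norm_sq (\<lambda>u \<xi>. kernel_field \<Phi> s u \<xi> - kernel_field \<Psi> s u \<xi>) = hs_norm_sq (kernel_field (\<lambda>q. \<Phi> q - \<Psi> q) s)"
  using AE_slice_l2[OF \<Phi>] AE_slice_l2[OF \<Psi>] AE_lborel_singleton[of "0 :: real"]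
proof eventually_elim
  case (elim s)
  have m: "\<Phi> \<in> borel_measurable borel" "\<Psi> \<in> borel_measurable borel"
    using l2_measurable[OF \<Phi>] l2_measurable[OF \<Psi>] by simp_all
  have sl: "slice (\<lambda>q. \<Phi> q - \<Psi> q) s = (\<lambda>p. slice \<Phi> s p - slice \<Psi> s p)" by (simp add: slice_def fun_eq_iff)
  have D: "slice (\<lambda>q. \<Phi> q - \<Psi> q) s \<in> l2_space lborel"
    unfolding sl by (intro l2_space_diff elim)
  show ?case
  proof (rule hs_norm_sq_cong)
    fix j
    have eq: "twisted_kernel (\<lambda>q. \<Phi> q - \<Psi> q) s = (\<lambda>p. twisted_kernel \<Phi> s p + (-1) * twisted_kernel \<Psi> s p)" by (simp add: twisted_kernel_def slice_def fun_eq_iff)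
    from AE_kernel_op_lincomb[OF twisted_kernel_l2(1)[OF m(1) elim(1,3)] twisted_kernel_l2(1)[OF m(2) elim(2,3)] the_basis_in_l2[of j], of "-1"]
    show "AE \<xi> in lborel. kernel_field \<Phi> s (the_basis j) \<xi> - kernel_field \<Psi> s (the_basis j) \<xi> = kernel_field (\<lambda>q. \<Phi> q - \<Psi> q) s (the_basis j) \<xi>"
      by eventually_elim (use elim D in \<open>simp add: kernel_field_def eq\<close>)
  qed
qed

section \<open>The group Fourier transform as a field of integral operators\<close>

text \<open>Reordering of the coordinates of the Heisenberg group from \<open>(x, y, t)\<close> to \<open>(y, (x, t))\<close>.\<close>

definition reorder :: "('n::finite heis \<Rightarrow> 'c) \<Rightarrow> 'n dual \<Rightarrow> 'c" where
  "reorder f p = f (fst (snd p), fst p, snd (snd p))"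

lemma nn_integral_reorder:
  fixes f :: "'n::finite heis \<Rightarrow> ennreal"
  assumes [measurable]: "f \<in> borel_measurable borel"
  shows "(\<integral>\<^sup>+p. reorder f p \<partial>lborel) = (\<integral>\<^sup>+X. f X \<partial>lborel)"
proof -
  have "(\<integral>\<^sup>+X. f X \<partial>lborel) = (\<integral>\<^sup>+x. \<integral>\<^sup>+w. f (x, w) \<partial>lborel \<partial>lborel)"
    by (rule nn_integral_lborel_pair) measurable
  also have "\<dots> = (\<integral>\<^sup>+x. \<integral>\<^sup>+y. \<integral>\<^sup>+t. f (x, y, t) \<partial>lborel \<partial>lborel \<partial>lborel)"
    by (intro nn_integral_cong nn_integral_lborel_pair) measurable
  also have "\<dots> = (\<integral>\<^sup>+y. \<integral>\<^sup>+x. \<integral>\<^sup>+t. f (x, y, t) \<partial>lborel \<partial>lborel \<partial>lborel)"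
    by (rule nn_integral_lborel_swap) measurable
  also have "\<dots> = (\<integral>\<^sup>+y. \<integral>\<^sup>+z. f (fst z, y, snd z) \<partial>lborel \<partial>lborel)"
    by (intro nn_integral_cong, subst nn_integral_lborel_pair) auto
  also have "\<dots> = (\<integral>\<^sup>+p. reorder f p \<partial>lborel)"
    unfolding reorder_def by (subst nn_integral_lborel_pair) auto
  finally show ?thesis by simp
qed

lemma distr_reorder: "distr lborel borel (\<lambda>p::'n::finite dual. (fst (snd p), fst p, snd (snd p))) = (lborel :: 'n heis measure)"
proof (rule measure_eqI)
  fix A :: "'n heis set" assume "A \<in> sets (distr lborel borel (\<lambda>p::'n dual. (fst (snd p), fst p, snd (snd p))))"
  hence [measurable]: "A \<in> sets borel" by simp
  have "emeasure (distr lborel borel (\<lambda>p::'n dual. (fst (snd p), fst p, snd (snd p)))) A =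
      (\<integral>\<^sup>+X. indicator A X \<partial>distr lborel borel (\<lambda>p::'n dual. (fst (snd p), fst p, snd (snd p))))"
    by simp
  also have "\<dots> = (\<integral>\<^sup>+p. reorder (indicator A) p \<partial>lborel)"
    unfolding reorder_def by (subst nn_integral_distr) auto
  also have "\<dots> = emeasure lborel A" by (subst nn_integral_reorder) auto
  finally show "emeasure (distr lborel borel (\<lambda>p::'n dual. (fst (snd p), fst p, snd (snd p)))) A = emeasure lborel A" .
qed simp

lemma reorder_measurable [measurable]:
  assumes [measurable]: "f \<in> borel_measurable borel"
  shows "reorder f \<in> borel_measurable borel"
  unfolding reorder_def by measurable

lemma integral_reorder:
  fixes f :: "'n::finite heis \<Rightarrow> 'c::{banach, second_countable_topology}"
  assumes [measurable]: "f \<in> borel_measurable borel"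
  shows "(LINT p|lborel. reorder f p) = (LINT X|lborel. f X)"
  unfolding reorder_def by (subst distr_reorder[symmetric], subst integral_distr) auto

lemma integrable_reorder:
  fixes f :: "'n::finite heis \<Rightarrow> 'c::{banach, second_countable_topology}"
  assumes f: "integrable lborel f"
  shows "integrable lborel (reorder f)"
proof -
  have "integrable (distr lborel borel (\<lambda>p::'n dual. (fst (snd p), fst p, snd (snd p)))) f"
    unfolding distr_reorder by (rule f)
  from integrable_distr[OF _ this] show ?thesis by (simp add: reorder_def[abs_def])
qed

lemma l2_norm_reorder:
  fixes f :: "'n::finite heis \<Rightarrow> complex"
  assumes [measurable]: "f \<in> borel_measurable borel"
  shows "l2_norm lborel (reorder f) = l2_norm lborel f"
  unfolding l2_norm_def using integral_reorder[of "\<lambda>X. (cmod (f X))\<^sup>2"] by (simp add: reorder_def)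

lemma l2_inner_reorder:
  fixes f g :: "'n::finite heis \<Rightarrow> complex"
  assumes [measurable]: "f \<in> borel_measurable borel" "g \<in> borel_measurable borel"
  shows "l2_inner lborel (reorder f) (reorder g) = l2_inner lborel f g"
  unfolding l2_inner_def using integral_reorder[of "\<lambda>X. f X * cnj (g X)"] by (simp add: reorder_def)

lemma l2_space_reorder:
  fixes f :: "'n::finite heis \<Rightarrow> complex"
  assumes f: "f \<in> l2_space lborel"
  shows "reorder f \<in> l2_space lborel"
proof -
  have [measurable]: "f \<in> borel_measurable borel" using l2_measurable[OF f] by simp
  show ?thesis using integrable_reorder[OF l2_integrable_sq[OF f]] by (simp add: l2_space_def reorder_def[abs_def])
qed

lemma L12_approx_reorder:
  fixes f :: "'n::finite heis \<Rightarrow> complex"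
  assumes "L12_approx g f"
  shows "L12_approx (\<lambda>k. reorder (g k)) (reorder f)"
proof -
  note D = assms[unfolded L12_approx_def]
  have gm: "g k \<in> borel_measurable borel" for k
    using l2_measurable[OF l2_tendstoD(1)[OF conjunct2[OF D]], of k] by simp
  have fm: "f \<in> borel_measurable borel" using l2_measurable[OF l2_tendstoD(2)[OF conjunct2[OF D]]] by simp
  have "l2_norm lborel (\<lambda>p. reorder (g k) p - reorder f p) = l2_norm lborel (\<lambda>X. g k X - f X)" for k
    using l2_norm_reorder[of "\<lambda>X. g k X - f X"] gm[of k] fm by (simp add: reorder_def[abs_def])
  thus ?thesis using D
    by (auto simp: L12_approx_def l2_tendsto_def intro: l2_space_reorder integrable_reorder)
qed

text \<open>Fubini: with \<open>\<eta> = \<xi> + y\<close>, the phase of the representation is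
  \<open>\<lambda>t + x\<cdot>\<lambda>(\<xi> + \<eta>)/2\<close>, so integrating over \<open>(x,t)\<close> first leaves the partial Euclidean transform.\<close>

lemma fourier_weak_identity:
  fixes g :: "'n::finite heis \<Rightarrow> complex"
  assumes g: "integrable lborel g" and u: "u \<in> l2_space lborel" and v: "v \<in> l2_space lborel"
  shows "(LINT X|lborel. g X * l2_inner lborel (schroedinger s X u) v) =
     l2_inner lborel (kernel_op (twisted_kernel (part_ft (reorder g)) s) u) v"
proof -
  have [measurable]: "g \<in> borel_measurable borel" using borel_measurable_integrable[OF g] by simp
  have [measurable]: "u \<in> borel_measurable borel" "v \<in> borel_measurable borel"
    using l2_measurable[OF u] l2_measurable[OF v] by simp_all
  define E :: "'n heis \<Rightarrow> real^'n \<Rightarrow> complex" where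
    "E = (\<lambda>X \<xi>. chr (s *\<^sub>R \<xi> + (s / 2) *\<^sub>R fst (snd X), s) (fst X, snd (snd X)))"
  have [measurable]: "case_prod E \<in> borel_measurable borel" unfolding E_def by measurable
  have nE: "cmod (E X \<xi>) = 1" for X \<xi> by (simp add: E_def)
  have sch: "schroedinger s X u \<xi> = E X \<xi> * u (\<xi> + fst (snd X))" for X \<xi>
  proof (cases X)
    case (fields x y t)
    have "exp (2 * complex_of_real pi * \<i> * complex_of_real (s * t)) *
        exp (2 * complex_of_real pi * \<i> * complex_of_real (s * (x \<bullet> \<xi> + (x \<bullet> y) / 2))) = E X \<xi>"
      unfolding E_def fields chr_def cis_conv_exp exp_add[symmetric]
      by (rule arg_cong[where f = exp]) (simp add: inner_add_left inner_commute algebra_simps)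
    thus ?thesis by (simp add: fields)
  qed
  define F where "F = (\<lambda>(X :: 'n heis, \<xi>). g X * (E X \<xi> * u (\<xi> + fst (snd X)) * cnj (v \<xi>)))"
  have [measurable]: "F \<in> borel_measurable borel" unfolding F_def E_def case_prod_beta' by measurable
  have "(\<integral>\<^sup>+p. ennreal (cmod (F p)) \<partial>lborel) =
      (\<integral>\<^sup>+X. \<integral>\<^sup>+\<xi>. ennreal (cmod (g X)) * ennreal (cmod (u (\<xi> + fst (snd X)) * v \<xi>)) \<partial>lborel \<partial>lborel)"
    by (subst nn_integral_lborel_pair, measurable) (simp add: F_def norm_mult nE ennreal_mult mult.assoc)
  also have "\<dots> = (\<integral>\<^sup>+X. ennreal (cmod (g X)) * (\<integral>\<^sup>+\<xi>. ennreal (cmod (u (\<xi> + fst (snd X)) * v \<xi>)) \<partial>lborel) \<partial>lborel)"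
    by (intro nn_integral_cong nn_integral_cmult) measurable
  also have "\<dots> \<le> (\<integral>\<^sup>+X. ennreal (cmod (g X)) * ennreal (l2_norm lborel u * l2_norm lborel v) \<partial>lborel)"
  proof (intro nn_integral_mono mult_left_mono)
    fix X :: "'n heis"
    let ?c = "fst (snd X)"
    have uc: "(\<lambda>\<xi>. u (\<xi> + ?c)) \<in> l2_space lborel" by (rule l2_space_translate[OF u])
    let ?a = "\<lambda>\<xi>. complex_of_real (cmod (u (\<xi> + ?c)))" and ?b = "\<lambda>\<xi>. complex_of_real (cmod (v \<xi>))"
    have ab: "?a \<in> l2_space lborel" "?b \<in> l2_space lborel"
      using uc v by (auto simp: l2_space_def)
    have "(\<integral>\<^sup>+\<xi>. ennreal (cmod (u (\<xi> + ?c) * v \<xi>)) \<partial>lborel) = ennreal (LINT \<xi>|lborel. cmod (u (\<xi> + ?c) * v \<xi>))"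
      using integrable_norm[OF l2_integrable_mult[OF uc v]] by (intro nn_integral_eq_integral) auto
    also have "(LINT \<xi>|lborel. cmod (u (\<xi> + ?c) * v \<xi>)) = cmod (l2_inner lborel ?a ?b)"
    proof -
      have "l2_inner lborel ?a ?b = complex_of_real (LINT \<xi>|lborel. cmod (u (\<xi> + ?c) * v \<xi>))"
        unfolding l2_inner_def integral_complex_of_real[symmetric] by (simp add: norm_mult)
      thus ?thesis by (simp only: norm_of_real) (simp add: integral_nonneg_AE)
    qed
    also have "\<dots> \<le> l2_norm lborel ?a * l2_norm lborel ?b" by (rule l2_cauchy_schwarz[OF ab])
    also have "l2_norm lborel ?a = l2_norm lborel u"
      using l2_norm_lborel_translate[of u ?c] by (simp add: l2_norm_def)
    also have "l2_norm lborel ?b = l2_norm lborel v" by (simp add: l2_norm_def)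
    finally show "(\<integral>\<^sup>+\<xi>. ennreal (cmod (u (\<xi> + ?c) * v \<xi>)) \<partial>lborel) \<le> ennreal (l2_norm lborel u * l2_norm lborel v)"
      by (simp add: ennreal_leI)
  qed simp
  also have "\<dots> = (\<integral>\<^sup>+X. ennreal (cmod (g X)) \<partial>lborel) * ennreal (l2_norm lborel u * l2_norm lborel v)"
    by (rule nn_integral_multc) measurable
  also have "\<dots> < \<infinity>" using g by (simp add: integrable_iff_bounded ennreal_mult_less_top)
  finally have F: "integrable lborel F" by (intro integrableI_bounded) auto
  hence F': "integrable (lborel \<Otimes>\<^sub>M lborel) (case_prod (\<lambda>X \<xi>. F (X, \<xi>)))" by (simp add: lborel_prod)
  have "(LINT X|lborel. g X * l2_inner lborel (schroedinger s X u) v) = (LINT X|lborel. (LINT \<xi>|lborel. F (X, \<xi>)))"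
    by (simp add: l2_inner_def sch F_def)
  also have "\<dots> = (LINT \<xi>|lborel. (LINT X|lborel. F (X, \<xi>)))"
    using lborel_pair.integral_fst[OF F'] lborel_pair.integral_snd[OF F'] by simp
  also have "\<dots> = (LINT \<xi>|lborel. kernel_op (twisted_kernel (part_ft (reorder g)) s) u \<xi> * cnj (v \<xi>))"
  proof (rule integral_cong_AE)
    have [measurable]: "kernel_op (twisted_kernel (part_ft (reorder g)) s) u \<in> borel_measurable borel"
      by (rule kernel_op_measurable) measurable
    show "(\<lambda>\<xi>. kernel_op (twisted_kernel (part_ft (reorder g)) s) u \<xi> * cnj (v \<xi>)) \<in> borel_measurable lborel" by measurable
    show "(\<lambda>\<xi>. LINT X|lborel. F (X, \<xi>)) \<in> borel_measurable lborel" by measurable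
    show "AE \<xi> in lborel. (LINT X|lborel. F (X, \<xi>)) = kernel_op (twisted_kernel (part_ft (reorder g)) s) u \<xi> * cnj (v \<xi>)"
      using lborel_pair.AE_integrable_snd[OF F']
    proof eventually_elim
      case (elim \<xi>)
      have "(LINT X|lborel. F (X, \<xi>)) = (LINT p|lborel. reorder (\<lambda>X. F (X, \<xi>)) p)"
        by (rule integral_reorder[symmetric]) measurable
      also have "\<dots> = (LINT y|lborel. (LINT z|lborel. reorder (\<lambda>X. F (X, \<xi>)) (y, z)))"
      proof -
        have "integrable (lborel \<Otimes>\<^sub>M lborel) (case_prod (\<lambda>y z. reorder (\<lambda>X. F (X, \<xi>)) (y, z)))"
          using integrable_reorder[OF elim] by (simp add: lborel_prod)
        from lborel_pair.integral_fst[OF this] show ?thesis by (simp add: lborel_prod)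
      qed
      also have "\<dots> = (LINT y|lborel. part_ft (reorder g) (y, (s *\<^sub>R \<xi> + (s / 2) *\<^sub>R y, s)) * u (y + \<xi>) * cnj (v \<xi>))"
      proof (rule Bochner_Integration.integral_cong[OF refl])
        fix y
        have "reorder (\<lambda>X. F (X, \<xi>)) (y, z) = (u (y + \<xi>) * cnj (v \<xi>)) * (reorder g (y, z) * chr (s *\<^sub>R \<xi> + (s / 2) *\<^sub>R y, s) z)" for z
          by (cases z) (simp add: reorder_def F_def E_def add.commute mult_ac)
        thus "(LINT z|lborel. reorder (\<lambda>X. F (X, \<xi>)) (y, z)) =
            part_ft (reorder g) (y, (s *\<^sub>R \<xi> + (s / 2) *\<^sub>R y, s)) * u (y + \<xi>) * cnj (v \<xi>)"
          by (simp add: part_ft_def ft_def mult_ac)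
      qed
      also have "\<dots> = (LINT y|lborel. part_ft (reorder g) (y + \<xi> - \<xi>, (s *\<^sub>R \<xi> + (s / 2) *\<^sub>R (y + \<xi> - \<xi>), s)) * u (y + \<xi>) * cnj (v \<xi>))"
        by simp
      also have "\<dots> = (LINT \<eta>|lborel. part_ft (reorder g) (\<eta> - \<xi>, (s *\<^sub>R \<xi> + (s / 2) *\<^sub>R (\<eta> - \<xi>), s)) * u \<eta> * cnj (v \<xi>))"
        by (rule integral_lborel_translate[where c = \<xi>]) measurable
      also have "\<dots> = (LINT \<eta>|lborel. twisted_kernel (part_ft (reorder g)) s (\<xi>, \<eta>) * u \<eta> * cnj (v \<xi>))"
      proof -
        have "s *\<^sub>R \<xi> + (s / 2) *\<^sub>R (\<eta> - \<xi>) = (s / 2) *\<^sub>R (\<xi> + \<eta>)" for \<eta>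
        proof -
          have "s *\<^sub>R \<xi> = (s / 2) *\<^sub>R \<xi> + (s / 2) *\<^sub>R \<xi>" by (simp flip: scaleR_add_left)
          thus ?thesis by (simp add: scaleR_add_right scaleR_diff_right)
        qed
        thus ?thesis by (simp add: twisted_kernel_def slice_def)
      qed
      also have "\<dots> = kernel_op (twisted_kernel (part_ft (reorder g)) s) u \<xi> * cnj (v \<xi>)"
        unfolding kernel_op_def by (rule integral_mult_left_zero)
      finally show ?case .
    qed
  qed
  finally show ?thesis by (simp add: l2_inner_def)
qed

text \<open>For almost every \<open>s\<close> the kernel is square integrable, so its operator is bounded and satisfies the
  weak identity that defines the transform; a bounded operator is determined by its matrix elements.\<close>

lemma fourier_L1_eq_kernel_field:
  fixes g :: "'n::finite heis \<Rightarrow> complex"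
  assumes g: "integrable lborel g" and gL: "g \<in> l2_space lborel"
  shows "AE s in lborel. bounded_op (fourier_L1 g s) \<and>
     (\<forall>u\<in>l2_space lborel. AE \<xi> in lborel. fourier_L1 g s u \<xi> = kernel_field (part_ft (reorder g)) s u \<xi>)"
proof -
  have PL: "part_ft (reorder g) \<in> l2_space lborel"
    by (intro part_ft_plancherel integrable_reorder l2_space_reorder g gL)
  have m: "part_ft (reorder g) \<in> borel_measurable borel" using l2_measurable[OF PL] by simp
  show ?thesis using AE_slice_l2[OF PL] AE_lborel_singleton[of "0 :: real"]
  proof eventually_elim
    case (elim s)
    let ?K = "twisted_kernel (part_ft (reorder g)) s"
    let ?P = "\<lambda>T. bounded_op T \<and> (\<forall>u\<in>l2_space lborel. \<forall>v\<in>l2_space lborel.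
        l2_inner lborel (T u) v = (LINT X|lborel. g X * l2_inner lborel (schroedinger s X u) v))"
    have KL: "?K \<in> l2_space lborel" by (rule twisted_kernel_l2(1)[OF m elim])
    have "?P (kernel_op ?K)" using kernel_op_bounded_op[OF KL] fourier_weak_identity[OF g] by auto
    hence P: "?P (fourier_L1 g s)" unfolding fourier_L1_def by (rule someI[of ?P])
    have "AE \<xi> in lborel. fourier_L1 g s u \<xi> = kernel_field (part_ft (reorder g)) s u \<xi>" if u: "u \<in> l2_space lborel" for u
    proof -
      let ?d = "\<lambda>\<xi>. fourier_L1 g s u \<xi> - kernel_op ?K u \<xi>"
      have a: "fourier_L1 g s u \<in> l2_space lborel" using P u by (auto simp: bounded_op_def)
      have b: "kernel_op ?K u \<in> l2_space lborel" by (rule kernel_op_l2(1)[OF KL u])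
      have d: "?d \<in> l2_space lborel" by (rule l2_space_diff[OF a b])
      have "l2_inner lborel ?d ?d = l2_inner lborel (fourier_L1 g s u) ?d - l2_inner lborel (kernel_op ?K u) ?d"
        by (rule l2_inner_diff_left[OF a b d])
      also have "\<dots> = 0" using P u d fourier_weak_identity[OF g u d, of s] by simp
      finally have "l2_norm lborel ?d = 0" by (simp add: l2_inner_self)
      from l2_norm_zeroD[OF d this] show ?thesis using elim by (simp add: kernel_field_def)
    qed
    thus ?case using P by blast
  qed
qed

text \<open>What is needed of a field of operators for its Hilbert--Schmidt norms to be measurable.\<close>

definition weak_field :: "(real \<Rightarrow> 'n::finite op) \<Rightarrow> bool" where
  "weak_field A \<longleftrightarrow> (\<forall>s. s \<noteq> 0 \<longrightarrow> bounded_op (A s)) \<and>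
     (\<forall>u\<in>l2_space lborel. \<forall>v\<in>l2_space lborel.
        (\<lambda>s. l2_inner lborel (A s u) v) \<in> borel_measurable (plancherel_measure CARD('n)))"

lemma weak_field_l2: "weak_field A \<Longrightarrow> s \<noteq> 0 \<Longrightarrow> u \<in> l2_space lborel \<Longrightarrow> A s u \<in> l2_space lborel"
  by (simp add: weak_field_def bounded_op_def)

lemma weak_field_measurable:
  fixes A :: "real \<Rightarrow> 'n::finite op"
  shows "weak_field A \<Longrightarrow> u \<in> l2_space lborel \<Longrightarrow> v \<in> l2_space lborel \<Longrightarrow>
    (\<lambda>s. l2_inner lborel (A s u) v) \<in> borel_measurable (plancherel_measure CARD('n))"
  by (simp add: weak_field_def)

lemma hs_fields_weak_field: "F \<in> hs_fields \<Longrightarrow> weak_field F"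
  by (auto simp: hs_fields_def weak_field_def hilbert_schmidt_def)

lemma kernel_field_weak_field: "\<Phi> \<in> l2_space lborel \<Longrightarrow> weak_field (kernel_field \<Phi>)"
  by (intro hs_fields_weak_field kernel_field_in_hs_fields)

lemma space_plancherel_measure: "space (plancherel_measure n) = - {0}"
  by (simp add: plancherel_measure_def space_restrict_space)

text \<open>Parseval writes the norm as a double series of squared matrix elements, each of which is measurable.\<close>

lemma hs_norm_sq_diff_measurable:
  fixes A B :: "real \<Rightarrow> 'n::finite op"
  assumes A: "weak_field A" and B: "weak_field B"
  shows "(\<lambda>s. hs_norm_sq (\<lambda>u \<xi>. A s u \<xi> - B s u \<xi>)) \<in> borel_measurable (plancherel_measure CARD('n))"
proof -
  let ?e = "the_basis :: nat \<Rightarrow> real^'n \<Rightarrow> complex"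
  have eq: "hs_norm_sq (\<lambda>u \<xi>. A s u \<xi> - B s u \<xi>) =
      (\<Sum>j. \<Sum>i. ennreal ((cmod (l2_inner lborel (A s (?e j)) (?e i) - l2_inner lborel (B s (?e j)) (?e i)))\<^sup>2))"
    if "s \<noteq> 0" for s
    unfolding hs_norm_sq_def
  proof (rule suminf_cong)
    fix j
    have a: "A s (?e j) \<in> l2_space lborel" and b: "B s (?e j) \<in> l2_space lborel"
      by (rule weak_field_l2[OF A that the_basis_in_l2], rule weak_field_l2[OF B that the_basis_in_l2])
    from orthonormal_parseval_ennreal[OF the_basis_orthonormal the_basis_spanning l2_space_diff[OF a b]]
    show "nn_sq lborel (\<lambda>\<xi>. A s (?e j) \<xi> - B s (?e j) \<xi>) =
        (\<Sum>i. ennreal ((cmod (l2_inner lborel (A s (?e j)) (?e i) - l2_inner lborel (B s (?e j)) (?e i)))\<^sup>2))"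
      by (simp add: l2_inner_diff_left[OF a b the_basis_in_l2])
  qed
  have [measurable]: "(\<lambda>s. l2_inner lborel (A s (?e j)) (?e i)) \<in> borel_measurable (plancherel_measure CARD('n))"
    "(\<lambda>s. l2_inner lborel (B s (?e j)) (?e i)) \<in> borel_measurable (plancherel_measure CARD('n))" for i j
    by (rule weak_field_measurable[OF A the_basis_in_l2 the_basis_in_l2], rule weak_field_measurable[OF B the_basis_in_l2 the_basis_in_l2])
  show ?thesis
    by (subst measurable_cong[OF eq]) (simp_all add: space_plancherel_measure)
qed

lemma hs_norm_sq_triangle:
  assumes L: "\<And>j. A (the_basis j) \<in> l2_space lborel" "\<And>j. B (the_basis j) \<in> l2_space lborel" "\<And>j. C (the_basis j) \<in> l2_space lborel"
  shows "hs_norm_sq (\<lambda>u \<xi>. A u \<xi> - C u \<xi>) \<le>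
    2 * hs_norm_sq (\<lambda>u \<xi>. B u \<xi> - A u \<xi>) + 2 * hs_norm_sq (\<lambda>u \<xi>. B u \<xi> - C u \<xi>)"
proof -
  have "nn_sq lborel (\<lambda>\<xi>. A (the_basis j) \<xi> - C (the_basis j) \<xi>) \<le>
      2 * nn_sq lborel (\<lambda>\<xi>. B (the_basis j) \<xi> - A (the_basis j) \<xi>) +
      2 * nn_sq lborel (\<lambda>\<xi>. B (the_basis j) \<xi> - C (the_basis j) \<xi>)" for j
  proof -
    note [measurable] = l2_measurable[OF L(1)[of j]] l2_measurable[OF L(2)[of j]] l2_measurable[OF L(3)[of j]]
    have *: "(cmod (a - c))\<^sup>2 \<le> 2 * (cmod (b - a))\<^sup>2 + 2 * (cmod (b - c))\<^sup>2" for a b c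
    proof -
      have "(cmod (a - c))\<^sup>2 \<le> (cmod (b - a) + cmod (b - c))\<^sup>2"
        using norm_triangle_ineq4[of "b - c" "b - a"] by (intro power_mono) (auto simp: add.commute)
      also have "\<dots> \<le> 2 * (cmod (b - a))\<^sup>2 + 2 * (cmod (b - c))\<^sup>2"
        using sum_squares_ge_zero[of "cmod (b - a) - cmod (b - c)" 0]
        by (simp add: power2_eq_square algebra_simps)
      finally show ?thesis .
    qed
    have "nn_sq lborel (\<lambda>\<xi>. A (the_basis j) \<xi> - C (the_basis j) \<xi>) \<le>
        (\<integral>\<^sup>+\<xi>. 2 * ennreal ((cmod (B (the_basis j) \<xi> - A (the_basis j) \<xi>))\<^sup>2) +
          2 * ennreal ((cmod (B (the_basis j) \<xi> - C (the_basis j) \<xi>))\<^sup>2) \<partial>lborel)"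
    proof (intro nn_integral_mono)
      fix \<xi>
      have "ennreal ((cmod (A (the_basis j) \<xi> - C (the_basis j) \<xi>))\<^sup>2) \<le>
          ennreal (2 * (cmod (B (the_basis j) \<xi> - A (the_basis j) \<xi>))\<^sup>2 + 2 * (cmod (B (the_basis j) \<xi> - C (the_basis j) \<xi>))\<^sup>2)"
        by (intro ennreal_leI *)
      thus "ennreal ((cmod (A (the_basis j) \<xi> - C (the_basis j) \<xi>))\<^sup>2) \<le>
          2 * ennreal ((cmod (B (the_basis j) \<xi> - A (the_basis j) \<xi>))\<^sup>2) + 2 * ennreal ((cmod (B (the_basis j) \<xi> - C (the_basis j) \<xi>))\<^sup>2)"
        by (simp add: ennreal_plus ennreal_mult)
    qed
    also have "\<dots> = 2 * nn_sq lborel (\<lambda>\<xi>. B (the_basis j) \<xi> - A (the_basis j) \<xi>) +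
        2 * nn_sq lborel (\<lambda>\<xi>. B (the_basis j) \<xi> - C (the_basis j) \<xi>)"
      by (simp add: nn_integral_add nn_integral_cmult)
    finally show ?thesis .
  qed
  hence "hs_norm_sq (\<lambda>u \<xi>. A u \<xi> - C u \<xi>) \<le>
      (\<Sum>j. 2 * nn_sq lborel (\<lambda>\<xi>. B (the_basis j) \<xi> - A (the_basis j) \<xi>) +
      2 * nn_sq lborel (\<lambda>\<xi>. B (the_basis j) \<xi> - C (the_basis j) \<xi>))"
    unfolding hs_norm_sq_def by (intro suminf_le summableI) auto
  thus ?thesis unfolding hs_norm_sq_def by (simp add: suminf_add[symmetric])
qed

lemma nn_integral_hs_norm_kernel_field_diff:
  fixes \<Phi> \<Psi> :: "'n::finite dual \<Rightarrow> complex"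
  assumes "\<Phi> \<in> l2_space lborel" "\<Psi> \<in> l2_space lborel"
  shows "(\<integral>\<^sup>+s. hs_norm_sq (\<lambda>u \<xi>. kernel_field \<Phi> s u \<xi> - kernel_field \<Psi> s u \<xi>) \<partial>plancherel_measure CARD('n)) =
    ennreal ((l2_norm lborel (\<lambda>q. \<Phi> q - \<Psi> q))\<^sup>2)"
proof -
  have "(\<integral>\<^sup>+s. hs_norm_sq (\<lambda>u \<xi>. kernel_field \<Phi> s u \<xi> - kernel_field \<Psi> s u \<xi>) \<partial>plancherel_measure CARD('n)) =
      (\<integral>\<^sup>+s. hs_norm_sq (kernel_field (\<lambda>q. \<Phi> q - \<Psi> q) s) \<partial>plancherel_measure CARD('n))"
    by (intro nn_integral_cong_AE AE_plancherel_measure AE_hs_norm_sq_kernel_field_diff assms)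
  also have "\<dots> = ennreal ((l2_norm lborel (\<lambda>q. \<Phi> q - \<Psi> q))\<^sup>2)"
    by (intro nn_integral_hs_norm_kernel_field l2_space_diff assms)
  finally show ?thesis .
qed

lemma nn_integral_fourier_L1_diff:
  fixes g :: "'n::finite heis \<Rightarrow> complex" and F :: "real \<Rightarrow> 'n op"
  assumes g: "integrable lborel g" "g \<in> l2_space lborel"
  shows "(\<integral>\<^sup>+s. hs_norm_sq (\<lambda>u \<xi>. fourier_L1 g s u \<xi> - F s u \<xi>) \<partial>plancherel_measure CARD('n)) =
    (\<integral>\<^sup>+s. hs_norm_sq (\<lambda>u \<xi>. kernel_field (part_ft (reorder g)) s u \<xi> - F s u \<xi>) \<partial>plancherel_measure CARD('n))"
proof (intro nn_integral_cong_AE AE_plancherel_measure, use fourier_L1_eq_kernel_field[OF g] in eventually_elim)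
  case (elim s)
  show ?case
  proof (rule hs_norm_sq_cong)
    fix j
    have "AE \<xi> in lborel. fourier_L1 g s (the_basis j) \<xi> = kernel_field (part_ft (reorder g)) s (the_basis j) \<xi>"
      using elim the_basis_in_l2 by blast
    thus "AE \<xi> in lborel. fourier_L1 g s (the_basis j) \<xi> - F s (the_basis j) \<xi> =
        kernel_field (part_ft (reorder g)) s (the_basis j) \<xi> - F s (the_basis j) \<xi>"
      by eventually_elim simp
  qed
qed

lemma ennreal_sq_tendsto_0: "(f \<longlongrightarrow> 0) F \<Longrightarrow> ((\<lambda>k. ennreal ((f k)\<^sup>2)) \<longlongrightarrow> 0) F"
proof -
  assume "(f \<longlongrightarrow> 0) F"
  hence "((\<lambda>k. ennreal ((f k)\<^sup>2)) \<longlongrightarrow> ennreal (0\<^sup>2)) F" by (intro tendsto_intros)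
  thus ?thesis by simp
qed

lemma is_fourier_L2_kernel_field:
  fixes f :: "'n::finite heis \<Rightarrow> complex"
  assumes f: "f \<in> l2_space lborel" and \<Phi>: "is_part_ft (reorder f) \<Phi>"
  shows "is_fourier_L2 f (kernel_field \<Phi>)"
proof -
  have \<Phi>L: "\<Phi> \<in> l2_space lborel" by (rule is_part_ft_in_l2[OF \<Phi>])
  obtain g where g: "L12_approx g f" using L12_approx_exists[OF f] .
  have gi: "integrable lborel (g k)" and gL: "g k \<in> l2_space lborel" for k
    using g by (auto simp: L12_approx_def l2_tendsto_def)
  have conv: "l2_tendsto lborel (\<lambda>k. part_ft (reorder (g k))) \<Phi>"
    using \<Phi> L12_approx_reorder[OF g] by (simp add: is_part_ft_def)
  have "(\<integral>\<^sup>+s. hs_norm_sq (\<lambda>u \<xi>. fourier_L1 (g k) s u \<xi> - kernel_field \<Phi> s u \<xi>) \<partial>plancherel_measure CARD('n)) =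
      ennreal ((l2_norm lborel (\<lambda>q. part_ft (reorder (g k)) q - \<Phi> q))\<^sup>2)" for k
    unfolding nn_integral_fourier_L1_diff[OF gi gL]
    by (rule nn_integral_hs_norm_kernel_field_diff[OF l2_tendstoD(1,2)[OF conv]])
  hence "(\<lambda>k. \<integral>\<^sup>+s. hs_norm_sq (\<lambda>u \<xi>. fourier_L1 (g k) s u \<xi> - kernel_field \<Phi> s u \<xi>) \<partial>plancherel_measure CARD('n)) \<longlonglongrightarrow> 0"
    using ennreal_sq_tendsto_0[OF l2_tendstoD(3)[OF conv]] by simp
  thus ?thesis unfolding is_fourier_L2_def
    using kernel_field_in_hs_fields[OF \<Phi>L] gi gL g by (auto simp: L12_approx_def l2_tendsto_def)
qed

text \<open>Both fields are limits of transforms of integrable functions, possibly along different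
  approximations. The corresponding kernels converge to the same limit, since the partial Euclidean
  transform does not depend on the approximation.\<close>

lemma is_fourier_L2_unique:
  fixes f :: "'n::finite heis \<Rightarrow> complex"
  assumes f: "f \<in> l2_space lborel" and \<Phi>: "is_part_ft (reorder f) \<Phi>" and F: "is_fourier_L2 f F"
  shows "AE s in lborel. s \<noteq> 0 \<and> (\<forall>j. F s (the_basis j) \<in> l2_space lborel) \<and>
    (\<forall>j. AE \<xi> in lborel. F s (the_basis j) \<xi> = kernel_field \<Phi> s (the_basis j) \<xi>)"
proof -
  let ?P = "plancherel_measure CARD('n)"
  have \<Phi>L: "\<Phi> \<in> l2_space lborel" by (rule is_part_ft_in_l2[OF \<Phi>])
  obtain g where g: "\<And>k. g k \<in> l2_space lborel" "\<And>k. integrable lborel (g k)"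
    "(\<lambda>k. l2_norm lborel (\<lambda>X. g k X - f X)) \<longlonglongrightarrow> 0"
    "(\<lambda>k. \<integral>\<^sup>+s. hs_norm_sq (\<lambda>u \<xi>. fourier_L1 (g k) s u \<xi> - F s u \<xi>) \<partial>?P) \<longlonglongrightarrow> 0"
    and FH: "F \<in> hs_fields"
    using F unfolding is_fourier_L2_def by blast
  have "L12_approx g f" using g f by (simp add: L12_approx_def l2_tendsto_def)
  hence conv: "l2_tendsto lborel (\<lambda>k. part_ft (reorder (g k))) \<Phi>"
    using \<Phi> L12_approx_reorder by (auto simp: is_part_ft_def)
  note W = hs_fields_weak_field[OF FH] kernel_field_weak_field[OF \<Phi>L] kernel_field_weak_field[OF l2_tendstoD(1)[OF conv]]
  have FL: "F s (the_basis j) \<in> l2_space lborel" if "s \<noteq> 0" for s j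
    by (rule weak_field_l2[OF W(1) that the_basis_in_l2])
  have le: "(\<integral>\<^sup>+s. hs_norm_sq (\<lambda>u \<xi>. F s u \<xi> - kernel_field \<Phi> s u \<xi>) \<partial>?P) \<le>
      2 * (\<integral>\<^sup>+s. hs_norm_sq (\<lambda>u \<xi>. fourier_L1 (g k) s u \<xi> - F s u \<xi>) \<partial>?P) +
      2 * ennreal ((l2_norm lborel (\<lambda>q. part_ft (reorder (g k)) q - \<Phi> q))\<^sup>2)" for k
  proof -
    let ?G = "kernel_field (part_ft (reorder (g k)))"
    have "(\<integral>\<^sup>+s. hs_norm_sq (\<lambda>u \<xi>. F s u \<xi> - kernel_field \<Phi> s u \<xi>) \<partial>?P) \<le>
        (\<integral>\<^sup>+s. 2 * hs_norm_sq (\<lambda>u \<xi>. ?G s u \<xi> - F s u \<xi>) + 2 * hs_norm_sq (\<lambda>u \<xi>. ?G s u \<xi> - kernel_field \<Phi> s u \<xi>) \<partial>?P)"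
    proof (intro nn_integral_mono hs_norm_sq_triangle)
      fix s j assume "s \<in> space ?P"
      hence s: "s \<noteq> 0" by (simp add: space_plancherel_measure)
      show "F s (the_basis j) \<in> l2_space lborel" by (rule FL[OF s])
      show "?G s (the_basis j) \<in> l2_space lborel" "kernel_field \<Phi> s (the_basis j) \<in> l2_space lborel"
        by (rule weak_field_l2[OF W(3) s the_basis_in_l2], rule weak_field_l2[OF W(2) s the_basis_in_l2])
    qed
    also have "\<dots> = 2 * (\<integral>\<^sup>+s. hs_norm_sq (\<lambda>u \<xi>. ?G s u \<xi> - F s u \<xi>) \<partial>?P) +
        2 * (\<integral>\<^sup>+s. hs_norm_sq (\<lambda>u \<xi>. ?G s u \<xi> - kernel_field \<Phi> s u \<xi>) \<partial>?P)"
      using hs_norm_sq_diff_measurable[OF W(3)[of k] W(1)] hs_norm_sq_diff_measurable[OF W(3)[of k] W(2)]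
      by (simp add: nn_integral_add nn_integral_cmult)
    finally show ?thesis
      unfolding nn_integral_fourier_L1_diff[OF g(2,1)] nn_integral_hs_norm_kernel_field_diff[OF l2_tendstoD(1,2)[OF conv]] .
  qed
  have "(\<lambda>k. 2 * (\<integral>\<^sup>+s. hs_norm_sq (\<lambda>u \<xi>. fourier_L1 (g k) s u \<xi> - F s u \<xi>) \<partial>?P) +
      2 * ennreal ((l2_norm lborel (\<lambda>q. part_ft (reorder (g k)) q - \<Phi> q))\<^sup>2)) \<longlonglongrightarrow> 2 * 0 + 2 * 0"
    using g(4) ennreal_sq_tendsto_0[OF l2_tendstoD(3)[OF conv]]
    by (intro tendsto_add ennreal_tendsto_cmult) auto
  hence "(\<integral>\<^sup>+s. hs_norm_sq (\<lambda>u \<xi>. F s u \<xi> - kernel_field \<Phi> s u \<xi>) \<partial>?P) \<le> 2 * 0 + 2 * 0"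
    by (rule LIMSEQ_le_const) (use le in auto)
  hence "(\<integral>\<^sup>+s. hs_norm_sq (\<lambda>u \<xi>. F s u \<xi> - kernel_field \<Phi> s u \<xi>) \<partial>?P) = 0" by simp
  hence "AE s in ?P. hs_norm_sq (\<lambda>u \<xi>. F s u \<xi> - kernel_field \<Phi> s u \<xi>) = 0"
    using hs_norm_sq_diff_measurable[OF W(1,2)] by (subst (asm) nn_integral_0_iff_AE) auto
  from AE_plancherel_measureD[OF this] AE_lborel_singleton[of "0 :: real"] show ?thesis
  proof eventually_elim
    case (elim s)
    have "AE \<xi> in lborel. F s (the_basis j) \<xi> = kernel_field \<Phi> s (the_basis j) \<xi>" for j
    proof -
      have a: "F s (the_basis j) \<in> l2_space lborel" by (rule FL[OF elim(2)])
      have b: "kernel_field \<Phi> s (the_basis j) \<in> l2_space lborel"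
        by (rule weak_field_l2[OF W(2) elim(2) the_basis_in_l2])
      note [measurable] = l2_measurable[OF a] l2_measurable[OF b]
      have "nn_sq lborel (\<lambda>\<xi>. F s (the_basis j) \<xi> - kernel_field \<Phi> s (the_basis j) \<xi>) \<le>
          hs_norm_sq (\<lambda>u \<xi>. F s u \<xi> - kernel_field \<Phi> s u \<xi>)"
        unfolding hs_norm_sq_def
        using sum_le_suminf[OF summableI, of "{j}" "\<lambda>j. nn_sq lborel (\<lambda>\<xi>. F s (the_basis j) \<xi> - kernel_field \<Phi> s (the_basis j) \<xi>)"]
        by simp
      hence "nn_sq lborel (\<lambda>\<xi>. F s (the_basis j) \<xi> - kernel_field \<Phi> s (the_basis j) \<xi>) = 0"
        using elim by simp
      thus ?thesis by (subst (asm) nn_integral_0_iff_AE) auto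
    qed
    thus ?case using elim FL by blast
  qed
qed

text \<open>The weight cancels the Jacobian of the kernel, leaving an inner product of slices.\<close>

lemma AE_hs_inner_fourier:
  fixes f g :: "'n::finite heis \<Rightarrow> complex"
  assumes f: "f \<in> l2_space lborel" and \<Phi>: "is_part_ft (reorder f) \<Phi>" and g: "g \<in> l2_space lborel" and \<Psi>: "is_part_ft (reorder g) \<Psi>"
  shows "AE s in lborel. hs_inner (fourier f s) (fourier g s) * complex_of_real (\<bar>s\<bar> ^ CARD('n)) =
    l2_inner lborel (slice \<Phi> s) (slice \<Psi> s)"
proof -
  have Ff: "is_fourier_L2 f (fourier f)" unfolding fourier_def by (rule someI[of "is_fourier_L2 f", OF is_fourier_L2_kernel_field[OF f \<Phi>]])
  have Fg: "is_fourier_L2 g (fourier g)" unfolding fourier_def by (rule someI[of "is_fourier_L2 g", OF is_fourier_L2_kernel_field[OF g \<Psi>]])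
  have L: "\<Phi> \<in> l2_space lborel" "\<Psi> \<in> l2_space lborel" using is_part_ft_in_l2 \<Phi> \<Psi> by blast+
  have m: "\<Phi> \<in> borel_measurable borel" "\<Psi> \<in> borel_measurable borel" using L l2_measurable by fastforce+
  show ?thesis
    using is_fourier_L2_unique[OF f \<Phi> Ff] is_fourier_L2_unique[OF g \<Psi> Fg] AE_slice_l2[OF L(1)] AE_slice_l2[OF L(2)]
  proof eventually_elim
    case (elim s)
    hence s: "s \<noteq> 0" by blast
    note K = twisted_kernel_l2(1)[OF m(1) elim(3) s] twisted_kernel_l2(1)[OF m(2) elim(4) s]
    have o: "kernel_field \<Phi> s = kernel_op (twisted_kernel \<Phi> s)" "kernel_field \<Psi> s = kernel_op (twisted_kernel \<Psi> s)" using s elim by (simp_all add: kernel_field_def)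
    have "hs_inner (fourier f s) (fourier g s) = hs_inner (kernel_op (twisted_kernel \<Phi> s)) (kernel_op (twisted_kernel \<Psi> s))"
      unfolding hs_inner_def
    proof (intro suminf_cong l2_inner_cong_AE)
      fix j
      show "AE \<xi> in lborel. fourier f s (the_basis j) \<xi> = kernel_op (twisted_kernel \<Phi> s) (the_basis j) \<xi>"
        "AE \<xi> in lborel. fourier g s (the_basis j) \<xi> = kernel_op (twisted_kernel \<Psi> s) (the_basis j) \<xi>"
        using elim(1,2) o by auto
      show "fourier f s (the_basis j) \<in> borel_measurable lborel" "fourier g s (the_basis j) \<in> borel_measurable lborel"
        using elim(1,2) l2_measurable by blast+
      show "kernel_op (twisted_kernel \<Phi> s) (the_basis j) \<in> borel_measurable lborel" "kernel_op (twisted_kernel \<Psi> s) (the_basis j) \<in> borel_measurable lborel"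
        by (rule l2_measurable[OF kernel_op_l2(1)[OF K(1) the_basis_in_l2]], rule l2_measurable[OF kernel_op_l2(1)[OF K(2) the_basis_in_l2]])
    qed
    thus ?case using hs_inner_kernel_op[OF K] twisted_kernel_inner[OF m elim(3,4) s] by simp
  qed
qed

section \<open>Periodization\<close>

lemma unit_box_real: "unit_box = {0<..1::real}"
  by (auto simp: unit_box_def)

lemma AE_unit_interval_iff: "(AE s in unit_interval. P s) \<longleftrightarrow> (AE s in torus. P s)"
  by (subst AE_restrict_space_iff) (auto simp: AE_torus unit_box_real)

lemma of_int_in_lattice [simp]: "real_of_int m \<in> lattice"
  by (simp add: lattice_def)

lemma distr_slice:
  "distr lborel borel (\<lambda>q::real \<times> (real^'n::finite) \<times> (real^'n). (fst (snd q), (snd (snd q), fst q))) = (lborel :: 'n dual measure)"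
proof (rule measure_eqI)
  let ?\<tau> = "\<lambda>q::real \<times> (real^'n) \<times> (real^'n). (fst (snd q), (snd (snd q), fst q))"
  fix A :: "'n dual set" assume "A \<in> sets (distr lborel borel ?\<tau>)"
  hence [measurable]: "A \<in> sets borel" by simp
  have "emeasure (distr lborel borel ?\<tau>) A = (\<integral>\<^sup>+X. indicator A X \<partial>distr lborel borel ?\<tau>)" by simp
  also have "\<dots> = (\<integral>\<^sup>+q. indicator A (?\<tau> q) \<partial>lborel)" by (subst nn_integral_distr) auto
  also have "\<dots> = (\<integral>\<^sup>+s. \<integral>\<^sup>+p. indicator A (fst p, (snd p, s)) \<partial>lborel \<partial>lborel)"
    by (subst nn_integral_lborel_pair) auto
  also have "\<dots> = (\<integral>\<^sup>+q. indicator A q \<partial>lborel)"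
    by (rule nn_integral_slice) measurable
  finally show "emeasure (distr lborel borel ?\<tau>) A = emeasure lborel A" by simp
qed simp

lemma slice_fubini:
  fixes H :: "'n::finite dual \<Rightarrow> complex"
  assumes H: "integrable lborel H"
  shows "integrable lborel (\<lambda>s. LINT p|lborel. slice H s p)"
    and "(LINT s|lborel. (LINT p|lborel. slice H s p)) = (LINT q|lborel. H q)"
proof -
  let ?\<tau> = "\<lambda>q::real \<times> (real^'n) \<times> (real^'n). (fst (snd q), (snd (snd q), fst q))"
  have [measurable]: "H \<in> borel_measurable borel" using borel_measurable_integrable[OF H] by simp
  have "integrable (distr lborel borel ?\<tau>) H" unfolding distr_slice by (rule H)
  from integrable_distr[OF _ this] have "integrable lborel (\<lambda>q. H (?\<tau> q))" by simp
  hence "integrable (lborel \<Otimes>\<^sub>M lborel) (case_prod (\<lambda>s p. slice H s p))"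
    by (simp add: lborel_prod slice_def case_prod_beta')
  from lborel_pair.integrable_fst[OF this] lborel_pair.integral_fst[OF this]
  show "integrable lborel (\<lambda>s. LINT p|lborel. slice H s p)"
    and "(LINT s|lborel. (LINT p|lborel. slice H s p)) = (LINT q|lborel. H q)"
    by (simp_all add: lborel_prod slice_def case_prod_beta',
        subst distr_slice[symmetric], subst integral_distr) auto
qed

lemma infsum_int_eq_suminf_lat:
  fixes h :: "real \<Rightarrow> complex"
  assumes "summable (\<lambda>n. cmod (h (s + lat n)))"
  shows "(\<Sum>\<^sub>\<infinity>r::int. h (s + real_of_int r)) = (\<Sum>n. h (s + lat n))"
proof -
  have fl: "real_of_int \<lfloor>lat n :: real\<rfloor> = lat n" for n
  proof -
    have "(lat n :: real) \<in> \<int>" using lat_in_lattice[of n, where 'a = real] by (simp add: lattice_def)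
    then obtain i where "(lat n :: real) = of_int i" by (rule Ints_cases)
    thus ?thesis by simp
  qed
  have bij: "bij_betw (\<lambda>n. \<lfloor>lat n :: real\<rfloor>) UNIV UNIV"
  proof (rule bij_betwI')
    fix m n show "(\<lfloor>lat m :: real\<rfloor> = \<lfloor>lat n :: real\<rfloor>) \<longleftrightarrow> m = n"
      using fl injD[OF bij_betw_imp_inj_on[OF bij_lat[where 'a = real]]] by metis
  next
    fix r :: int
    have "real_of_int r \<in> range (lat :: nat \<Rightarrow> real)" using bij_betw_imp_surj_on[OF bij_lat[where 'a = real]] by simp
    then obtain n where "real_of_int r = lat n" by blast
    thus "\<exists>n\<in>UNIV. r = \<lfloor>lat n :: real\<rfloor>" by (intro bexI[of _ n]) (simp_all flip: \<open>real_of_int r = lat n\<close>)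
  qed simp
  have "(\<Sum>\<^sub>\<infinity>r::int. h (s + real_of_int r)) = (\<Sum>\<^sub>\<infinity>n. h (s + real_of_int \<lfloor>lat n :: real\<rfloor>))"
    by (rule infsum_reindex_bij_betw[OF bij, symmetric])
  also have "\<dots> = (\<Sum>\<^sub>\<infinity>n. h (s + lat n))" by (simp only: fl)
  also have "\<dots> = (\<Sum>n. h (s + lat n))"
    by (intro infsumI norm_summable_imp_has_sum[OF assms] summable_sums summable_norm_cancel[OF assms])
  finally show ?thesis .
qed

lemma integrable_tile_suminf:
  fixes f :: "'a::euclidean_space \<Rightarrow> complex"
  assumes f: "integrable lborel f"
  shows "integrable torus (\<lambda>x. \<Sum>n. f (x + lat n))"
proof -
  have "integrable lborel (\<lambda>x. complex_of_real (cmod (f x)))" using f by simp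
  from integral_tile(2)[OF this]
  have "summable (\<lambda>n. LINT x|torus. complex_of_real (cmod (f (x + lat n))))" by (rule sums_summable)
  hence s: "summable (\<lambda>n. LINT x|torus. cmod (f (x + lat n)))"
    by (simp add: summable_complex_of_real)
  show ?thesis
    by (rule integrable_suminf[OF integral_tile(1)[OF f] integral_tile(3)[OF f] s])
qed

lemma AE_torus_all_translates:
  assumes "AE s in (lborel :: real measure). P s"
  shows "AE s in torus. \<forall>r::int. P (s + real_of_int r)"
proof -
  have "AE s in lborel. P (s + real_of_int r)" for r :: int
  proof -
    obtain N where N: "N \<in> null_sets lborel" "{s. \<not> P s} \<subseteq> N"
      using assms by (auto simp: eventually_ae_filter)
    have [measurable]: "N \<in> sets borel" using N(1) by auto
    have "emeasure lborel ((\<lambda>s. s + real_of_int r) -` N) = (\<integral>\<^sup>+s. indicator N (s + real_of_int r) \<partial>lborel)"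
      by (subst nn_integral_indicator[symmetric]) (auto simp: indicator_def intro!: nn_integral_cong measurable_sets_borel[of _ borel])
    also have "\<dots> = emeasure lborel N" by (subst nn_integral_lborel_translate) auto
    also have "\<dots> = 0" using N(1) by auto
    finally have "(\<lambda>s. s + real_of_int r) -` N \<in> null_sets lborel"
      by (intro null_setsI) (auto intro!: measurable_sets_borel[of _ borel])
    thus ?thesis by (rule AE_I') (use N(2) in auto)
  qed
  hence "AE s in lborel. \<forall>r::int. P (s + real_of_int r)" by (simp add: AE_all_countable)
  thus ?thesis by (rule AE_lborel_torus)
qed

lemma reorder_left_translate_central:
  "reorder (left_translate (0, 0, m) \<psi>) = (\<lambda>p. reorder \<psi> (p + (0, - (0, m))))"
  by (simp add: reorder_def left_translate_def fun_eq_iff)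

text \<open>The slice inner product \<open>h\<close> is integrable over the line, and \<open>g\<close> is its periodization. A coefficient of
  \<open>g\<close> is an integral of \<open>h\<close> against a character over the whole line, hence an inner product of \<open>\<Phi>\<close> with a
  modulation of \<open>\<Psi>\<close>, which is the transform of a central translate.\<close>

lemma fourier_periodization:
  fixes \<phi> \<psi> :: "'n::finite heis \<Rightarrow> complex"
  assumes \<phi>: "\<phi> \<in> l2_space lborel" and \<psi>: "\<psi> \<in> l2_space lborel"
  obtains g where "integrable torus g"
    "AE s in torus. (\<Sum>\<^sub>\<infinity>r::int. hs_inner (fourier \<phi> (s + real_of_int r)) (fourier \<psi> (s + real_of_int r)) *
        complex_of_real (\<bar>s + real_of_int r\<bar> ^ CARD('n))) = g s"
    "\<And>m::int. (LINT s|torus. g s * cnj (chr (real_of_int m) s)) = l2_inner lborel \<phi> (left_translate (0, 0, real_of_int m) \<psi>)"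
    "\<phi> = \<psi> \<Longrightarrow> AE s in torus. g s = complex_of_real (cmod (g s))"
proof -
  obtain \<Phi> where \<Phi>: "is_part_ft (reorder \<phi>) \<Phi>" using is_part_ft_exists[OF l2_space_reorder[OF \<phi>]] .
  obtain \<Psi> where \<Psi>: "is_part_ft (reorder \<psi>) \<Psi>" "\<phi> = \<psi> \<Longrightarrow> \<Phi> = \<Psi>"
    using is_part_ft_exists[OF l2_space_reorder[OF \<psi>]] \<Phi> by metis
  have [measurable]: "\<phi> \<in> borel_measurable borel" "\<psi> \<in> borel_measurable borel"
    using l2_measurable[OF \<phi>] l2_measurable[OF \<psi>] by simp_all
  have L: "\<Phi> \<in> l2_space lborel" "\<Psi> \<in> l2_space lborel" using is_part_ft_in_l2 \<Phi> \<Psi>(1) by blast+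
  have [measurable]: "\<Phi> \<in> borel_measurable borel" "\<Psi> \<in> borel_measurable borel"
    using l2_measurable[OF L(1)] l2_measurable[OF L(2)] by simp_all
  define h where "h = (\<lambda>s. l2_inner lborel (slice \<Phi> s) (slice \<Psi> s))"
  have h_eq: "h s = (LINT p|lborel. slice (\<lambda>q. \<Phi> q * cnj (\<Psi> q)) s p)" for s
    by (simp add: h_def l2_inner_def slice_def)
  have hi: "integrable lborel h"
    unfolding h_eq[abs_def] by (rule slice_fubini(1)[OF l2_integrable_inner[OF L]])
  have [measurable]: "h \<in> borel_measurable borel" using borel_measurable_integrable[OF hi] by simp
  define g where "g = (\<lambda>s. \<Sum>n. h (s + lat n))"
  note summ = integral_tile(3)[OF hi]
  show thesis
  proof (rule that[of g])
    show "integrable torus g" unfolding g_def by (rule integrable_tile_suminf[OF hi])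
    show "AE s in torus. (\<Sum>\<^sub>\<infinity>r::int. hs_inner (fourier \<phi> (s + real_of_int r)) (fourier \<psi> (s + real_of_int r)) *
        complex_of_real (\<bar>s + real_of_int r\<bar> ^ CARD('n))) = g s"
      using summ AE_torus_all_translates[OF AE_hs_inner_fourier[OF \<phi> \<Phi> \<psi> \<Psi>(1)]]
    proof eventually_elim
      case (elim s)
      have "(\<Sum>\<^sub>\<infinity>r::int. hs_inner (fourier \<phi> (s + real_of_int r)) (fourier \<psi> (s + real_of_int r)) *
        complex_of_real (\<bar>s + real_of_int r\<bar> ^ CARD('n))) = (\<Sum>\<^sub>\<infinity>r::int. h (s + real_of_int r))"
        using elim(2) by (intro infsum_cong) (simp add: h_def)
      also have "\<dots> = g s" unfolding g_def by (rule infsum_int_eq_suminf_lat[OF elim(1)])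
      finally show ?case .
    qed
    fix m :: int
    let ?m = "real_of_int m"
    obtain \<Psi>' where \<Psi>': "is_part_ft (\<lambda>p. reorder \<psi> (p + (0, - (0, ?m)))) \<Psi>'"
      "AE p in lborel. \<Psi>' p = chr (snd p) (0, ?m) * \<Psi> p"
      using is_part_ft_translate[OF \<Psi>(1)] .
    have [measurable]: "\<Psi>' \<in> borel_measurable borel" using l2_measurable[OF is_part_ft_in_l2[OF \<Psi>'(1)]] by simp
    have cL: "(\<lambda>p. chr (snd p) (0, ?m) * \<Psi> p) \<in> l2_space lborel"
      using L(2) by (intro l2_space_bounded_mult[where B = 1]) auto
    have [measurable]: "left_translate (0, 0, ?m) \<psi> \<in> borel_measurable borel"
      unfolding left_translate_def
    proof -
      have "(\<lambda>X. \<psi> (heis_mult (heis_inv (0, 0, ?m)) X)) = (\<lambda>X. \<psi> (fst X, fst (snd X), snd (snd X) - ?m))"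
        by (auto simp: fun_eq_iff)
      thus "(\<lambda>X. \<psi> (heis_mult (heis_inv (0, 0, ?m)) X)) \<in> borel_measurable borel" by simp
    qed
    have "l2_inner lborel \<phi> (left_translate (0, 0, ?m) \<psi>) = l2_inner lborel (reorder \<phi>) (reorder (left_translate (0, 0, ?m) \<psi>))"
      by (rule l2_inner_reorder[symmetric]) measurable
    also have "\<dots> = l2_inner lborel \<Phi> \<Psi>'"
      unfolding reorder_left_translate_central by (rule is_part_ft_inner[OF \<Phi> \<Psi>'(1)])
    also have "\<dots> = l2_inner lborel \<Phi> (\<lambda>p. chr (snd p) (0, ?m) * \<Psi> p)"
      using \<Psi>'(2) by (intro l2_inner_cong_AE) auto
    also have "\<dots> = (LINT s|lborel. (LINT p|lborel. slice (\<lambda>q. \<Phi> q * cnj (chr (snd q) (0, ?m) * \<Psi> q)) s p))"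
      unfolding l2_inner_def by (rule slice_fubini(2)[OF l2_integrable_inner[OF L(1) cL], symmetric])
    also have "\<dots> = (LINT s|lborel. h s * cnj (chr ?m s))"
    proof (rule Bochner_Integration.integral_cong[OF refl])
      fix s :: real
      have "slice (\<lambda>q. \<Phi> q * cnj (chr (snd q) (0, ?m) * \<Psi> q)) s p = slice (\<lambda>q. \<Phi> q * cnj (\<Psi> q)) s p * cnj (chr ?m s)" for p
        by (simp add: slice_def chr_def mult.commute)
      thus "(LINT p|lborel. slice (\<lambda>q. \<Phi> q * cnj (chr (snd q) (0, ?m) * \<Psi> q)) s p) = h s * cnj (chr ?m s)"
        unfolding h_eq by simp
    qed
    also have "\<dots> = (LINT s|lborel. h s * chr (- ?m) s)" by (simp add: cnj_chr)
    also have "\<dots> = (LINT s|torus. (\<Sum>n. h (s + lat n) * chr (- ?m) (s + lat n)))"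
      by (rule integral_tile_suminf[OF integrable_mult_chr[OF hi], symmetric])
    also have "\<dots> = (LINT s|torus. g s * cnj (chr ?m s))"
    proof (rule integral_cong_AE)
      show "AE s in torus. (\<Sum>n. h (s + lat n) * chr (- ?m) (s + lat n)) = g s * cnj (chr ?m s)"
        using summ
      proof eventually_elim
        case (elim s)
        have "chr (- ?m) (s + lat n) = cnj (chr ?m s)" for n
          by (simp add: chr_add_right cnj_chr chr_lattice lattice_uminus)
        thus ?case unfolding g_def
          using suminf_mult2[OF summable_norm_cancel[OF elim], of "cnj (chr ?m s)"] by simp
      qed
    qed (unfold g_def, measurable)
    finally show "(LINT s|torus. g s * cnj (chr ?m s)) = l2_inner lborel \<phi> (left_translate (0, 0, ?m) \<psi>)" ..
  next
    assume "\<phi> = \<psi>"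
    hence h_real: "h s = complex_of_real (cmod (h s))" for s
      using \<Psi>(2) by (simp add: h_def l2_inner_self norm_power)
    show "AE s in torus. g s = complex_of_real (cmod (g s))"
      using summ
    proof eventually_elim
      case (elim s)
      have "g s = (\<Sum>n. complex_of_real (cmod (h (s + lat n))))"
        unfolding g_def by (rule suminf_cong) (rule h_real)
      also have "\<dots> = complex_of_real (\<Sum>n. cmod (h (s + lat n)))"
        by (rule suminf_of_real[OF elim, symmetric])
      finally have g: "g s = complex_of_real (\<Sum>n. cmod (h (s + lat n)))" .
      have "0 \<le> (\<Sum>n. cmod (h (s + lat n)))" by (rule suminf_nonneg[OF elim]) simp
      thus ?case unfolding g by simp
    qed
  qed
qed

section \<open>The Gram matrix of the translates\<close>

lemma heis_mult_assoc: "heis_mult (heis_mult a b) c = heis_mult a (heis_mult b c)"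
  by (cases a; cases b; cases c) (simp add: inner_add_left inner_add_right algebra_simps add_divide_distrib diff_divide_distrib)

lemma heis_mult_zero [simp]: "heis_mult (0, 0, 0) X = X"
  by (cases X) simp

lemma heis_inv_mult: "heis_inv (heis_mult a b) = heis_mult (heis_inv b) (heis_inv a)"
  by (cases a; cases b) (simp add: inner_commute algebra_simps diff_divide_distrib)

lemma left_translate_mult: "left_translate a (left_translate b f) = left_translate (heis_mult a b) f"
  by (simp add: left_translate_def heis_inv_mult heis_mult_assoc)

lemma left_translate_zero [simp]: "left_translate (0, 0, 0) f = f"
  using heis_mult_zero by (auto simp: left_translate_def fun_eq_iff)

lemma heis_mult_measurable [measurable]: "heis_mult h \<in> borel_measurable borel"
proof (cases h)
  case (fields a b c)
  have "heis_mult h = (\<lambda>X. (a + fst X, b + fst (snd X), c + snd (snd X) + (fst X \<bullet> b - fst (snd X) \<bullet> a) / 2))"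
    by (auto simp: fields fun_eq_iff)
  thus ?thesis by simp
qed

text \<open>A left translation is a composition of translations and a shear, so it preserves Lebesgue measure.\<close>

lemma distr_heis_mult: "distr lborel borel (heis_mult h) = (lborel :: 'n::finite heis measure)"
proof (rule measure_eqI)
  obtain a b c where h: "h = (a, b, c)" by (cases h)
  fix A :: "'n heis set" assume "A \<in> sets (distr lborel borel (heis_mult h))"
  hence [measurable]: "A \<in> sets borel" by simp
  let ?I = "indicator A :: 'n heis \<Rightarrow> ennreal"
  have "emeasure (distr lborel borel (heis_mult h)) A = (\<integral>\<^sup>+X. ?I X \<partial>distr lborel borel (heis_mult h))" by simp
  also have "\<dots> = (\<integral>\<^sup>+X. ?I (heis_mult h X) \<partial>lborel)" by (subst nn_integral_distr) auto
  also have "\<dots> = (\<integral>\<^sup>+x. \<integral>\<^sup>+w. ?I (heis_mult h (x, w)) \<partial>lborel \<partial>lborel)"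
    by (rule nn_integral_lborel_pair) measurable
  also have "\<dots> = (\<integral>\<^sup>+x. \<integral>\<^sup>+y. \<integral>\<^sup>+t. ?I (heis_mult h (x, (y, t))) \<partial>lborel \<partial>lborel \<partial>lborel)"
    by (intro nn_integral_cong nn_integral_lborel_pair) measurable
  also have "\<dots> = (\<integral>\<^sup>+x. \<integral>\<^sup>+y. \<integral>\<^sup>+t. ?I (x + a, y + b, t + (c + (x \<bullet> b - y \<bullet> a) / 2)) \<partial>lborel \<partial>lborel \<partial>lborel)"
    by (simp add: h add_ac)
  also have "\<dots> = (\<integral>\<^sup>+x. \<integral>\<^sup>+y. \<integral>\<^sup>+t. ?I (x + a, y + b, t) \<partial>lborel \<partial>lborel \<partial>lborel)"
    by (intro nn_integral_cong nn_integral_lborel_translate) measurable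
  also have "\<dots> = (\<integral>\<^sup>+x. \<integral>\<^sup>+y. \<integral>\<^sup>+t. ?I (x + a, y, t) \<partial>lborel \<partial>lborel \<partial>lborel)"
    by (intro nn_integral_cong nn_integral_lborel_translate) measurable
  also have "\<dots> = (\<integral>\<^sup>+x. \<integral>\<^sup>+y. \<integral>\<^sup>+t. ?I (x, y, t) \<partial>lborel \<partial>lborel \<partial>lborel)"
    by (rule nn_integral_lborel_translate) measurable
  also have "\<dots> = (\<integral>\<^sup>+x. \<integral>\<^sup>+w. ?I (x, w) \<partial>lborel \<partial>lborel)"
    by (intro nn_integral_cong nn_integral_lborel_pair[symmetric]) measurable
  also have "\<dots> = (\<integral>\<^sup>+X. ?I X \<partial>lborel)"
    by (rule nn_integral_lborel_pair[symmetric]) measurable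
  finally show "emeasure (distr lborel borel (heis_mult h)) A = emeasure lborel A" by simp
qed simp

lemma integral_left_translate:
  fixes f :: "'n::finite heis \<Rightarrow> 'c::{banach, second_countable_topology}"
  assumes [measurable]: "f \<in> borel_measurable borel"
  shows "(LINT X|lborel. f (heis_mult h X)) = (LINT X|lborel. f X)"
  by (subst (2) distr_heis_mult[of h, symmetric], subst integral_distr) auto

lemma l2_space_left_translate:
  fixes f :: "'n::finite heis \<Rightarrow> complex"
  assumes f: "f \<in> l2_space lborel"
  shows "left_translate h f \<in> l2_space lborel"
proof -
  have [measurable]: "f \<in> borel_measurable borel" using l2_measurable[OF f] by simp
  have "integrable (distr lborel borel (heis_mult (heis_inv h))) (\<lambda>X. (cmod (f X))\<^sup>2)"
    unfolding distr_heis_mult by (rule l2_integrable_sq[OF f])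
  from integrable_distr[OF _ this] show ?thesis by (simp add: l2_space_def left_translate_def)
qed

lemma l2_inner_left_translate:
  fixes f g :: "'n::finite heis \<Rightarrow> complex"
  assumes [measurable]: "f \<in> borel_measurable borel" "g \<in> borel_measurable borel"
  shows "l2_inner lborel (left_translate h f) (left_translate h g) = l2_inner lborel f g"
  unfolding l2_inner_def left_translate_def
  by (rule integral_left_translate[of "\<lambda>X. f X * cnj (g X)"]) measurable

lemma l2_norm_left_translate:
  fixes f :: "'n::finite heis \<Rightarrow> complex"
  assumes [measurable]: "f \<in> borel_measurable borel"
  shows "l2_norm lborel (left_translate h f) = l2_norm lborel f"
  unfolding l2_norm_def left_translate_def
  by (subst integral_left_translate[of "\<lambda>X. (cmod (f X))\<^sup>2"]) auto

lemma translates_l2: "\<phi> \<in> l2_space lborel \<Longrightarrow> translates \<phi> j \<in> l2_space lborel"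
  by (cases j) (simp add: l2_space_left_translate)

lemma of_int_vec_inner: "of_int_vec k \<bullet> of_int_vec l = real_of_int (\<Sum>i\<in>UNIV. k $ i * l $ i)"
  by (simp add: of_int_vec_def inner_vec_def)

lemma of_int_vec_diff: "of_int_vec (k - l) = of_int_vec k - of_int_vec l"
  by (simp add: of_int_vec_def vec_eq_iff)

lemma of_int_vec_zero [simp]: "of_int_vec 0 = 0"
  by (simp add: of_int_vec_def vec_eq_iff)

text \<open>Because of the factor 2 in the first coordinate, the points \<open>(2k, l, m)\<close> form a subgroup, and the
  quotient of two of them is a central integer translation followed by a translation in \<open>(2k, l, 0)\<close>.\<close>

lemma translates_quotient:
  fixes \<phi> :: "'n::finite heis \<Rightarrow> complex"
  assumes \<phi>: "\<phi> \<in> l2_space lborel"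
  shows "l2_inner lborel (translates \<phi> (k, l, m)) (translates \<phi> (k', l', m')) =
    l2_inner lborel \<phi> (left_translate (0, 0, real_of_int (m' - m + (\<Sum>i\<in>UNIV. k $ i * l' $ i) - (\<Sum>i\<in>UNIV. k' $ i * l $ i)))
      (translates \<phi> (k' - k, l' - l, 0)))"
proof -
  have [measurable]: "\<phi> \<in> borel_measurable borel" using l2_measurable[OF \<phi>] by simp
  let ?\<gamma> = "(2 *\<^sub>R of_int_vec k, of_int_vec l, real_of_int m)" and ?\<gamma>' = "(2 *\<^sub>R of_int_vec k', of_int_vec l', real_of_int m')"
  let ?N = "real_of_int (m' - m + (\<Sum>i\<in>UNIV. k $ i * l' $ i) - (\<Sum>i\<in>UNIV. k' $ i * l $ i))"
  have [measurable]: "left_translate h \<phi> \<in> borel_measurable borel" for h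
    using l2_measurable[OF l2_space_left_translate[OF \<phi>]] by simp
  have "l2_inner lborel (translates \<phi> (k, l, m)) (translates \<phi> (k', l', m')) =
      l2_inner lborel (left_translate (heis_inv ?\<gamma>) (left_translate ?\<gamma> \<phi>)) (left_translate (heis_inv ?\<gamma>) (left_translate ?\<gamma>' \<phi>))"
    unfolding translates.simps by (rule l2_inner_left_translate[symmetric]) measurable
  also have "left_translate (heis_inv ?\<gamma>) (left_translate ?\<gamma> \<phi>) = \<phi>"
    unfolding left_translate_mult heis_mult_inv(2) by simp
  also have "left_translate (heis_inv ?\<gamma>) (left_translate ?\<gamma>' \<phi>) = left_translate (heis_mult (heis_inv ?\<gamma>) ?\<gamma>') \<phi>"
    by (rule left_translate_mult)
  also have "heis_mult (heis_inv ?\<gamma>) ?\<gamma>' = heis_mult (0, 0, ?N) (2 *\<^sub>R of_int_vec (k' - k), of_int_vec (l' - l), real_of_int 0)"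
  proof -
    have "of_int_vec l' \<bullet> of_int_vec k = real_of_int (\<Sum>i\<in>UNIV. k $ i * l' $ i)"
      "of_int_vec k' \<bullet> of_int_vec l = real_of_int (\<Sum>i\<in>UNIV. k' $ i * l $ i)"
      unfolding of_int_vec_inner by (simp_all add: mult.commute)
    thus ?thesis by (simp add: of_int_vec_diff scaleR_diff_right)
  qed
  finally show ?thesis by (simp add: left_translate_mult)
qed

text \<open>The Gram matrix depends on the quotient of two lattice points. Its entries are Fourier coefficients
  of the functions \<open>G\<^bsub>k,l\<^esub>\<close>, and condition C removes those with \<open>(k,l) \<noteq> (0,0)\<close>. The modulus of the
  periodization serves as a Borel version of \<open>G\<^bsub>0,0\<^esub>\<close>.\<close>

lemma translates_gram:
  fixes \<phi> :: "'n::finite heis \<Rightarrow> complex"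
  assumes \<phi>: "\<phi> \<in> l2_space lborel" and C: "condition_C \<phi>"
  obtains W :: "real \<Rightarrow> real" where "\<And>s. 0 \<le> W s" "integrable torus W"
    "AE s in torus. G00 \<phi> s = ennreal (W s)"
    "\<And>k l m k' l' m'. l2_inner lborel (translates \<phi> (k, l, m)) (translates \<phi> (k', l', m')) =
      (if k = k' \<and> l = l' then LINT s|torus. complex_of_real (W s) * (chr (real_of_int m) s * cnj (chr (real_of_int m') s)) else 0)"
proof -
  obtain g where g: "integrable torus g" "AE s in torus. G \<phi> 0 0 s = g s"
    "\<And>m::int. (LINT s|torus. g s * cnj (chr (real_of_int m) s)) = l2_inner lborel \<phi> (left_translate (0, 0, real_of_int m) \<phi>)"
    "AE s in torus. g s = complex_of_real (cmod (g s))"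
    using fourier_periodization[OF \<phi> \<phi>] unfolding G_def by auto
  have gm [measurable]: "g \<in> borel_measurable borel" using borel_measurable_integrable[OF g(1)] by simp
  show thesis
  proof (rule that[of "\<lambda>s. cmod (g s)"])
    show "integrable torus (\<lambda>s. cmod (g s))" using g(1) by simp
    show "AE s in torus. G00 \<phi> s = ennreal (cmod (g s))" using g(2) by eventually_elim (simp add: G00_def)
    fix k l :: "int^'n" and m and k' l' :: "int^'n" and m'
    show "l2_inner lborel (translates \<phi> (k, l, m)) (translates \<phi> (k', l', m')) =
      (if k = k' \<and> l = l' then LINT s|torus. complex_of_real (cmod (g s)) * (chr (real_of_int m) s * cnj (chr (real_of_int m') s)) else 0)"
    proof (cases "k = k' \<and> l = l'")
      case True
      have "l2_inner lborel (translates \<phi> (k, l, m)) (translates \<phi> (k', l', m')) =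
          (LINT s|torus. g s * cnj (chr (real_of_int (m' - m)) s))"
        unfolding translates_quotient[OF \<phi>] g(3) using True by simp
      also have "\<dots> = (LINT s|torus. complex_of_real (cmod (g s)) * (chr (real_of_int m) s * cnj (chr (real_of_int m') s)))"
      proof (rule integral_cong_AE)
        have "cnj (chr (real_of_int (m' - m)) s) = chr (real_of_int m) s * cnj (chr (real_of_int m') s)" for s
          unfolding cnj_chr chr_add[symmetric] by simp
        thus "AE s in torus. g s * cnj (chr (real_of_int (m' - m)) s) =
            complex_of_real (cmod (g s)) * (chr (real_of_int m) s * cnj (chr (real_of_int m') s))"
          using g(4) by auto
      qed measurable
      finally show ?thesis using True by simp
    next
      case False
      let ?\<psi> = "translates \<phi> (k' - k, l' - l, 0)"
      obtain f where f: "integrable torus f" "AE s in torus. G \<phi> (k' - k) (l' - l) s = f s"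
        "\<And>m::int. (LINT s|torus. f s * cnj (chr (real_of_int m) s)) = l2_inner lborel \<phi> (left_translate (0, 0, real_of_int m) ?\<psi>)"
        using fourier_periodization[OF \<phi> translates_l2[OF \<phi>, of "(k' - k, l' - l, 0)"]] unfolding G_def by blast
      have "(k' - k, l' - l) \<noteq> (0, 0)" using False by auto
      hence "AE s in torus. G \<phi> (k' - k) (l' - l) s = 0"
        using C unfolding condition_C_def AE_unit_interval_iff by blast
      hence f0: "AE s in torus. f s = 0" using f(2) by eventually_elim simp
      have [measurable]: "f \<in> borel_measurable borel" using borel_measurable_integrable[OF f(1)] by simp
      have "(LINT s|torus. f s * cnj (chr (real_of_int N) s)) = (LINT s|(torus :: real measure). 0)" for N
        using f0 by (intro integral_cong_AE) auto
      thus ?thesis unfolding translates_quotient[OF \<phi>] f(3)[symmetric] by (simp only: False if_False Bochner_Integration.integral_zero)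
    qed
  qed simp
qed

section \<open>Essential boundedness by duality\<close>

text \<open>If \<open>v\<close> is unbounded, each set \<open>A\<^sub>n\<close> where \<open>v > 4\<^sup>n\<close> has positive measure. The density that puts mass
  \<open>2\<^sup>-\<^sup>n\<close> on \<open>A\<^sub>n\<close> is integrable, but its integral against \<open>v\<close> is at least \<open>\<Sum> 2\<^sup>n\<close>.\<close>

lemma AE_bounded_by_duality:
  fixes v :: "'a \<Rightarrow> ennreal"
  assumes fin: "finite_measure M" and v [measurable]: "v \<in> borel_measurable M"
    and dual: "\<And>q. q \<in> borel_measurable M \<Longrightarrow> (\<integral>\<^sup>+x. q x \<partial>M) < \<infinity> \<Longrightarrow> (\<integral>\<^sup>+x. q x * v x \<partial>M) < \<infinity>"
  shows "\<exists>B::real. AE x in M. v x \<le> ennreal B"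
proof (rule ccontr)
  interpret finite_measure M by (fact fin)
  assume no: "\<not> ?thesis"
  define A where "A = (\<lambda>n::nat. {x \<in> space M. v x > ennreal (4 ^ n)})"
  have [measurable]: "A n \<in> sets M" for n unfolding A_def by measurable
  define c where "c = (\<lambda>n. 1 / (2 ^ n * measure M (A n)))"
  have pos: "measure M (A n) > 0" for n
  proof -
    have "\<not> (AE x in M. v x \<le> ennreal (4 ^ n))" using no by blast
    hence "emeasure M (A n) \<noteq> 0"
      by (subst (asm) AE_iff_measurable[OF _ refl]) (auto simp: A_def not_le)
    thus ?thesis by (simp add: emeasure_eq_measure zero_less_measure_iff)
  qed
  define q where "q = (\<lambda>x. \<Sum>n. ennreal (c n) * indicator (A n) x)"
  have [measurable]: "q \<in> borel_measurable M" unfolding q_def by measurable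
  have c: "c n > 0" "c n * measure M (A n) = (1/2) ^ n" for n
    using pos[of n] by (simp_all add: c_def power_one_over)
  have "(\<integral>\<^sup>+x. q x \<partial>M) = (\<Sum>n. \<integral>\<^sup>+x. ennreal (c n) * indicator (A n) x \<partial>M)"
    unfolding q_def by (rule nn_integral_suminf) measurable
  also have "\<dots> = (\<Sum>n. ennreal ((1/2) ^ n))"
    using c by (intro suminf_cong) (simp add: nn_integral_cmult_indicator emeasure_eq_measure ennreal_mult'[symmetric] less_imp_le)
  also have "\<dots> = ennreal (\<Sum>n. (1/2) ^ n)"
    by (rule suminf_ennreal2) (auto intro: summable_geometric)
  also have "\<dots> < \<infinity>" by simp
  finally have "(\<integral>\<^sup>+x. q x * v x \<partial>M) < \<infinity>" by (intro dual) auto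
  moreover have "(\<integral>\<^sup>+x. q x * v x \<partial>M) \<ge> ennreal (real N)" for N
  proof -
    have "ennreal (real N) = (\<Sum>n<N. 1)" by (simp add: ennreal_of_nat_eq_real_of_nat)
    also have "\<dots> \<le> (\<Sum>n<N. ennreal (2 ^ n))" by (intro sum_mono) (simp add: ennreal_ge_1)
    also have "\<dots> = (\<Sum>n<N. \<integral>\<^sup>+x. ennreal (c n * 4 ^ n) * indicator (A n) x \<partial>M)"
    proof (rule sum.cong)
      fix n
      have "c n * 4 ^ n * measure M (A n) = (1/2) ^ n * 4 ^ n" unfolding c(2)[symmetric] by simp
      also have "\<dots> = (2::real) ^ n" by (simp flip: power_mult_distrib)
      finally show "ennreal (2 ^ n) = (\<integral>\<^sup>+x. ennreal (c n * 4 ^ n) * indicator (A n) x \<partial>M)"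
        using c(1)[of n] by (simp add: nn_integral_cmult_indicator emeasure_eq_measure ennreal_mult'[symmetric] less_imp_le)
    qed simp
    also have "\<dots> = (\<integral>\<^sup>+x. (\<Sum>n<N. ennreal (c n * 4 ^ n) * indicator (A n) x) \<partial>M)"
      by (rule nn_integral_sum[symmetric]) measurable
    also have "\<dots> \<le> (\<integral>\<^sup>+x. q x * v x \<partial>M)"
    proof (intro nn_integral_mono)
      fix x assume x: "x \<in> space M"
      have "(\<Sum>n<N. ennreal (c n * 4 ^ n) * indicator (A n) x) \<le> (\<Sum>n<N. ennreal (c n) * indicator (A n) x * v x)"
        using c(1) by (intro sum_mono) (auto simp: indicator_def A_def ennreal_mult less_imp_le intro!: mult_left_mono)
      also have "\<dots> = (\<Sum>n<N. ennreal (c n) * indicator (A n) x) * v x" by (rule sum_distrib_right[symmetric])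
      also have "\<dots> \<le> q x * v x"
        unfolding q_def by (intro mult_right_mono sum_le_suminf) (auto intro: summableI)
      finally show "(\<Sum>n<N. ennreal (c n * 4 ^ n) * indicator (A n) x) \<le> q x * v x" .
    qed
    finally show ?thesis .
  qed
  ultimately show False
  proof -
    assume f: "(\<integral>\<^sup>+x. q x * v x \<partial>M) < \<infinity>" and g: "\<And>N. ennreal (real N) \<le> (\<integral>\<^sup>+x. q x * v x \<partial>M)"
    obtain r where r: "r \<ge> 0" "(\<integral>\<^sup>+x. q x * v x \<partial>M) = ennreal r"
      using f by (cases "\<integral>\<^sup>+x. q x * v x \<partial>M") auto
    obtain N where "r < real N" using reals_Archimedean2 by blast
    thus False using g[of N] r by (simp add: ennreal_le_iff)
  qed
qed

section \<open>Families over the integer lattice\<close>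

lemma finite_cube: "finite (cube N :: ('n::finite) idx set)"
proof -
  let ?V = "{k :: int^'n. \<forall>i. \<bar>k $ i\<bar> \<le> int N}"
  have "?V \<subseteq> vec_lambda ` (PiE UNIV (\<lambda>_. {- int N..int N}))"
  proof
    fix k assume "k \<in> ?V"
    hence "vec_nth k \<in> PiE UNIV (\<lambda>_. {- int N..int N})" by (auto simp: abs_le_iff)
      (smt (verit) abs_le_iff)+
    thus "k \<in> vec_lambda ` (PiE UNIV (\<lambda>_. {- int N..int N}))"
      by (intro image_eqI[of _ _ "vec_nth k"]) auto
  qed
  hence V: "finite ?V" by (rule finite_subset) (intro finite_imageI finite_PiE, auto)
  have "cube N \<subseteq> ?V \<times> ?V \<times> {- int N..int N}" by (auto simp: cube_def)
  thus ?thesis by (rule finite_subset) (intro finite_cartesian_product V, auto)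
qed

lemma cube_mono: "M \<le> N \<Longrightarrow> cube M \<subseteq> cube N"
proof -
  assume "M \<le> N"
  hence MN: "int M \<le> int N" by simp
  show ?thesis by (auto simp: cube_def intro: order_trans[OF _ MN])
qed

lemma finite_subset_cube:
  assumes "finite (F :: ('n::finite) idx set)"
  obtains N where "F \<subseteq> cube N"
proof -
  have "\<exists>N. j \<in> cube N" for j :: "'n idx"
  proof -
    obtain k l m where j: "j = (k, l, m)" by (cases j)
    let ?S = "range (\<lambda>i. nat \<bar>k $ i\<bar>) \<union> range (\<lambda>i. nat \<bar>l $ i\<bar>) \<union> {nat \<bar>m\<bar>}"
    have "x \<le> Max ?S" if "x \<in> ?S" for x using that by (intro Max_ge) auto
    hence "nat \<bar>k $ i\<bar> \<le> Max ?S" "nat \<bar>l $ i\<bar> \<le> Max ?S" "nat \<bar>m\<bar> \<le> Max ?S" for i by auto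
    hence "j \<in> cube (Max ?S)" by (auto simp: cube_def j nat_le_iff simp del: Max_insert)
    thus ?thesis by blast
  qed
  then obtain n :: "'n idx \<Rightarrow> nat" where n: "\<And>j :: 'n idx. j \<in> cube (n j)" by metis
  have "F \<subseteq> cube (Max (insert 0 (n ` F)))"
  proof
    fix j assume "j \<in> F"
    hence "n j \<le> Max (insert 0 (n ` F))" using assms by (intro Max_ge) auto
    thus "j \<in> cube (Max (insert 0 (n ` F)))" using n cube_mono by blast
  qed
  thus thesis by (rule that)
qed

lemma summable_on_if_cube_bounded:
  fixes f :: "('n::finite) idx \<Rightarrow> real"
  assumes nn: "\<And>j. f j \<ge> 0" and B: "\<And>N. (\<Sum>j\<in>cube N. f j) \<le> B"
  shows "f summable_on UNIV" and "(\<Sum>\<^sub>\<infinity>j. f j) \<le> B"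
proof -
  have le: "sum f F \<le> B" if F: "finite F" for F
  proof -
    obtain N where "F \<subseteq> cube N" using finite_subset_cube[OF F] .
    hence "sum f F \<le> (\<Sum>j\<in>cube N. f j)" by (intro sum_mono2 finite_cube nn)
    thus ?thesis using B[of N] by linarith
  qed
  show s: "f summable_on UNIV"
    by (rule nonneg_bdd_above_summable_on) (auto intro!: bdd_aboveI2[where M = B] nn le)
  show "(\<Sum>\<^sub>\<infinity>j. f j) \<le> B" by (rule infsum_le_finite_sums[OF s]) (auto intro: le)
qed

definition lincomb :: "('n::finite idx \<Rightarrow> 'a \<Rightarrow> complex) \<Rightarrow> ('n idx \<Rightarrow> complex) \<Rightarrow> nat \<Rightarrow> 'a \<Rightarrow> complex" where
  "lincomb f c N x = (\<Sum>j\<in>cube N. c j * f j x)"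

lemma lincomb_l2: "(\<And>j. f j \<in> l2_space M) \<Longrightarrow> lincomb f c N \<in> l2_space M"
  unfolding lincomb_def by (intro l2_space_lincomb)

lemma l2_sums_iff_tendsto:
  assumes "\<And>j. f j \<in> l2_space M"
  shows "l2_sums M f c s \<longleftrightarrow> l2_tendsto M (lincomb f c) s"
  using lincomb_l2[of f M, OF assms] by (simp add: l2_sums_def l2_tendsto_def lincomb_def)

text \<open>An upper bound for the synthesis operator, tested on the cubes: every finite set of indices lies in one.\<close>

definition riesz_upper :: "'a measure \<Rightarrow> ('n::finite idx \<Rightarrow> 'a \<Rightarrow> complex) \<Rightarrow> real \<Rightarrow> bool" where
  "riesz_upper M f B \<longleftrightarrow> (\<forall>c N. (l2_norm M (lincomb f c N))\<^sup>2 \<le> B * (\<Sum>j\<in>cube N. (cmod (c j))\<^sup>2))"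

context
  fixes M :: "'a measure" and f :: "'n::finite idx \<Rightarrow> 'a \<Rightarrow> complex"
  assumes fL: "\<And>j. f j \<in> l2_space M"
begin

lemma lincomb_diff:
  assumes "N \<le> N'"
  shows "lincomb f c N' x - lincomb f c N x = lincomb f (\<lambda>j. if j \<in> cube N then 0 else c j) N' x"
proof -
  have "lincomb f c N x = (\<Sum>j\<in>cube N'. (if j \<in> cube N then c j else 0) * f j x)"
    unfolding lincomb_def using cube_mono[OF assms]
    by (intro sum.mono_neutral_cong_left finite_cube) auto
  thus ?thesis unfolding lincomb_def sum_subtractf[symmetric] left_diff_distrib[symmetric]
    by (auto simp: sum_subtractf[symmetric] intro!: sum.cong)
qed

lemma riesz_upper_hilbertian:
  assumes B: "riesz_upper M f B" "B > 0"
  shows "hilbertian M f"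
  unfolding hilbertian_def
proof (intro allI impI)
  fix c :: "'n idx \<Rightarrow> complex" assume "c \<in> ell2"
  hence summ: "(\<lambda>j. (cmod (c j))\<^sup>2) summable_on UNIV" by (simp add: ell2_def)
  define t where "t = (\<lambda>N. \<Sum>j\<in>cube N. (cmod (c j))\<^sup>2)"
  have t_mono: "incseq t" unfolding t_def
    by (intro incseq_SucI sum_mono2 finite_cube cube_mono) auto
  have "t N \<le> (\<Sum>\<^sub>\<infinity>j. (cmod (c j))\<^sup>2)" for N
    unfolding t_def by (intro finite_sum_le_infsum summ finite_cube) auto
  then obtain l where "t \<longlonglongrightarrow> l" using incseq_convergent[OF t_mono] by blast
  hence cau: "Cauchy t" by (rule LIMSEQ_imp_Cauchy)
  have key: "(l2_norm M (\<lambda>x. lincomb f c N' x - lincomb f c N x))\<^sup>2 \<le> B * (t N' - t N)" if "N \<le> N'" for N N'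
  proof -
    have "(l2_norm M (\<lambda>x. lincomb f c N' x - lincomb f c N x))\<^sup>2 \<le>
        B * (\<Sum>j\<in>cube N'. (cmod (if j \<in> cube N then 0 else c j))\<^sup>2)"
      unfolding lincomb_diff[OF that] using B(1) unfolding riesz_upper_def by blast
    also have "(\<Sum>j\<in>cube N'. (cmod (if j \<in> cube N then 0 else c j))\<^sup>2) = (\<Sum>j\<in>cube N' - cube N. (cmod (c j))\<^sup>2)"
      by (rule sum.mono_neutral_cong_right) (auto simp: finite_cube)
    also have "\<dots> = t N' - t N"
      unfolding t_def by (rule sum_diff[OF finite_cube cube_mono[OF that]])
    finally show ?thesis .
  qed
  obtain s where "l2_tendsto M (lincomb f c) s"
  proof (rule l2_complete)
    show "lincomb f c n \<in> l2_space M" for n by (rule lincomb_l2[OF fL])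
    fix \<epsilon> :: real assume e: "\<epsilon> > 0"
    hence "\<epsilon>\<^sup>2 / B > 0" using B by simp
    with cau obtain K where K: "\<And>m n. m \<ge> K \<Longrightarrow> n \<ge> K \<Longrightarrow> norm (t m - t n) < \<epsilon>\<^sup>2 / B"
      using CauchyD by blast
    have half: "l2_norm M (\<lambda>x. lincomb f c m x - lincomb f c n x) < \<epsilon>" if "n \<le> m" "n \<ge> K" for m n
    proof -
      have "(l2_norm M (\<lambda>x. lincomb f c m x - lincomb f c n x))\<^sup>2 \<le> B * (t m - t n)" by (rule key[OF that(1)])
      also have "\<dots> < B * (\<epsilon>\<^sup>2 / B)" using K[of m n] that B by (intro mult_strict_left_mono) auto
      finally show ?thesis using B e by (intro power2_less_imp_less[of _ \<epsilon>]) auto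
    qed
    have "l2_norm M (\<lambda>x. lincomb f c m x - lincomb f c n x) < \<epsilon>" if "m \<ge> K" "n \<ge> K" for m n
      using half[of n m] half[of m n] that l2_norm_minus_commute[of M "lincomb f c m"] by (cases "n \<le> m") auto
    thus "\<exists>N. \<forall>m\<ge>N. \<forall>n\<ge>N. l2_norm M (\<lambda>x. lincomb f c m x - lincomb f c n x) < \<epsilon>" by blast
  qed
  thus "\<exists>s. l2_sums M f c s" using l2_sums_iff_tendsto[of f M c, OF fL] by blast
qed

text \<open>The synthesis and analysis operators are adjoint, so a bound for one is a bound for the other.\<close>

lemma riesz_upper_bessel_sequence:
  assumes B: "riesz_upper M f B" "B > 0"
  shows "bessel_sequence M f"
  unfolding bessel_sequence_def
proof (intro exI[of _ B] conjI B ballI)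
  fix g assume g: "g \<in> l2_space M"
  let ?c = "\<lambda>j. l2_inner M g (f j)"
  have bound: "(\<Sum>j\<in>cube N. (cmod (?c j))\<^sup>2) \<le> B * (l2_norm M g)\<^sup>2" for N
  proof -
    define X where "X = (\<Sum>j\<in>cube N. (cmod (?c j))\<^sup>2)"
    have X0: "X \<ge> 0" unfolding X_def by (intro sum_nonneg) auto
    have "l2_inner M g (lincomb f ?c N) = (\<Sum>j\<in>cube N. cnj (?c j) * ?c j)"
      unfolding lincomb_def by (intro l2_inner_lincomb_right fL g)
    also have "\<dots> = complex_of_real X"
      unfolding X_def of_real_sum by (intro sum.cong refl, subst complex_norm_square) (rule mult.commute)
    finally have "X = cmod (l2_inner M g (lincomb f ?c N))" using X0 by simp
    also have "\<dots> \<le> l2_norm M g * l2_norm M (lincomb f ?c N)"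
      by (intro l2_cauchy_schwarz g lincomb_l2 fL)
    finally have "X\<^sup>2 \<le> (l2_norm M g * l2_norm M (lincomb f ?c N))\<^sup>2" using X0 by (intro power_mono)
    also have "\<dots> \<le> (l2_norm M g)\<^sup>2 * (B * X)"
      using B(1) unfolding riesz_upper_def X_def power_mult_distrib by (intro mult_left_mono) auto
    finally have "X * X \<le> (B * (l2_norm M g)\<^sup>2) * X" by (simp add: power2_eq_square mult_ac)
    thus ?thesis using X0 B unfolding X_def[symmetric] by (cases "X = 0") (auto simp: mult_le_cancel_right)
  qed
  show "(\<lambda>j. (cmod (?c j))\<^sup>2) summable_on UNIV" "(\<Sum>\<^sub>\<infinity>j. (cmod (?c j))\<^sup>2) \<le> B * (l2_norm M g)\<^sup>2"
    by (rule summable_on_if_cube_bounded[OF _ bound], simp)+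
qed

lemma bessel_sequence_riesz_upper:
  assumes "bessel_sequence M f"
  obtains B where "B > 0" "riesz_upper M f B"
proof -
  obtain B where B: "B > 0" and S: "\<And>g. g \<in> l2_space M \<Longrightarrow> (\<lambda>j. (cmod (l2_inner M g (f j)))\<^sup>2) summable_on UNIV"
    and le: "\<And>g. g \<in> l2_space M \<Longrightarrow> (\<Sum>\<^sub>\<infinity>j. (cmod (l2_inner M g (f j)))\<^sup>2) \<le> B * (l2_norm M g)\<^sup>2"
    using assms unfolding bessel_sequence_def by blast
  have "(l2_norm M (lincomb f c N))\<^sup>2 \<le> B * (\<Sum>j\<in>cube N. (cmod (c j))\<^sup>2)" for c N
  proof -
    let ?S = "lincomb f c N"
    have SL: "?S \<in> l2_space M" by (rule lincomb_l2[OF fL])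
    define X where "X = (l2_norm M ?S)\<^sup>2"
    define Y where "Y = (\<Sum>j\<in>cube N. (cmod (c j))\<^sup>2)"
    have Y0: "Y \<ge> 0" unfolding Y_def by (intro sum_nonneg) auto
    have X0: "X \<ge> 0" by (simp add: X_def)
    have "complex_of_real X = l2_inner M ?S ?S" by (simp add: X_def l2_inner_self)
    also have "\<dots> = (\<Sum>j\<in>cube N. c j * l2_inner M (f j) ?S)"
    proof -
      have "l2_inner M (\<lambda>x. \<Sum>j\<in>cube N. c j * f j x) ?S = (\<Sum>j\<in>cube N. c j * l2_inner M (f j) ?S)"
        by (rule l2_inner_lincomb_left[OF fL SL])
      thus ?thesis by (simp add: lincomb_def[abs_def])
    qed
    finally have "cmod (complex_of_real X) = cmod (\<Sum>j\<in>cube N. c j * l2_inner M (f j) ?S)" by simp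
    also have "\<dots> \<le> (\<Sum>j\<in>cube N. cmod (c j) * cmod (l2_inner M ?S (f j)))"
      by (rule norm_sum[THEN order_trans])
         (simp add: norm_mult l2_inner_commute[of M "f _" ?S])
    finally have "X \<le> (\<Sum>j\<in>cube N. cmod (c j) * cmod (l2_inner M ?S (f j)))" using X0 by simp
    hence "X\<^sup>2 \<le> (\<Sum>j\<in>cube N. cmod (c j) * cmod (l2_inner M ?S (f j)))\<^sup>2" using X0 by (intro power_mono)
    also have "\<dots> \<le> Y * (\<Sum>j\<in>cube N. (cmod (l2_inner M ?S (f j)))\<^sup>2)"
      unfolding Y_def by (rule Cauchy_Schwarz_ineq_sum)
    also have "\<dots> \<le> Y * (B * X)"
    proof (rule mult_left_mono[OF _ Y0])
      have "(\<Sum>j\<in>cube N. (cmod (l2_inner M ?S (f j)))\<^sup>2) \<le> (\<Sum>\<^sub>\<infinity>j. (cmod (l2_inner M ?S (f j)))\<^sup>2)"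
        by (intro finite_sum_le_infsum S SL finite_cube) auto
      thus "(\<Sum>j\<in>cube N. (cmod (l2_inner M ?S (f j)))\<^sup>2) \<le> B * X" using le[OF SL] by (simp add: X_def)
    qed
    finally have "X * X \<le> (B * Y) * X" by (simp add: power2_eq_square mult_ac)
    thus ?thesis using X0 Y0 B unfolding X_def[symmetric] Y_def[symmetric]
      by (cases "X = 0") (auto simp: mult_le_cancel_right)
  qed
  with B that show thesis by (auto simp: riesz_upper_def)
qed

end

lemma orthonormal_besselian:
  assumes on: "orthonormal_on M f (UNIV :: ('n::finite) idx set)"
  shows "besselian M f"
  unfolding besselian_def
proof (intro allI impI)
  fix c assume "\<exists>s. l2_sums M f c s"
  then obtain s where "l2_tendsto M (lincomb f c) s"
    using l2_sums_iff_tendsto[of f M c] orthonormal_in_l2[OF on] by auto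
  hence "(\<lambda>N. (l2_norm M (lincomb f c N))\<^sup>2) \<longlonglongrightarrow> (l2_norm M s)\<^sup>2"
    by (intro tendsto_power l2_tendsto_norm)
  moreover have "(l2_norm M (lincomb f c N))\<^sup>2 = (\<Sum>j\<in>cube N. (cmod (c j))\<^sup>2)" for N
    unfolding lincomb_def by (rule orthonormal_norm_sq[OF on finite_cube]) simp
  ultimately have "(\<lambda>N. \<Sum>j\<in>cube N. (cmod (c j))\<^sup>2) \<longlonglongrightarrow> (l2_norm M s)\<^sup>2" by simp
  then obtain B where "\<And>N. norm (\<Sum>j\<in>cube N. (cmod (c j))\<^sup>2) \<le> B"
    using convergent_imp_bounded bounded_iff by (metis rangeI)
  hence "(\<Sum>j\<in>cube N. (cmod (c j))\<^sup>2) \<le> B" for N by (metis abs_le_D1 real_norm_def)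
  from summable_on_if_cube_bounded(1)[OF _ this] show "c \<in> ell2" by (simp add: ell2_def)
qed

section \<open>The weighted space on the circle\<close>

abbreviation expo :: "int \<Rightarrow> real \<Rightarrow> complex" where
  "expo m \<equiv> chr (real_of_int m)"

definition trig_poly :: "(int \<Rightarrow> complex) \<Rightarrow> int set \<Rightarrow> real \<Rightarrow> complex" where
  "trig_poly a F s = (\<Sum>m\<in>F. a m * expo m s)"

lemma trig_poly_measurable [measurable]: "trig_poly a F \<in> borel_measurable borel"
  unfolding trig_poly_def[abs_def] by measurable

lemma bij_int_lattice: "bij_betw real_of_int UNIV (lattice :: real set)"
proof (rule bij_betwI')
  fix x :: real assume "x \<in> lattice"
  hence "x \<in> \<int>" by (simp add: lattice_def)
  thus "\<exists>m\<in>UNIV. x = real_of_int m" by (auto elim: Ints_cases)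
qed auto

lemma expo_orthonormal: "orthonormal_on torus expo UNIV"
  by (rule orthonormal_on_reindex[OF chr_orthonormal bij_int_lattice])

lemma expo_spanning: "l2_spanning torus expo UNIV"
  by (rule l2_spanning_reindex[OF chr_spanning bij_int_lattice])

lemma trig_poly_norm_torus: "finite F \<Longrightarrow> (l2_norm torus (trig_poly a F))\<^sup>2 = (\<Sum>m\<in>F. (cmod (a m))\<^sup>2)"
  unfolding trig_poly_def[abs_def] by (rule orthonormal_norm_sq[OF expo_orthonormal]) auto

lemma trig_poly_l2_torus: "trig_poly a F \<in> l2_space torus"
  unfolding trig_poly_def[abs_def] by (intro l2_space_lincomb chr_in_l2_torus)

lemma int_interval_exhausts: "finite F0 \<Longrightarrow> \<exists>N. \<forall>n\<ge>N. F0 \<subseteq> {- int n..int n}"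
proof -
  assume fin: "finite F0"
  show ?thesis
  proof (intro exI[of _ "Max (insert 0 ((\<lambda>m. nat \<bar>m\<bar>) ` F0))"] allI impI subsetI)
    fix n m assume n: "Max (insert 0 ((\<lambda>m. nat \<bar>m\<bar>) ` F0)) \<le> n" and m: "m \<in> F0"
    have "nat \<bar>m\<bar> \<le> Max (insert 0 ((\<lambda>m. nat \<bar>m\<bar>) ` F0))" using fin m by (intro Max_ge) auto
    thus "m \<in> {- int n..int n}" using n by auto
  qed
qed

lemma fourier_series_tendsto:
  assumes "u \<in> l2_space torus"
  shows "l2_tendsto torus (\<lambda>N. trig_poly (\<lambda>m. l2_inner torus u (expo m)) {- int N..int N}) u"
  unfolding trig_poly_def[abs_def]
  by (rule orthonormal_l2_tendsto[OF expo_orthonormal expo_spanning assms]) (auto intro: int_interval_exhausts)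

definition weighted :: "(real \<Rightarrow> real) \<Rightarrow> real measure" where
  "weighted W = density torus (\<lambda>s. ennreal (W s))"

definition central_coeffs :: "(int \<Rightarrow> complex) \<Rightarrow> 'n::finite idx \<Rightarrow> complex" where
  "central_coeffs a j = (case j of (k, l, m) \<Rightarrow> if k = 0 \<and> l = 0 then a m else 0)"

text \<open>The projection of the cube to the coordinates \<open>(k,l)\<close>, which index the orthogonal blocks.\<close>

definition cube2 :: "nat \<Rightarrow> ((int^'n::finite) \<times> (int^'n)) set" where
  "cube2 N = {(k, l). (\<forall>i. \<bar>k $ i\<bar> \<le> int N) \<and> (\<forall>i. \<bar>l $ i\<bar> \<le> int N)}"

lemma sum_cube:
  "(\<Sum>j\<in>(cube N :: ('n::finite) idx set). f j) = (\<Sum>p\<in>cube2 N. \<Sum>m\<in>{- int N..int N}. f (fst p, snd p, m))"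
  and finite_cube2: "finite (cube2 N :: ((int^'n) \<times> (int^'n)) set)"
proof -
  let ?h = "\<lambda>(p :: (int^'n) \<times> (int^'n), m). (fst p, snd p, m)"
  have im: "cube N = ?h ` (cube2 N \<times> {- int N..int N})"
  proof safe
    fix k l :: "int^'n" and m assume "(k, l, m) \<in> cube N"
    thus "(k, l, m) \<in> ?h ` (cube2 N \<times> {- int N..int N})"
      by (intro image_eqI[of _ _ "((k, l), m)"]) (auto simp: cube_def cube2_def)
  next
    fix k l :: "int^'n" and m assume "(k, l) \<in> cube2 N" "m \<in> {- int N..int N}"
    thus "(fst (k, l), snd (k, l), m) \<in> cube N" by (auto simp: cube_def cube2_def)
  qed
  have "cube2 N \<subseteq> (\<lambda>(k, l, m). (k, l)) ` (cube N :: 'n idx set)"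
  proof
    fix p :: "(int^'n) \<times> (int^'n)" assume "p \<in> cube2 N"
    thus "p \<in> (\<lambda>(k, l, m). (k, l)) ` (cube N :: 'n idx set)"
      by (intro image_eqI[of _ _ "(fst p, snd p, 0)"]) (auto simp: cube_def cube2_def)
  qed
  thus fin: "finite (cube2 N :: ((int^'n) \<times> (int^'n)) set)"
    by (rule finite_subset) (intro finite_imageI finite_cube)
  have "inj_on ?h (cube2 N \<times> {- int N..int N})" by (auto simp: inj_on_def)
  hence "(\<Sum>j\<in>cube N. f j) = (\<Sum>q\<in>cube2 N \<times> {- int N..int N}. f (?h q))"
    unfolding im by (subst sum.reindex) auto
  thus "(\<Sum>j\<in>(cube N :: 'n idx set). f j) = (\<Sum>p\<in>cube2 N. \<Sum>m\<in>{- int N..int N}. f (fst p, snd p, m))"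
    by (simp add: sum.cartesian_product case_prod_beta')
qed

lemma zero_in_cube2: "(0, 0) \<in> (cube2 N :: ((int^'n::finite) \<times> (int^'n)) set)"
  by (simp add: cube2_def)

section \<open>Translates and exponentials\<close>

context
  fixes W :: "real \<Rightarrow> real"
  assumes W0: "\<And>s. 0 \<le> W s" and Wi: "integrable torus W"
begin

lemma weight_measurable: "W \<in> borel_measurable borel"
  using borel_measurable_integrable[OF Wi] by simp

lemma sets_weighted: "sets (weighted W) = sets borel"
  by (simp add: weighted_def)

lemma measurable_weighted: "f \<in> borel_measurable (weighted W) \<longleftrightarrow> f \<in> borel_measurable borel"
  by (rule measurable_cong_sets[OF sets_weighted refl, THEN arg_cong])

lemma nn_integral_weighted:
  assumes "f \<in> borel_measurable borel"
  shows "(\<integral>\<^sup>+s. f s \<partial>weighted W) = (\<integral>\<^sup>+s. ennreal (W s) * f s \<partial>torus)"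
proof -
  note [measurable] = weight_measurable assms
  show ?thesis unfolding weighted_def by (subst nn_integral_density) auto
qed

lemma integral_weighted:
  fixes f :: "real \<Rightarrow> complex"
  assumes "f \<in> borel_measurable borel"
  shows "(LINT s|weighted W. f s) = (LINT s|torus. complex_of_real (W s) * f s)"
proof -
  note [measurable] = weight_measurable assms
  show ?thesis unfolding weighted_def by (subst integral_density) (auto simp: W0 scaleR_conv_of_real)
qed

lemma AE_weighted: "(AE s in weighted W. P s) \<longleftrightarrow> (AE s in torus. 0 < W s \<longrightarrow> P s)"
proof -
  note [measurable] = weight_measurable
  show ?thesis unfolding weighted_def by (subst AE_density) auto
qed

lemma AE_torus_weighted: "(AE s in torus. P s) \<Longrightarrow> (AE s in weighted W. P s)"
  unfolding AE_weighted by (auto elim: eventually_mono)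

lemma finite_measure_weighted: "finite_measure (weighted W)"
proof
  have "emeasure (weighted W) (space (weighted W)) = (\<integral>\<^sup>+s. 1 \<partial>weighted W)" by simp
  also have "\<dots> = (\<integral>\<^sup>+s. ennreal (W s) \<partial>torus)" by (subst nn_integral_weighted) auto
  also have "\<dots> = ennreal (LINT s|torus. W s)" by (intro nn_integral_eq_integral Wi) (auto simp: W0)
  finally show "emeasure (weighted W) (space (weighted W)) \<noteq> \<infinity>" by simp
qed

lemma expo_l2_weighted: "expo m \<in> l2_space (weighted W)"
  by (rule chr_in_l2[OF finite_measure_weighted sets_weighted AE_torus_weighted[OF AE_torus_box]])

lemma trig_poly_l2_weighted: "trig_poly a F \<in> l2_space (weighted W)"
  unfolding trig_poly_def[abs_def] by (intro l2_space_lincomb expo_l2_weighted)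

lemma expo_spanning_weighted: "l2_spanning (weighted W) expo UNIV"
  by (rule l2_spanning_reindex[OF trigonometric_spanning[OF finite_measure_weighted sets_weighted AE_torus_weighted[OF AE_torus_box]] bij_int_lattice])

lemma l2_weighted_bounded:
  assumes B: "AE s in torus. W s \<le> B" "0 \<le> B" and u: "u \<in> l2_space torus"
  shows "u \<in> l2_space (weighted W)" and "(l2_norm (weighted W) u)\<^sup>2 \<le> B * (l2_norm torus u)\<^sup>2"
proof -
  have um [measurable]: "u \<in> borel_measurable borel" using l2_measurable[OF u] by simp
  have "nn_sq (weighted W) u = (\<integral>\<^sup>+s. ennreal (W s) * ennreal ((cmod (u s))\<^sup>2) \<partial>torus)"
    by (rule nn_integral_weighted) measurable
  also have "\<dots> \<le> (\<integral>\<^sup>+s. ennreal B * ennreal ((cmod (u s))\<^sup>2) \<partial>torus)"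
    using B(1) by (intro nn_integral_mono_AE) (auto elim!: eventually_mono intro!: mult_right_mono ennreal_leI)
  also have "\<dots> = ennreal (B * (l2_norm torus u)\<^sup>2)"
    by (simp add: nn_integral_cmult l2_nn_integral[OF u] ennreal_mult[OF B(2)])
  finally have le: "nn_sq (weighted W) u \<le> ennreal (B * (l2_norm torus u)\<^sup>2)" .
  show L: "u \<in> l2_space (weighted W)"
    by (rule l2_spaceI_nn[OF _ order.strict_trans1[OF le]]) (auto simp: measurable_weighted um)
  show "(l2_norm (weighted W) u)\<^sup>2 \<le> B * (l2_norm torus u)\<^sup>2"
    using le B(2) unfolding l2_nn_integral[OF L] by (subst (asm) ennreal_le_iff) auto
qed

text \<open>The assumption on the Gram matrix is the form in which condition C is used from here on.\<close>

context
  fixes \<phi> :: "'n::finite heis \<Rightarrow> complex"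
  assumes \<phi>: "\<phi> \<in> l2_space lborel"
    and gram: "\<And>k l m k' l' m'. l2_inner lborel (translates \<phi> (k, l, m)) (translates \<phi> (k', l', m')) =
      (if k = k' \<and> l = l' then l2_inner (weighted W) (expo m) (expo m') else 0)"
begin

lemma translates_phi_l2: "translates \<phi> j \<in> l2_space lborel"
  by (rule translates_l2[OF \<phi>])

text \<open>The blocks are orthogonal, and within each the Gram matrix is that of the exponentials.\<close>

lemma lincomb_translates_norm:
  "(l2_norm lborel (lincomb (translates \<phi>) c N))\<^sup>2 =
    (\<Sum>p\<in>cube2 N. (l2_norm (weighted W) (trig_poly (\<lambda>m. c (fst p, snd p, m)) {- int N..int N}))\<^sup>2)"
proof -
  let ?I = "{- int N..int N}"
  let ?e = "\<lambda>m m'. l2_inner (weighted W) (expo m) (expo m')"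
  have "complex_of_real ((l2_norm lborel (lincomb (translates \<phi>) c N))\<^sup>2) =
      (\<Sum>i\<in>cube N. \<Sum>j\<in>cube N. c i * cnj (c j) * l2_inner lborel (translates \<phi> i) (translates \<phi> j))"
    unfolding lincomb_def[abs_def] by (rule l2_norm_lincomb_sq[OF translates_phi_l2])
  also have "\<dots> = (\<Sum>p\<in>cube2 N. \<Sum>m\<in>?I. \<Sum>p'\<in>cube2 N. \<Sum>m'\<in>?I.
      c (fst p, snd p, m) * cnj (c (fst p', snd p', m')) *
        l2_inner lborel (translates \<phi> (fst p, snd p, m)) (translates \<phi> (fst p', snd p', m')))"
    unfolding sum_cube ..
  also have "\<dots> = (\<Sum>p\<in>cube2 N. \<Sum>m\<in>?I. \<Sum>p'\<in>cube2 N.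
      if p = p' then (\<Sum>m'\<in>?I. c (fst p, snd p, m) * cnj (c (fst p, snd p, m')) * ?e m m') else 0)"
    unfolding gram by (intro sum.cong refl) (auto simp: prod_eq_iff)
  also have "\<dots> = (\<Sum>p\<in>cube2 N. \<Sum>m\<in>?I. \<Sum>m'\<in>?I. c (fst p, snd p, m) * cnj (c (fst p, snd p, m')) * ?e m m')"
    by (intro sum.cong refl) (simp add: finite_cube2)
  also have "\<dots> = (\<Sum>p\<in>cube2 N. complex_of_real ((l2_norm (weighted W) (trig_poly (\<lambda>m. c (fst p, snd p, m)) ?I))\<^sup>2))"
    unfolding trig_poly_def[abs_def] by (intro sum.cong refl l2_norm_lincomb_sq[symmetric] expo_l2_weighted)
  finally show ?thesis by (simp only: of_real_sum[symmetric] of_real_eq_iff)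
qed

lemma lincomb_translates_norm_ge:
  "l2_norm (weighted W) (trig_poly (\<lambda>m. c (0, 0, m)) {- int N..int N}) \<le> l2_norm lborel (lincomb (translates \<phi>) c N)"
proof -
  have "(l2_norm (weighted W) (trig_poly (\<lambda>m. c (0, 0, m)) {- int N..int N}))\<^sup>2 \<le> (l2_norm lborel (lincomb (translates \<phi>) c N))\<^sup>2"
    unfolding lincomb_translates_norm
    using member_le_sum[OF zero_in_cube2[of N], of "\<lambda>p. (l2_norm (weighted W) (trig_poly (\<lambda>m. c (fst p, snd p, m)) {- int N..int N}))\<^sup>2"]
    by (simp add: finite_cube2)
  thus ?thesis by (rule power2_le_imp_le) simp
qed

lemma lincomb_central_coeffs_norm:
  "l2_norm lborel (lincomb (translates \<phi>) (central_coeffs a) N) = l2_norm (weighted W) (trig_poly a {- int N..int N})"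
proof -
  have z: "l2_norm (weighted W) (trig_poly (\<lambda>m. central_coeffs a (fst p, snd p, m)) {- int N..int N}) =
      (if p = (0, 0) then l2_norm (weighted W) (trig_poly a {- int N..int N}) else 0)" for p :: "(int^'n) \<times> (int^'n)"
    by (cases p) (auto simp: central_coeffs_def trig_poly_def[abs_def] l2_norm_def)
  have "(l2_norm lborel (lincomb (translates \<phi>) (central_coeffs a) N))\<^sup>2 =
      (\<Sum>p\<in>(cube2 N :: ((int^'n) \<times> (int^'n)) set). if p = (0, 0) then (l2_norm (weighted W) (trig_poly a {- int N..int N}))\<^sup>2 else 0)"
    unfolding lincomb_translates_norm z by (intro sum.cong) auto
  also have "\<dots> = (l2_norm (weighted W) (trig_poly a {- int N..int N}))\<^sup>2"
    using zero_in_cube2[of N, where 'n = 'n] by (simp add: finite_cube2)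
  finally show ?thesis by simp
qed

lemma central_coeffs_ell2:
  assumes "\<And>F. finite F \<Longrightarrow> (\<Sum>m\<in>F. (cmod (a m))\<^sup>2) \<le> B"
  shows "(central_coeffs a :: 'n idx \<Rightarrow> complex) \<in> ell2"
proof -
  have "(\<Sum>j\<in>cube N. (cmod (central_coeffs a (j :: 'n idx)))\<^sup>2) \<le> B" for N
  proof -
    have "(\<Sum>j\<in>cube N. (cmod (central_coeffs a (j :: 'n idx)))\<^sup>2) =
        (\<Sum>p\<in>(cube2 N :: ((int^'n) \<times> (int^'n)) set). if p = (0, 0) then (\<Sum>m\<in>{- int N..int N}. (cmod (a m))\<^sup>2) else 0)"
      unfolding sum_cube by (intro sum.cong refl) (auto simp: central_coeffs_def prod_eq_iff)
    also have "\<dots> = (\<Sum>m\<in>{- int N..int N}. (cmod (a m))\<^sup>2)"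
      using zero_in_cube2[of N, where 'n = 'n] by (simp add: finite_cube2)
    finally show ?thesis using assms[of "{- int N..int N}"] by simp
  qed
  from summable_on_if_cube_bounded(1)[OF _ this] show ?thesis by (simp add: ell2_def)
qed

lemma fourier_coefficients_ell2:
  assumes "u \<in> l2_space torus"
  shows "(central_coeffs (\<lambda>m. l2_inner torus u (expo m)) :: 'n idx \<Rightarrow> complex) \<in> ell2"
  by (rule central_coeffs_ell2[where B = "(l2_norm torus u)\<^sup>2"], rule orthonormal_bessel[OF expo_orthonormal]) (auto simp: assms)

lemma bounded_weight_riesz_upper:
  assumes B: "AE s in torus. W s \<le> B" "0 \<le> B"
  shows "riesz_upper lborel (translates \<phi>) B"
  unfolding riesz_upper_def
proof (intro allI)
  fix c N
  let ?I = "{- int N..int N}"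
  have "(l2_norm lborel (lincomb (translates \<phi>) c N))\<^sup>2 \<le> (\<Sum>p\<in>cube2 N. B * (\<Sum>m\<in>?I. (cmod (c (fst p, snd p, m)))\<^sup>2))"
    unfolding lincomb_translates_norm
    by (rule sum_mono, subst trig_poly_norm_torus[symmetric, OF finite_atLeastAtMost_int]) (rule l2_weighted_bounded(2)[OF B trig_poly_l2_torus])
  thus "(l2_norm lborel (lincomb (translates \<phi>) c N))\<^sup>2 \<le> B * (\<Sum>j\<in>cube N. (cmod (c j))\<^sup>2)"
    unfolding sum_cube by (simp add: sum_distrib_left)
qed

text \<open>Every \<open>q\<close> is the squared modulus of some \<open>u\<close> in \<open>L\<^sup>2(0,1]\<close>. Its Fourier coefficients, placed on the centre, give a
  convergent series of translates, so the partial sums of the Fourier series are bounded in the weighted space.\<close>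

lemma hilbertian_bounded_weight:
  assumes H: "hilbertian lborel (translates \<phi>)"
  shows "\<exists>B. AE s in torus. ennreal (W s) \<le> ennreal B"
proof (rule AE_bounded_by_duality[OF finite_measure_torus])
  note [measurable] = weight_measurable
  show "(\<lambda>s. ennreal (W s)) \<in> borel_measurable torus" by measurable
  fix q :: "real \<Rightarrow> ennreal" assume q: "q \<in> borel_measurable torus" and qi: "(\<integral>\<^sup>+s. q s \<partial>torus) < \<infinity>"
  have [measurable]: "q \<in> borel_measurable borel" using q by simp
  have qf: "AE s in torus. q s \<noteq> \<infinity>" using qi q by (intro nn_integral_noteq_infinite) auto
  define u where "u = (\<lambda>s. complex_of_real (sqrt (enn2real (q s))))"
  have um [measurable]: "u \<in> borel_measurable borel" unfolding u_def by measurable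
  have uq: "ennreal ((cmod (u s))\<^sup>2) = q s" if "q s \<noteq> \<infinity>" for s
    using that by (simp add: u_def ennreal_enn2real less_top)
  have "nn_sq torus u = (\<integral>\<^sup>+s. q s \<partial>torus)"
    using qf by (intro nn_integral_cong_AE) (auto elim!: eventually_mono simp: uq)
  hence uL: "u \<in> l2_space torus" using qi by (intro l2_spaceI_nn) auto
  let ?a = "\<lambda>m. l2_inner torus u (expo m)"
  have "(central_coeffs ?a :: 'n idx \<Rightarrow> complex) \<in> ell2" by (rule fourier_coefficients_ell2[OF uL])
  then obtain s where "l2_sums lborel (translates \<phi>) (central_coeffs ?a) s" using H unfolding hilbertian_def by blast
  hence "l2_tendsto lborel (lincomb (translates \<phi>) (central_coeffs ?a)) s" by (simp add: l2_sums_iff_tendsto[of "translates \<phi>", OF translates_phi_l2])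
  hence "convergent (\<lambda>N. l2_norm (weighted W) (trig_poly ?a {- int N..int N}))"
    using l2_tendsto_norm unfolding lincomb_central_coeffs_norm[symmetric] convergent_def by blast
  hence "Bseq (\<lambda>N. l2_norm (weighted W) (trig_poly ?a {- int N..int N}))" by (rule convergent_imp_Bseq)
  then obtain C where C: "\<And>N. l2_norm (weighted W) (trig_poly ?a {- int N..int N}) \<le> C"
    unfolding Bseq_def by (metis abs_le_D1 real_norm_def)
  obtain r :: "nat \<Rightarrow> nat" where "strict_mono r"
    and r: "AE s in torus. (\<lambda>n. trig_poly ?a {- int (r n)..int (r n)} s) \<longlonglongrightarrow> u s"
    using l2_tendsto_AE_subseq[OF fourier_series_tendsto[OF uL]] .
  have uW: "u \<in> l2_space (weighted W)"
    by (rule l2_fatou(1)[OF trig_poly_l2_weighted _ AE_torus_weighted[OF r] C]) (simp add: measurable_weighted um)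
  have "(\<integral>\<^sup>+s. q s * ennreal (W s) \<partial>torus) = (\<integral>\<^sup>+s. ennreal (W s) * ennreal ((cmod (u s))\<^sup>2) \<partial>torus)"
    using qf by (intro nn_integral_cong_AE) (auto elim!: eventually_mono simp: uq mult.commute)
  also have "\<dots> = nn_sq (weighted W) u"
    by (rule nn_integral_weighted[symmetric]) measurable
  also have "\<dots> < \<infinity>" by (simp add: l2_nn_integral[OF uW])
  finally show "(\<integral>\<^sup>+s. q s * ennreal (W s) \<partial>torus) < \<infinity>" .
qed

lemma V_spaceI:
  assumes "l2_tendsto lborel \<psi> f" "\<And>n. \<exists>J c. finite J \<and> \<psi> n = (\<lambda>X. \<Sum>j\<in>J. c j * translates \<phi> j X)"
  shows "f \<in> V_space \<phi>"
  unfolding V_space_def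
proof (intro CollectI conjI allI impI)
  show "f \<in> l2_space lborel" by (rule l2_tendstoD(2)[OF assms(1)])
  fix \<epsilon> :: real assume "\<epsilon> > 0"
  then obtain n where n: "l2_norm lborel (\<lambda>X. \<psi> n X - f X) < \<epsilon>"
    using LIMSEQ_D[OF l2_tendstoD(3)[OF assms(1)]] by fastforce
  obtain J c where J: "finite J" "\<psi> n = (\<lambda>X. \<Sum>j\<in>J. c j * translates \<phi> j X)" using assms(2)[of n] by blast
  show "\<exists>J c. finite J \<and> l2_norm lborel (\<lambda>X. f X - (\<Sum>j\<in>J. c j * translates \<phi> j X)) < \<epsilon>"
    using n J(1) unfolding J(2) by (intro exI[of _ J] exI[of _ c]) (simp add: l2_norm_minus_commute[of lborel f])
qed

lemma lincomb_central_coeffs: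
  "lincomb (translates \<phi>) (central_coeffs a) N = (\<lambda>X. \<Sum>m\<in>{- int N..int N}. a m * translates \<phi> (0, 0, m) X)"
proof
  fix X
  have "lincomb (translates \<phi>) (central_coeffs a) N X = (\<Sum>p\<in>(cube2 N :: ((int^'n) \<times> (int^'n)) set). if p = (0, 0) then
      (\<Sum>m\<in>{- int N..int N}. a m * translates \<phi> (0, 0, m) X) else 0)"
    unfolding lincomb_def sum_cube by (intro sum.cong refl) (auto simp: central_coeffs_def prod_eq_iff)
  thus "lincomb (translates \<phi>) (central_coeffs a) N X = (\<Sum>m\<in>{- int N..int N}. a m * translates \<phi> (0, 0, m) X)"
    using zero_in_cube2[of N, where 'n = 'n] by (simp add: finite_cube2)
qed

lemma translates_central: "translates (translates \<phi> (0, 0, m)) (k, l, p) = translates \<phi> (k, l, p + m)"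
  by (simp add: left_translate_mult)

lemma translates_lincomb:
  "translates (\<lambda>X. \<Sum>m\<in>F. a m * translates \<phi> (0, 0, m) X) (k, l, p) = (\<lambda>X. \<Sum>m\<in>F. a m * translates \<phi> (k, l, p + m) X)"
proof -
  have "translates (\<lambda>X. \<Sum>m\<in>F. a m * translates \<phi> (0, 0, m) X) (k, l, p) =
      (\<lambda>X. \<Sum>m\<in>F. a m * translates (translates \<phi> (0, 0, m)) (k, l, p) X)"
    by (simp add: left_translate_def)
  thus ?thesis unfolding translates_central .
qed

lemma gram_lincomb:
  "l2_inner lborel (translates (\<lambda>X. \<Sum>m\<in>F. a m * translates \<phi> (0, 0, m) X) (k, l, p))
      (translates (\<lambda>X. \<Sum>m\<in>F. a m * translates \<phi> (0, 0, m) X) (k', l', p')) =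
    (if k = k' \<and> l = l' then l2_inner (weighted W) (\<lambda>s. expo p s * trig_poly a F s) (\<lambda>s. expo p' s * trig_poly a F s) else 0)"
proof -
  let ?L = "\<lambda>k l p X. \<Sum>m\<in>F. a m * translates \<phi> (k, l, p + m) X"
  let ?E = "\<lambda>p s. \<Sum>m\<in>F. a m * expo (p + m) s"
  have E: "(\<lambda>s. expo p s * trig_poly a F s) = ?E p" for p
    by (simp add: trig_poly_def sum_distrib_left chr_add mult_ac fun_eq_iff)
  have "l2_inner lborel (?L k l p) (?L k' l' p') =
      (\<Sum>m\<in>F. a m * (\<Sum>m'\<in>F. cnj (a m') * l2_inner lborel (translates \<phi> (k, l, p + m)) (translates \<phi> (k', l', p' + m'))))"
    by (subst l2_inner_lincomb_left[OF translates_phi_l2 l2_space_lincomb[OF translates_phi_l2]], intro sum.cong refl arg_cong2[where f = "(*)"], rule l2_inner_lincomb_right[OF translates_phi_l2 translates_phi_l2])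
  also have "\<dots> = (if k = k' \<and> l = l' then
      (\<Sum>m\<in>F. a m * (\<Sum>m'\<in>F. cnj (a m') * l2_inner (weighted W) (expo (p + m)) (expo (p' + m')))) else 0)"
    unfolding gram by (cases "k = k' \<and> l = l'") auto
  also have "(\<Sum>m\<in>F. a m * (\<Sum>m'\<in>F. cnj (a m') * l2_inner (weighted W) (expo (p + m)) (expo (p' + m')))) =
      l2_inner (weighted W) (?E p) (?E p')"
    by (subst l2_inner_lincomb_left[OF expo_l2_weighted l2_space_lincomb[OF expo_l2_weighted]], intro sum.cong refl arg_cong2[where f = "(*)"],
        rule l2_inner_lincomb_right[OF expo_l2_weighted expo_l2_weighted, symmetric])
  finally show ?thesis unfolding translates_lincomb E .
qed

text \<open>With \<open>h = W\<^bsup>-1/2\<^esup>\<close>, the Fourier series of \<open>h\<close> converges in the weighted space too, because the weight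
  is bounded. In the limit, the entries of the Gram matrix within a block become
  \<open>\<integral>|h|\<^sup>2 W e\<^bsup>2\<pi>i(p-p')s\<^esup> ds\<close>, and \<open>|h|\<^sup>2 W = 1\<close>.\<close>

lemma exists_orthonormal_translates:
  assumes B: "AE s in torus. W s \<le> B" "0 < B"
    and pos: "AE s in torus. 0 < W s" and inv: "(\<integral>\<^sup>+s. ennreal (1 / W s) \<partial>torus) < \<infinity>"
  obtains \<phi>' where "\<phi>' \<in> V_space \<phi>" "orthonormal_on lborel (translates \<phi>') UNIV"
proof -
  note [measurable] = weight_measurable
  have B0: "0 \<le> B" using B(2) by simp
  define h where "h = (\<lambda>s. complex_of_real (sqrt (1 / W s)))"
  have hm [measurable]: "h \<in> borel_measurable borel" unfolding h_def by measurable
  have hsq: "(cmod (h s))\<^sup>2 = 1 / W s" for s using W0[of s] by (simp add: h_def real_sqrt_pow2)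
  have hL: "h \<in> l2_space torus" using inv by (intro l2_spaceI_nn) (auto simp: hsq)
  let ?a = "\<lambda>m. l2_inner torus h (expo m)"
  let ?I = "\<lambda>N. {- int N..int N}"
  have conv: "l2_tendsto torus (\<lambda>N. trig_poly ?a (?I N)) h" by (rule fourier_series_tendsto[OF hL])
  have convW: "l2_tendsto (weighted W) (\<lambda>N. trig_poly ?a (?I N)) h"
  proof -
    have "(\<lambda>N. l2_norm (weighted W) (\<lambda>s. trig_poly ?a (?I N) s - h s)) \<longlonglongrightarrow> 0"
    proof (rule Lim_null_comparison)
      show "(\<lambda>N. sqrt B * l2_norm torus (\<lambda>s. trig_poly ?a (?I N) s - h s)) \<longlonglongrightarrow> 0"
        using tendsto_mult_left[OF l2_tendstoD(3)[OF conv], of "sqrt B"] by simp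
      have "l2_norm (weighted W) (\<lambda>s. trig_poly ?a (?I N) s - h s) \<le> sqrt B * l2_norm torus (\<lambda>s. trig_poly ?a (?I N) s - h s)" for N
      proof (rule power2_le_imp_le)
        show "(l2_norm (weighted W) (\<lambda>s. trig_poly ?a (?I N) s - h s))\<^sup>2 \<le> (sqrt B * l2_norm torus (\<lambda>s. trig_poly ?a (?I N) s - h s))\<^sup>2"
          using l2_weighted_bounded(2)[OF B(1) B0 l2_space_diff[OF trig_poly_l2_torus hL]] B0 by (simp add: power_mult_distrib)
      qed (simp add: B0)
      thus "\<forall>\<^sub>F N in sequentially. norm (l2_norm (weighted W) (\<lambda>s. trig_poly ?a (?I N) s - h s)) \<le> sqrt B * l2_norm torus (\<lambda>s. trig_poly ?a (?I N) s - h s)"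
        by simp
    qed
    thus ?thesis using trig_poly_l2_weighted l2_weighted_bounded(1)[OF B(1) B0 hL] by (simp add: l2_tendsto_def)
  qed
  have "hilbertian lborel (translates \<phi>)"
    by (rule riesz_upper_hilbertian[OF translates_phi_l2 bounded_weight_riesz_upper[OF B(1) B0] B(2)])
  then obtain \<phi>' where "l2_sums lborel (translates \<phi>) (central_coeffs ?a) \<phi>'"
    using fourier_coefficients_ell2[OF hL] unfolding hilbertian_def by blast
  hence lim: "l2_tendsto lborel (\<lambda>N X. \<Sum>m\<in>?I N. ?a m * translates \<phi> (0, 0, m) X) \<phi>'"
    unfolding l2_sums_iff_tendsto[of "translates \<phi>", OF translates_phi_l2] lincomb_central_coeffs[abs_def] .
  have \<phi>'L: "\<phi>' \<in> l2_space lborel" by (rule l2_tendstoD(2)[OF lim])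
  have V: "\<phi>' \<in> V_space \<phi>"
  proof (rule V_spaceI[OF lim])
    fix N
    have "(\<lambda>X. \<Sum>m\<in>?I N. ?a m * translates \<phi> (0, 0, m) X) = (\<lambda>X. \<Sum>j\<in>cube N. central_coeffs ?a j * translates \<phi> j X)"
      unfolding lincomb_central_coeffs[symmetric] by (simp add: lincomb_def[abs_def])
    thus "\<exists>J c. finite J \<and> (\<lambda>X. \<Sum>m\<in>?I N. ?a m * translates \<phi> (0, 0, m) X) = (\<lambda>X. \<Sum>j\<in>J. c j * translates \<phi> j X)"
      using finite_cube by blast
  qed
  let ?S = "\<lambda>N X. \<Sum>m\<in>?I N. ?a m * translates \<phi> (0, 0, m) X"
  have tr: "l2_tendsto lborel (\<lambda>N. translates (?S N) j) (translates \<phi>' j)" for j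
  proof -
    obtain k l p where j: "j = (k, l, p)" by (cases j)
    let ?\<gamma> = "(2 *\<^sub>R of_int_vec k, of_int_vec l, real_of_int p)"
    have "l2_norm lborel (\<lambda>X. left_translate ?\<gamma> (?S N) X - left_translate ?\<gamma> \<phi>' X) = l2_norm lborel (\<lambda>X. ?S N X - \<phi>' X)" for N
    proof -
      have "(\<lambda>X. ?S N X - \<phi>' X) \<in> borel_measurable borel"
        using l2_measurable[OF l2_space_diff[OF l2_tendstoD(1)[OF lim, of N] \<phi>'L]] by simp
      from l2_norm_left_translate[OF this, of ?\<gamma>] show ?thesis by (simp add: left_translate_def)
    qed
    hence "(\<lambda>N. l2_norm lborel (\<lambda>X. left_translate ?\<gamma> (?S N) X - left_translate ?\<gamma> \<phi>' X)) \<longlonglongrightarrow> 0"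
      using l2_tendstoD(3)[OF lim] by simp
    moreover have "left_translate ?\<gamma> (?S N) \<in> l2_space lborel" for N
      by (rule l2_space_left_translate[OF l2_tendstoD(1)[OF lim]])
    ultimately show ?thesis using l2_space_left_translate[OF \<phi>'L, of ?\<gamma>]
      unfolding j translates.simps[of _ k l p] l2_tendsto_def by blast
  qed
  have "l2_inner lborel (translates \<phi>' i) (translates \<phi>' j) = (if i = j then 1 else 0)" for i j
  proof -
    obtain k l p where i: "i = (k, l, p)" by (cases i)
    obtain k' l' p' where j: "j = (k', l', p')" by (cases j)
    have 1: "(\<lambda>N. l2_inner lborel (translates (?S N) i) (translates (?S N) j)) \<longlonglongrightarrow> l2_inner lborel (translates \<phi>' i) (translates \<phi>' j)"
      by (rule l2_tendsto_inner[OF tr tr])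
    show ?thesis
    proof (cases "k = k' \<and> l = l'")
      case False
      hence "(\<lambda>N. l2_inner lborel (translates (?S N) i) (translates (?S N) j)) = (\<lambda>N. 0)"
        unfolding i j gram_lincomb by auto
      with 1 have "l2_inner lborel (translates \<phi>' i) (translates \<phi>' j) = 0"
        using LIMSEQ_unique[OF _ tendsto_const] by simp
      thus ?thesis using False i j by auto
    next
      case True
      have e: "l2_tendsto (weighted W) (\<lambda>N s. expo q s * trig_poly ?a (?I N) s) (\<lambda>s. expo q s * h s)" for q
        by (rule l2_tendsto_bounded_mult[OF convW, where B = 1]) (auto simp: measurable_weighted)
      have "(\<lambda>N. l2_inner lborel (translates (?S N) i) (translates (?S N) j)) =
          (\<lambda>N. l2_inner (weighted W) (\<lambda>s. expo p s * trig_poly ?a (?I N) s) (\<lambda>s. expo p' s * trig_poly ?a (?I N) s))"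
        using True unfolding i j gram_lincomb by simp
      with 1 l2_tendsto_inner[OF e[of p] e[of p']]
      have "l2_inner lborel (translates \<phi>' i) (translates \<phi>' j) = l2_inner (weighted W) (\<lambda>s. expo p s * h s) (\<lambda>s. expo p' s * h s)"
        using LIMSEQ_unique by simp
      also have "\<dots> = (LINT s|torus. complex_of_real (W s) * (expo p s * h s * cnj (expo p' s * h s)))"
        unfolding l2_inner_def by (rule integral_weighted) measurable
      also have "\<dots> = l2_inner torus (expo p) (expo p')"
        unfolding l2_inner_def
      proof (rule integral_cong_AE)
        show "AE s in torus. complex_of_real (W s) * (expo p s * h s * cnj (expo p' s * h s)) = expo p s * cnj (expo p' s)"
          using pos
        proof eventually_elim
          case (elim s)
          have "h s * cnj (h s) = complex_of_real (1 / W s)" unfolding hsq[symmetric] by (rule complex_norm_square[symmetric])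
          hence "complex_of_real (W s) * (h s * cnj (h s)) = 1" using elim by simp
          thus ?case by (simp add: mult_ac)
        qed
      qed measurable
      also have "\<dots> = (if p = p' then 1 else 0)" using expo_orthonormal by (simp add: orthonormal_on_def)
      finally show ?thesis using True i j by simp
    qed
  qed
  hence "orthonormal_on lborel (translates \<phi>') UNIV"
    using translates_l2[OF \<phi>'L] by (simp add: orthonormal_on_def)
  with V that show thesis by blast
qed

text \<open>For \<open>h = (q/W)\<^bsup>1/2\<^esup>\<close> in the weighted space, \<open>\<integral>q/W\<close> is the squared norm of \<open>h\<close> in
  \<open>L\<^sup>2(0,1]\<close>. The coefficients that the Besselian property controls in \<open>\<ell>\<^sup>2\<close> are those of an expansion of the element of
  \<open>V(\<phi>)\<close> that corresponds to \<open>h\<close>; they also approximate \<open>h\<close> in the weighted space.\<close>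

lemma besselian_bounded_inverse_weight:
  assumes bes: "besselian lborel (translates \<phi>)"
    and expand: "\<And>\<psi>. \<psi> \<in> V_space \<phi> \<Longrightarrow> \<exists>c. l2_sums lborel (translates \<phi>) c \<psi>"
    and pos: "AE s in torus. 0 < W s"
  shows "\<exists>B. AE s in torus. inverse (ennreal (W s)) \<le> ennreal B"
proof (rule AE_bounded_by_duality[OF finite_measure_torus])
  note [measurable] = weight_measurable
  show "(\<lambda>s. inverse (ennreal (W s))) \<in> borel_measurable torus" by measurable
  fix q :: "real \<Rightarrow> ennreal" assume q: "q \<in> borel_measurable torus" and qi: "(\<integral>\<^sup>+s. q s \<partial>torus) < \<infinity>"
  have [measurable]: "q \<in> borel_measurable borel" using q by simp
  have qf: "AE s in torus. q s \<noteq> \<infinity>" using qi q by (intro nn_integral_noteq_infinite) auto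
  define h where "h = (\<lambda>s. complex_of_real (sqrt (enn2real (q s) / W s)))"
  have hm [measurable]: "h \<in> borel_measurable borel" unfolding h_def by measurable
  have hsq: "(cmod (h s))\<^sup>2 = enn2real (q s) / W s" for s using W0[of s] by (simp add: h_def real_sqrt_pow2)
  have "nn_sq (weighted W) h = (\<integral>\<^sup>+s. ennreal (W s) * ennreal ((cmod (h s))\<^sup>2) \<partial>torus)"
    by (rule nn_integral_weighted) measurable
  also have "\<dots> = (\<integral>\<^sup>+s. q s \<partial>torus)"
    by (intro nn_integral_cong_AE, use qf pos in eventually_elim)
       (simp add: hsq ennreal_mult[symmetric] less_top)
  finally have hW: "h \<in> l2_space (weighted W)" using qi by (intro l2_spaceI_nn) (auto simp: measurable_weighted)
  have "\<exists>F a. finite F \<and> l2_norm (weighted W) (\<lambda>s. h s - trig_poly a F s) < 1 / real (Suc n)" for n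
    using expo_spanning_weighted[unfolded l2_spanning_def, rule_format, OF hW, of "1 / real (Suc n)"]
    by (auto simp: trig_poly_def)
  then obtain F a where F: "\<And>n. finite (F n)" "\<And>n. l2_norm (weighted W) (\<lambda>s. h s - trig_poly (a n) (F n) s) < 1 / real (Suc n)"
    by metis
  have convF: "l2_tendsto (weighted W) (\<lambda>n. trig_poly (a n) (F n)) h"
  proof -
    have "(\<lambda>n. l2_norm (weighted W) (\<lambda>s. trig_poly (a n) (F n) s - h s)) \<longlonglongrightarrow> 0"
      by (rule Lim_null_comparison[OF _ LIMSEQ_inverse_real_of_nat])
         (use F(2) in \<open>auto simp: l2_norm_minus_commute[of _ _ h] inverse_eq_divide less_imp_le\<close>)
    thus ?thesis using hW trig_poly_l2_weighted by (simp add: l2_tendsto_def)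
  qed
  \<comment> \<open>Padding with zeros puts polynomials with different frequencies over a common interval, hence over a common cube.\<close>
  define A where "A = (\<lambda>n m. if m \<in> F n then a n m else 0)"
  have trig_ext: "trig_poly (A n) {- int R..int R} = trig_poly (a n) (F n)" if "F n \<subseteq> {- int R..int R}" for n R
    unfolding trig_poly_def[abs_def] A_def using that
    by (intro ext sum.mono_neutral_cong_right) auto
  have "\<exists>R. F n \<subseteq> {- int R..int R}" for n using int_interval_exhausts[OF F(1)] by blast
  then obtain R where R: "\<And>n. F n \<subseteq> {- int (R n)..int (R n)}" by metis
  define \<psi> where "\<psi> = (\<lambda>n. lincomb (translates \<phi>) (central_coeffs (A n)) (R n))"
  have \<psi>_ext: "\<psi> n = lincomb (translates \<phi>) (central_coeffs (A n)) R'" if "R n \<le> R'" for n R'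
  proof -
    have "central_coeffs (A n) j = 0" if "j \<notin> cube (R n)" "j \<in> cube R'" for j :: "'n idx"
    proof -
      obtain k l m where j: "j = (k, l, m)" by (cases j)
      have "k = 0 \<and> l = 0 \<longrightarrow> m \<notin> F n" using R[of n] that(1) by (auto simp: j cube_def abs_le_iff subset_iff)
      thus ?thesis by (auto simp: central_coeffs_def j A_def)
    qed
    thus ?thesis unfolding \<psi>_def lincomb_def[abs_def]
      using cube_mono[OF that] by (intro ext sum.mono_neutral_left finite_cube) auto
  qed
  have \<psi>L: "\<psi> n \<in> l2_space lborel" for n unfolding \<psi>_def by (rule lincomb_l2[OF translates_phi_l2])
  have lin: "lincomb (translates \<phi>) c N X - lincomb (translates \<phi>) d N X = lincomb (translates \<phi>) (\<lambda>j. c j - d j) N X" for c d N X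
    by (simp add: lincomb_def sum_subtractf left_diff_distrib)
  have ax: "central_coeffs (\<lambda>m. b m - b' m) = (\<lambda>j. central_coeffs b j - central_coeffs b' j :: complex)" for b b'
    by (auto simp: central_coeffs_def fun_eq_iff)
  have trig_diff: "trig_poly (\<lambda>m. b m - b' m) K s = trig_poly b K s - trig_poly b' K s" for b b' K s
    by (simp add: trig_poly_def sum_subtractf left_diff_distrib)
  obtain f where f: "l2_tendsto lborel \<psi> f"
  proof (rule l2_complete[OF \<psi>L])
    fix \<epsilon> :: real assume "\<epsilon> > 0"
    have "l2_norm lborel (\<lambda>X. \<psi> m X - \<psi> n X) = l2_norm (weighted W) (\<lambda>s. trig_poly (a m) (F m) s - trig_poly (a n) (F n) s)" for m n
    proof -
      let ?R = "max (R m) (R n)"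
      have sub: "F m \<subseteq> {- int ?R..int ?R}" "F n \<subseteq> {- int ?R..int ?R}"
        using R[of m] R[of n] by (fastforce simp: subset_iff)+
      have "l2_norm lborel (\<lambda>X. \<psi> m X - \<psi> n X) = l2_norm lborel (lincomb (translates \<phi>) (central_coeffs (\<lambda>k. A m k - A n k)) ?R)"
        unfolding \<psi>_ext[of m ?R, OF max.cobounded1] \<psi>_ext[of n ?R, OF max.cobounded2] lin ax ..
      also have "\<dots> = l2_norm (weighted W) (\<lambda>s. trig_poly (a m) (F m) s - trig_poly (a n) (F n) s)"
        unfolding lincomb_central_coeffs_norm trig_diff[abs_def] trig_ext[OF sub(1)] trig_ext[OF sub(2)] ..
      finally show ?thesis .
    qed
    thus "\<exists>N. \<forall>m\<ge>N. \<forall>n\<ge>N. l2_norm lborel (\<lambda>x. \<psi> m x - \<psi> n x) < \<epsilon>"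
      using l2_tendsto_Cauchy[OF convF \<open>\<epsilon> > 0\<close>] by simp
  qed
  have "f \<in> V_space \<phi>"
  proof (rule V_spaceI[OF f])
    show "\<exists>J c. finite J \<and> \<psi> n = (\<lambda>X. \<Sum>j\<in>J. c j * translates \<phi> j X)" for n
      unfolding \<psi>_def lincomb_def[abs_def] using finite_cube by blast
  qed
  then obtain c where c: "l2_sums lborel (translates \<phi>) c f" using expand by blast
  hence cell: "c \<in> ell2" using bes unfolding besselian_def by blast
  have cf: "l2_tendsto lborel (lincomb (translates \<phi>) c) f"
    using c l2_sums_iff_tendsto[of "translates \<phi>", OF translates_phi_l2] by simp
  define b where "b = (\<lambda>m. c (0, 0, m))"
  let ?P = "\<lambda>N. trig_poly b {- int N..int N}"
  \<comment> \<open>Discarding the blocks other than \<open>k = l = 0\<close> does not increase the norm.\<close>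
  have le: "l2_norm (weighted W) (\<lambda>s. ?P N s - h s) \<le> l2_norm lborel (\<lambda>X. lincomb (translates \<phi>) c N X - f X)" for N
  proof (rule LIMSEQ_le)
    have "l2_tendsto (weighted W) (\<lambda>n s. ?P N s - trig_poly (a n) (F n) s) (\<lambda>s. ?P N s - h s)"
      using l2_tendsto_add[OF l2_tendsto_const[OF trig_poly_l2_weighted[of b "{- int N..int N}"]] l2_tendsto_cmult[OF convF, of "-1"]] by simp
    from l2_tendsto_norm[OF this]
    show "(\<lambda>n. l2_norm (weighted W) (\<lambda>s. ?P N s - trig_poly (a n) (F n) s)) \<longlonglongrightarrow> l2_norm (weighted W) (\<lambda>s. ?P N s - h s)" .
    have "l2_tendsto lborel (\<lambda>n X. lincomb (translates \<phi>) c N X - \<psi> n X) (\<lambda>X. lincomb (translates \<phi>) c N X - f X)"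
      using l2_tendsto_add[OF l2_tendsto_const[OF l2_tendstoD(1)[OF cf, of N]] l2_tendsto_cmult[OF f, of "-1"]] by simp
    from l2_tendsto_norm[OF this]
    show "(\<lambda>n. l2_norm lborel (\<lambda>X. lincomb (translates \<phi>) c N X - \<psi> n X)) \<longlonglongrightarrow> l2_norm lborel (\<lambda>X. lincomb (translates \<phi>) c N X - f X)" .
    have "l2_norm (weighted W) (\<lambda>s. ?P N s - trig_poly (a n) (F n) s) \<le> l2_norm lborel (\<lambda>X. lincomb (translates \<phi>) c N X - \<psi> n X)" for n
    proof -
      let ?R = "max N (R n)"
      define c' where "c' = (\<lambda>j. if j \<in> cube N then c j else 0)"
      define d where "d = (\<lambda>j. c' j - central_coeffs (A n) j)"
      have "lincomb (translates \<phi>) c N = lincomb (translates \<phi>) c' ?R"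
        unfolding lincomb_def[abs_def] c'_def using cube_mono[OF max.cobounded1, of N "R n"]
        by (intro ext sum.mono_neutral_cong_left finite_cube) auto
      hence S: "(\<lambda>X. lincomb (translates \<phi>) c N X - \<psi> n X) = lincomb (translates \<phi>) d ?R"
        unfolding \<psi>_ext[of n ?R, OF max.cobounded2] d_def by (simp add: lin fun_eq_iff)
      have sub: "F n \<subseteq> {- int ?R..int ?R}" using R[of n] by (fastforce simp: subset_iff)
      have "trig_poly (\<lambda>m. c' (0, 0, m)) {- int ?R..int ?R} = ?P N"
        unfolding trig_poly_def[abs_def] c'_def b_def
        by (intro ext sum.mono_neutral_cong_right) (auto simp: cube_def)
      moreover have "(\<lambda>m. d (0, 0, m)) = (\<lambda>m. c' (0, 0, m) - A n m)" by (simp add: d_def central_coeffs_def)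
      ultimately have "trig_poly (\<lambda>m. d (0, 0, m)) {- int ?R..int ?R} = (\<lambda>s. ?P N s - trig_poly (a n) (F n) s)"
        by (simp add: trig_diff[abs_def] trig_ext[OF sub])
      thus ?thesis unfolding S using lincomb_translates_norm_ge[of d ?R] by simp
    qed
    thus "\<exists>M. \<forall>n\<ge>M. l2_norm (weighted W) (\<lambda>s. ?P N s - trig_poly (a n) (F n) s) \<le> l2_norm lborel (\<lambda>X. lincomb (translates \<phi>) c N X - \<psi> n X)"
      by blast
  qed
  have "(\<lambda>N. l2_norm (weighted W) (\<lambda>s. ?P N s - h s)) \<longlonglongrightarrow> 0"
    by (rule Lim_null_comparison[OF _ l2_tendstoD(3)[OF cf]]) (use le in auto)
  hence "l2_tendsto (weighted W) ?P h" using hW trig_poly_l2_weighted by (simp add: l2_tendsto_def)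
  then obtain r :: "nat \<Rightarrow> nat" where "strict_mono r" and r: "AE s in weighted W. (\<lambda>n. ?P (r n) s) \<longlonglongrightarrow> h s"
    by (rule l2_tendsto_AE_subseq)
  have rT: "AE s in torus. (\<lambda>n. ?P (r n) s) \<longlonglongrightarrow> h s"
    using r[unfolded AE_weighted] pos by eventually_elim simp
  have summ: "(\<lambda>j. (cmod (c j))\<^sup>2) summable_on UNIV" using cell by (simp add: ell2_def)
  have bd: "l2_norm torus (?P N) \<le> sqrt (\<Sum>\<^sub>\<infinity>j. (cmod (c j))\<^sup>2)" for N
  proof (rule real_le_rsqrt)
    have "(l2_norm torus (?P N))\<^sup>2 = (\<Sum>m\<in>{- int N..int N}. (cmod (c (0, 0, m)))\<^sup>2)"
      by (simp add: trig_poly_norm_torus b_def)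
    also have "\<dots> = (\<Sum>j\<in>(\<lambda>m. (0, 0, m)) ` {- int N..int N}. (cmod (c j))\<^sup>2)"
      by (subst sum.reindex) (auto simp: inj_on_def)
    also have "\<dots> \<le> (\<Sum>\<^sub>\<infinity>j. (cmod (c j))\<^sup>2)" by (intro finite_sum_le_infsum summ) auto
    finally show "(l2_norm torus (?P N))\<^sup>2 \<le> (\<Sum>\<^sub>\<infinity>j. (cmod (c j))\<^sup>2)" .
  qed
  have hT: "h \<in> l2_space torus"
    by (rule l2_fatou(1)[OF trig_poly_l2_torus _ rT bd]) simp
  have "(\<integral>\<^sup>+s. q s * inverse (ennreal (W s)) \<partial>torus) = nn_sq torus h"
  proof (intro nn_integral_cong_AE, use qf pos in eventually_elim)
    case (elim s)
    have "q s = ennreal (enn2real (q s))" using elim by (simp add: less_top)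
    thus ?case using elim by (metis divide_inverse enn2real_nonneg ennreal_mult inverse_ennreal hsq less_imp_le positive_imp_inverse_positive)
  qed
  also have "\<dots> < \<infinity>" by (simp add: l2_nn_integral[OF hT])
  finally show "(\<integral>\<^sup>+s. q s * inverse (ennreal (W s)) \<partial>torus) < \<infinity>" .
qed

end

end

lemma ennreal_inverse_inverse: "inverse (inverse (x :: ennreal)) = x"
proof (cases x)
  case (real r)
  thus ?thesis by (cases "r = 0") (auto simp: inverse_ennreal)
qed simp

text \<open>Integrability of the reciprocal includes its measurability, and inversion is an involution on
  \<open>[0,\<infinity>]\<close>. The essential supremum of a function that is not measurable is \<open>\<infinity>\<close> by convention.\<close>

lemma G00_measurable:
  assumes "integrable_unit (\<lambda>s. inverse (G00 \<phi> s))"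
  shows "G00 \<phi> \<in> borel_measurable unit_interval"
proof -
  have [measurable]: "(\<lambda>s. inverse (G00 \<phi> s)) \<in> borel_measurable unit_interval"
    using assms unfolding integrable_unit_def by blast
  have "(\<lambda>s. inverse (inverse (G00 \<phi> s))) \<in> borel_measurable unit_interval" by measurable
  thus ?thesis by (simp only: ennreal_inverse_inverse)
qed

lemma Linf_norm_finite_iff:
  assumes v: "v \<in> borel_measurable unit_interval" and eq: "AE s in torus. v s = w s"
  shows "Linf_norm v < \<infinity> \<longleftrightarrow> (\<exists>B. AE s in torus. w s \<le> ennreal B)"
proof
  assume fin: "Linf_norm v < \<infinity>"
  then obtain B where B: "Linf_norm v = ennreal B" by (cases "Linf_norm v") auto
  have "AE s in torus. v s \<le> ennreal B"
    using esssup_AE[of v unit_interval] B unfolding AE_unit_interval_iff Linf_norm_def by simp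
  hence "AE s in torus. w s \<le> ennreal B" using eq by eventually_elim simp
  thus "\<exists>B. AE s in torus. w s \<le> ennreal B" ..
next
  assume "\<exists>B. AE s in torus. w s \<le> ennreal B"
  then obtain B where "AE s in torus. w s \<le> ennreal B" ..
  hence "AE s in torus. v s \<le> ennreal B" using eq by eventually_elim simp
  hence "Linf_norm v \<le> ennreal B"
    unfolding Linf_norm_def AE_unit_interval_iff[symmetric] using v by (intro esssup_I)
  thus "Linf_norm v < \<infinity>" by (rule order.strict_trans1) simp
qed

theorem theorem6p5:
  fixes \<phi> :: "'n::finite heis \<Rightarrow> complex"
  assumes "\<phi> \<in> l2_space lborel"
    and "condition_C \<phi>"
    and "integrable_unit (\<lambda>s. inverse (G00 \<phi> s))"
  shows "(hilbertian lborel (translates \<phi>) \<longleftrightarrow> Linf_norm (G00 \<phi>) < \<infinity>) \<and>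
         (Linf_norm (G00 \<phi>) < \<infinity> \<longleftrightarrow> bessel_sequence lborel (translates \<phi>)) \<and>
         (hilbertian lborel (translates \<phi>) \<or> Linf_norm (G00 \<phi>) < \<infinity> \<or>
            bessel_sequence lborel (translates \<phi>) \<longrightarrow>
          (\<exists>\<phi>'\<in>V_space \<phi>. besselian lborel (translates \<phi>'))) \<and>
         (besselian lborel (translates \<phi>) \<and>
            (\<forall>\<psi>\<in>V_space \<phi>. \<exists>c. l2_sums lborel (translates \<phi>) c \<psi>) \<longrightarrow>
          Linf_norm (\<lambda>s. inverse (G00 \<phi> s)) < \<infinity>)"
proof -
  obtain W where W: "\<And>s. 0 \<le> W s" "integrable torus W" and GW: "AE s in torus. G00 \<phi> s = ennreal (W s)"
    and gram0: "\<And>k l m k' l' m'. l2_inner lborel (translates \<phi> (k, l, m)) (translates \<phi> (k', l', m')) =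
      (if k = k' \<and> l = l' then LINT s|torus. complex_of_real (W s) * (expo m s * cnj (expo m' s)) else 0)"
    by (rule translates_gram[OF assms(1,2)]) blast
  note [measurable] = weight_measurable[OF W]
  have "l2_inner (weighted W) (expo m) (expo m') = (LINT s|torus. complex_of_real (W s) * (expo m s * cnj (expo m' s)))" for m m'
    unfolding l2_inner_def by (rule integral_weighted[OF W]) measurable
  hence gram: "l2_inner lborel (translates \<phi> (k, l, m)) (translates \<phi> (k', l', m')) =
      (if k = k' \<and> l = l' then l2_inner (weighted W) (expo m) (expo m') else 0)" for k l m k' l' m'
    unfolding gram0 by simp
  note translates_phi_l2 = translates_l2[OF assms(1)]
  have b_iff: "Linf_norm (G00 \<phi>) < \<infinity> \<longleftrightarrow> (\<exists>B. AE s in torus. ennreal (W s) \<le> ennreal B)"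
    by (rule Linf_norm_finite_iff[OF G00_measurable[OF assms(3)] GW])
  have inv_meas: "(\<lambda>s. inverse (G00 \<phi> s)) \<in> borel_measurable unit_interval"
    using assms(3) by (simp add: integrable_unit_def)
  have invW: "AE s in torus. inverse (G00 \<phi> s) = inverse (ennreal (W s))" using GW by eventually_elim simp
  have b_bound: "\<exists>B>0. AE s in torus. W s \<le> B" if "Linf_norm (G00 \<phi>) < \<infinity>"
  proof -
    obtain B where "AE s in torus. ennreal (W s) \<le> ennreal B" using \<open>Linf_norm (G00 \<phi>) < \<infinity>\<close> b_iff by blast
    hence "AE s in torus. W s \<le> max B 1"
    proof eventually_elim
      case (elim s)
      thus ?case using W(1)[of s] by (cases "B \<ge> 0") (auto simp: ennreal_neg le_max_iff_disj)
    qed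
    thus ?thesis by (intro exI[of _ "max B 1"]) simp
  qed
  have a_b: "Linf_norm (G00 \<phi>) < \<infinity>" if "hilbertian lborel (translates \<phi>)"
    using hilbertian_bounded_weight[OF W assms(1) gram that] b_iff by blast
  have upper: "\<exists>B>0. riesz_upper lborel (translates \<phi>) B" if "Linf_norm (G00 \<phi>) < \<infinity>"
    using b_bound[OF that] bounded_weight_riesz_upper[OF W assms(1) gram] less_imp_le by blast
  have b_a: "hilbertian lborel (translates \<phi>)" if "Linf_norm (G00 \<phi>) < \<infinity>"
    using upper[OF that] riesz_upper_hilbertian[where f = "translates \<phi>", OF translates_phi_l2] by blast
  have b_c: "bessel_sequence lborel (translates \<phi>)" if "Linf_norm (G00 \<phi>) < \<infinity>"
    using upper[OF that] riesz_upper_bessel_sequence[where f = "translates \<phi>", OF translates_phi_l2] by blast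
  have c_a: "hilbertian lborel (translates \<phi>)" if "bessel_sequence lborel (translates \<phi>)"
    using bessel_sequence_riesz_upper[where f = "translates \<phi>", OF translates_phi_l2 that]
      riesz_upper_hilbertian[where f = "translates \<phi>", OF translates_phi_l2] by blast
  have fin: "(\<integral>\<^sup>+s. inverse (ennreal (W s)) \<partial>torus) < \<infinity>"
  proof -
    have "(\<integral>\<^sup>+s. inverse (G00 \<phi> s) \<partial>unit_interval) = (\<integral>\<^sup>+s. inverse (ennreal (W s)) \<partial>unit_interval)"
      using invW by (intro nn_integral_cong_AE) (simp add: AE_unit_interval_iff)
    also have "\<dots> = (\<integral>\<^sup>+s. inverse (ennreal (W s)) \<partial>torus)"
      by (subst nn_integral_restrict_space) (auto simp: nn_integral_torus unit_box_real mult.commute)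
    finally show ?thesis using assms(3) by (simp add: integrable_unit_def)
  qed
  have pos: "AE s in torus. 0 < W s"
  proof -
    have "AE s in torus. inverse (ennreal (W s)) \<noteq> \<infinity>"
      using fin by (intro nn_integral_noteq_infinite) auto
    thus ?thesis
    proof eventually_elim
      case (elim s)
      thus ?case using W(1)[of s] by (cases "W s = 0") auto
    qed
  qed
  have d: "\<exists>\<phi>'\<in>V_space \<phi>. besselian lborel (translates \<phi>')" if Linf: "Linf_norm (G00 \<phi>) < \<infinity>"
  proof -
    obtain B where B: "B > 0" "AE s in torus. W s \<le> B" using b_bound[OF Linf] by blast
    have "(\<integral>\<^sup>+s. ennreal (1 / W s) \<partial>torus) = (\<integral>\<^sup>+s. inverse (ennreal (W s)) \<partial>torus)"
      by (intro nn_integral_cong_AE, use pos in eventually_elim) (simp add: inverse_ennreal inverse_eq_divide)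
    with fin have "(\<integral>\<^sup>+s. ennreal (1 / W s) \<partial>torus) < \<infinity>" by simp
    from exists_orthonormal_translates[OF W assms(1) gram B(2,1) pos this] obtain \<phi>'
      where "\<phi>' \<in> V_space \<phi>" "orthonormal_on lborel (translates \<phi>') UNIV" .
    thus ?thesis using orthonormal_besselian by blast
  qed
  have e: "Linf_norm (\<lambda>s. inverse (G00 \<phi> s)) < \<infinity>"
    if "besselian lborel (translates \<phi>)" "\<forall>\<psi>\<in>V_space \<phi>. \<exists>c. l2_sums lborel (translates \<phi>) c \<psi>"
    unfolding Linf_norm_finite_iff[OF inv_meas invW]
    by (rule besselian_bounded_inverse_weight[OF W assms(1) gram that(1) _ pos]) (use that(2) in blast)
  show ?thesis using a_b b_a b_c c_a d e by blast
qed

end
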